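(* Let $\alpha,\alpha',\beta,\beta',\gamma,\rho,p,b,c\in\mathbb{C}$ be such that $\kappa:=p+\frac{b+1}{2}\notin\{0,-1,-2,\ldots\}$. Suppose that $\operatorname{Re}(\gamma)>0$ and $\operatorname{Re}(\rho+p)>\max\{0,\operatorname{Re}(\alpha+\alpha'+\beta-\gamma),\operatorname{Re}(\alpha'-\beta')\}$. Then for every $x>0$, $$\left(I_{0,+}^{\alpha,\alpha',\beta,\beta',\gamma}\,t^{\rho-1}\mathcal{W}_{p,b,c}(t)\right)(x)=\frac{x^{\rho+p-\alpha-\alpha'+\gamma-1}}{2^{p}}\;{}_3\psi_4\left[\begin{array}{c}(\rho+p,2),\ (\rho+p+\gamma-\alpha-\alpha'-\beta,2),\ (\rho+p+\beta'-\alpha',2)\\ (\rho+p+\beta',2),\ (\rho+p+\gamma-\alpha-\alpha',2),\ (\rho+p+\gamma-\alpha'-\beta,2),\ (\kappa,1)\end{array}\bigg|-\frac{cx^2}{4}\right].$$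
   Context: Complex powers of positive reals are $y^{a}=\exp(a\log y)$. $(a)_n=a(a+1)\cdots(a+n-1)$, $(a)_0=1$, and $1/\Gamma$ is the entire reciprocal gamma function. Appell's third function (Horn's function) is $F_3(\alpha,\alpha',\beta,\beta';\gamma;u,v)=\sum_{m,n\ge0}\frac{(\alpha)_m(\alpha')_n(\beta)_m(\beta')_n}{(\gamma)_{m+n}\,m!\,n!}u^mv^n$ for $|u|,|v|<1$, extended by analytic continuation in $v$; explicitly, for $|u|<1$ and real $v<1$, $F_3=\sum_{m\ge0}\frac{(\alpha)_m(\beta)_m}{(\gamma)_m m!}u^m\,{}_2F_1(\alpha',\beta';\gamma+m;v)$, where ${}_2F_1$ is the Gauss hypergeometric function continued analytically to $\mathbb{C}\setminus[1,\infty)$. For $\operatorname{Re}(\gamma)>0$ and $x>0$, $$\left(I_{0,+}^{\alpha,\alpha',\beta,\beta',\gamma}f\right)(x)=\frac{x^{-\alpha}}{\Gamma(\gamma)}\int_0^x(x-t)^{\gamma-1}t^{-\alpha'}F_3\left(\alpha,\alpha',\beta,\beta';\gamma;1-\frac{t}{x},1-\frac{x}{t}\right)f(t)\,dt.$$ An expression in $t$ after the operator denotes the function $f(t)$ to which it is applied. The generalized Bessel function of the first kind is $\mathcal{W}_{p,b,c}(z)=\sum_{k=0}^\infty\frac{(-1)^kc^k}{\Gamma(p+\frac{b+1}{2}+k)\,k!}\left(\frac z2\right)^{2k+p}$. The generalized Wright function is ${}_r\psi_q\left[\begin{array}{c}(a_i,\alpha_i)_{1,r}\\(b_j,\beta_j)_{1,q}\end{array}\Big|z\right]=\sum_{k=0}^\infty\frac{\prod_{i=1}^r\Gamma(a_i+\alpha_ik)}{\prod_{j=1}^q\Gamma(b_j+\beta_jk)}\frac{z^k}{k!}$.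 *)

theory Defs
  imports "HOL-Complex_Analysis.Complex_Analysis"
begin

text \<open>
  The Gauss function on the plane cut along \<open>[1, \<infinity>)\<close>, as the analytic continuation of its power
  series. On the cut plane all functions admitted by \<open>SOME\<close> coincide, by the identity theorem;
  on the cut itself, and for \<open>c\<close> a non-positive integer, the value is meaningless.
\<close>

definition hyp2F1 :: "complex \<Rightarrow> complex \<Rightarrow> complex \<Rightarrow> complex \<Rightarrow> complex" where
  "hyp2F1 a b c =
     (SOME F. F holomorphic_on (- complex_of_real ` {1..}) \<and>
        (\<forall>z. norm z < 1 \<longrightarrow>
           F z = (\<Sum>n. pochhammer a n * pochhammer b n / (pochhammer c n * fact n) * z ^ n)))"

text \<open>
  Horn's function for \<open>|u| < 1\<close> and \<open>v\<close> in the cut plane. Since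
  \<open>(\<gamma>)\<^sub>m\<^sub>+\<^sub>n = (\<gamma>)\<^sub>m (\<gamma> + m)\<^sub>n\<close>, summing the double series over \<open>n\<close> first gives the Gauss function below;
  its continuation is the continuation of the double series in \<open>v\<close>.
\<close>

definition appell_F3 ::
  "complex \<Rightarrow> complex \<Rightarrow> complex \<Rightarrow> complex \<Rightarrow> complex \<Rightarrow> complex \<Rightarrow> complex \<Rightarrow> complex" where
  "appell_F3 \<alpha> \<alpha>' \<beta> \<beta>' \<gamma> u v =
     (\<Sum>m. pochhammer \<alpha> m * pochhammer \<beta> m / (pochhammer \<gamma> m * fact m) * u ^ m
            * hyp2F1 \<alpha>' \<beta>' (\<gamma> + of_nat m) v)"

definition saigo_maeda_kernel ::
  "complex \<Rightarrow> complex \<Rightarrow> complex \<Rightarrow> complex \<Rightarrow> complex \<Rightarrow> real \<Rightarrow> real \<Rightarrow> complex" where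
  "saigo_maeda_kernel \<alpha> \<alpha>' \<beta> \<beta>' \<gamma> x t =
     of_real (x - t) powr (\<gamma> - 1) * of_real t powr (- \<alpha>')
     * appell_F3 \<alpha> \<alpha>' \<beta> \<beta>' \<gamma> (of_real (1 - t / x)) (of_real (1 - x / t))"

definition saigo_maeda_I ::
  "complex \<Rightarrow> complex \<Rightarrow> complex \<Rightarrow> complex \<Rightarrow> complex \<Rightarrow> (real \<Rightarrow> complex) \<Rightarrow> real \<Rightarrow> complex" where
  "saigo_maeda_I \<alpha> \<alpha>' \<beta> \<beta>' \<gamma> f x =
     of_real x powr (- \<alpha>) / Gamma \<gamma>
     * (LINT t:{0<..<x}|lborel. saigo_maeda_kernel \<alpha> \<alpha>' \<beta> \<beta>' \<gamma> x t * f t)"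

definition gen_bessel :: "complex \<Rightarrow> complex \<Rightarrow> complex \<Rightarrow> complex \<Rightarrow> complex" where
  "gen_bessel p b c z =
     (\<Sum>k. (-1) ^ k * c ^ k * rGamma (p + (b + 1) / 2 + of_nat k) / fact k
            * (z / 2) powr (2 * of_nat k + p))"

definition wright_psi :: "(complex \<times> complex) list \<Rightarrow> (complex \<times> complex) list \<Rightarrow> complex \<Rightarrow> complex" where
  "wright_psi as bs z =
     (\<Sum>k. (\<Prod>(a, \<alpha>)\<leftarrow>as. Gamma (a + \<alpha> * of_nat k))
            * (\<Prod>(b, \<beta>)\<leftarrow>bs. rGamma (b + \<beta> * of_nat k))
            * z ^ k / fact k)"

end

theory Submission
  imports Defs "HOL-Real_Asymp.Real_Asymp"
begin

text \<open>
  Expand the Bessel function in powers: with \<open>s = \<rho> + p + 2k\<close> the claim follows from the value of the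
  operator on \<open>t\<^sup>s\<^sup>-\<^sup>1\<close>, and by scaling one may take \<open>x = 1\<close>. That value is a quotient of Gamma functions
  (\<open>mellin_appell_F3\<close>), obtained by two applications of Gauss's summation theorem. Write \<open>F\<^sub>3\<close> as a
  series in \<open>u = 1 - t\<close> whose \<open>m\<close>-th coefficient contains \<open>F(\<alpha>', \<beta>'; \<gamma> + m; 1 - 1/t)\<close>. By Pfaff's
  transformation this Gauss function is \<open>t\<close> to the power \<open>\<alpha>'\<close> times a power series in \<open>1 - t\<close>; Beta integrals followed
  by Gauss's theorem give its Mellin transform (\<open>mellin_hyp2F1\<close>). The resulting series over \<open>m\<close> is
  again a Gauss series at \<open>1\<close>, and summing it produces the remaining Gamma factors.

  Three points need an argument.

  (1) The Gauss function of the statement is a chosen continuation of its power series, so one must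
  show that a continuation to the cut plane exists. Euler's integral provides it when
  \<open>Re b > 1\<close> and \<open>Re (c - b) > 1\<close>, and contiguous relations, whose only denominators are \<open>c\<close> and
  \<open>c + 1\<close>, carry it to all \<open>a\<close>, \<open>b\<close> and all \<open>c\<close> with \<open>Re c > 0\<close>. Pfaff's transformation on the
  negative axis is carried along in the same induction, since the two sides satisfy the same relations.

  (2) Gauss's theorem is proved in a form regularised by the reciprocal Gamma function
  (\<open>gauss_summation\<close>), because parameters such as \<open>s + \<gamma> - \<alpha>'\<close> may be non-positive integers. It also
  yields the Beta integral for complex parameters.

  (3) Summation over \<open>m\<close> and integration over \<open>t\<close> must be interchanged. The absolute moments of the
  \<open>m\<close>-th term are of order \<open>m\<close> to the power \<open>- Re (s - \<alpha>')\<close> (\<open>hyp2F1_moment_bound\<close>), while the coefficients of \<open>u\<^sup>m\<close> are of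
  order \<open>m\<close> to the power \<open>Re (\<alpha> + \<beta> - \<gamma>) - 1\<close>; so the double sum converges absolutely when
  \<open>Re s > Re (\<alpha> + \<alpha>' + \<beta> - \<gamma>)\<close>, as assumed. Majorising the series in \<open>1 - t\<close> term by term gives
  the moment bound when \<open>Re \<alpha>' > 0\<close>, but loses too much when \<open>Re \<alpha>' < 0\<close>: for small \<open>t\<close> that are large
  compared with \<open>1/m\<close> the series is then small through cancellation. Contiguous relations reduce the general
  case to the first one.
\<close>

section \<open>Growth of Pochhammer symbols and of the reciprocal Gamma function\<close>

lemma half_plane_notin_nonpos_Ints:
  fixes c :: complex
  assumes "Re c > 0"
  shows "c \<notin> \<int>\<^sub>\<le>\<^sub>0"
  using assms by (auto elim!: nonpos_Ints_cases)

text \<open>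
  This is Gauss's product formula for the reciprocal Gamma function, renormalised by
  \<open>fact n * (n + 1) powr (Re a - 1)\<close>, which makes sense for \<open>n = 0\<close> too; so convergence gives bounds
  for every \<open>n\<close>. A lower bound needs a nonzero limit, which \<open>Re a > 0\<close> ensures.
\<close>

lemma norm_pochhammer_asymp:
  fixes a :: complex
  shows "(\<lambda>n. norm (pochhammer a n) / (fact n * (real n + 1) powr (Re a - 1))) \<longlonglongrightarrow> norm (rGamma a)"
proof -
  have 1: "(\<lambda>n. norm (rGamma_series a n)) \<longlonglongrightarrow> norm (rGamma a)"
    by (intro tendsto_norm rGamma_series_LIMSEQ)
  \<comment> \<open>The Gauss product at index n has n + 1 factors, so the two normalisations are
    compared at n and n + 1.\<close>
  have 2: "(\<lambda>n. real n powr Re a / ((real n + 1) * (real n + 2) powr (Re a - 1))) \<longlonglongrightarrow> 1"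
    by real_asymp
  have "(\<lambda>n. norm (rGamma_series a n) * (real n powr Re a / ((real n + 1) * (real n + 2) powr (Re a - 1))))
        \<longlonglongrightarrow> norm (rGamma a) * 1"
    by (rule tendsto_mult[OF 1 2])
  moreover have "\<forall>\<^sub>F n in sequentially.
      norm (rGamma_series a n) * (real n powr Re a / ((real n + 1) * (real n + 2) powr (Re a - 1)))
      = norm (pochhammer a (Suc n)) / (fact (Suc n) * (real (Suc n) + 1) powr (Re a - 1))"
    using eventually_gt_at_top[of 0]
  proof eventually_elim
    case (elim n)
    have "norm (exp (a * of_real (ln (real n)))) = real n powr Re a"
      using elim by (simp add: powr_def mult.commute)
    thus ?case using elim
      by (simp add: rGamma_series_def norm_divide norm_mult field_simps)
  qed
  ultimately have "(\<lambda>n. norm (pochhammer a (Suc n)) / (fact (Suc n) * (real (Suc n) + 1) powr (Re a - 1)))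
        \<longlonglongrightarrow> norm (rGamma a)"
    by (simp add: filterlim_cong)
  thus ?thesis by (subst (asm) filterlim_sequentially_Suc)
qed

lemma norm_pochhammer_upper:
  fixes a :: complex
  obtains C where "C > 0" "\<And>n. norm (pochhammer a n) \<le> C * (fact n * (real n + 1) powr (Re a - 1))"
proof -
  have "Bseq (\<lambda>n. norm (pochhammer a n) / (fact n * (real n + 1) powr (Re a - 1)))"
    using norm_pochhammer_asymp[of a] convergentI convergent_imp_Bseq by blast
  then obtain C where C: "C > 0" "\<And>n. norm (norm (pochhammer a n) / (fact n * (real n + 1) powr (Re a - 1))) \<le> C"
    by (auto elim!: BseqE)
  have "norm (pochhammer a n) \<le> C * (fact n * (real n + 1) powr (Re a - 1))" for n
    using C(2)[of n] by (simp add: pos_divide_le_eq)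
  with C(1) show ?thesis using that by blast
qed

lemma norm_pochhammer_lower:
  fixes a :: complex
  assumes "Re a > 0"
  obtains C where "C > 0" "\<And>n. fact n * (real n + 1) powr (Re a - 1) \<le> C * norm (pochhammer a n)"
proof -
  have na: "a \<notin> \<int>\<^sub>\<le>\<^sub>0" using assms by (rule half_plane_notin_nonpos_Ints)
  hence "norm (rGamma a) \<noteq> 0" by (simp add: rGamma_eq_zero_iff)
  hence "(\<lambda>n. inverse (norm (pochhammer a n) / (fact n * (real n + 1) powr (Re a - 1))))
      \<longlonglongrightarrow> inverse (norm (rGamma a))"
    by (intro tendsto_inverse norm_pochhammer_asymp)
  hence "Bseq (\<lambda>n. inverse (norm (pochhammer a n) / (fact n * (real n + 1) powr (Re a - 1))))"
    using convergentI convergent_imp_Bseq by blast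
  then obtain C where C: "C > 0"
    "\<And>n. norm (inverse (norm (pochhammer a n) / (fact n * (real n + 1) powr (Re a - 1)))) \<le> C"
    by (auto elim!: BseqE)
  have "fact n * (real n + 1) powr (Re a - 1) \<le> C * norm (pochhammer a n)" for n
  proof -
    have "pochhammer a n \<noteq> 0" using na by (auto simp: pochhammer_eq_0_iff)
    thus ?thesis using C(2)[of n] by (simp add: pos_divide_le_eq)
  qed
  with C(1) show ?thesis using that by blast
qed

text \<open>
  In the right half-plane the bound is the reciprocal of the lower bound for Pochhammer symbols. The functional
  equation costs a factor \<open>c + n\<close> of linear size, exactly what one step of \<open>c\<close> to the left allows,
  so the bound moves to all \<open>c\<close>, poles of Gamma included.
\<close>

lemma norm_rGamma_upper:
  fixes c :: complex
  obtains C where "C > 0" "\<And>n. norm (rGamma (c + of_nat n)) \<le> C * ((real n + 1) powr (1 - Re c) / fact n)"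
proof -
  have main: "\<exists>C>0. \<forall>n. norm (rGamma (c + of_nat n)) \<le> C * ((real n + 1) powr (1 - Re c) / fact n)"
    if "Re c > - real k" for k and c :: complex
    using that
  proof (induction k arbitrary: c)
    case 0
    then have c: "Re c > 0" by simp
    obtain C where C: "C > 0" "\<And>n. fact n * (real n + 1) powr (Re c - 1) \<le> C * norm (pochhammer c n)"
      using norm_pochhammer_lower[OF c] by blast
    have "norm (rGamma (c + of_nat n)) \<le> (C * norm (rGamma c) + 1) * ((real n + 1) powr (1 - Re c) / fact n)" for n
    proof -
      have pos: "fact n * (real n + 1) powr (Re c - 1) > 0" by simp
      have pn: "norm (pochhammer c n) > 0"
        using C(1) C(2)[of n] pos by (smt (verit) mult_nonneg_nonpos)
      have "norm (rGamma (c + of_nat n)) = norm (rGamma c) / norm (pochhammer c n)"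
        using pochhammer_rGamma[of c n] pn by (simp add: norm_mult)
      also have "\<dots> \<le> norm (rGamma c) * (C * ((real n + 1) powr (1 - Re c) / fact n))"
      proof -
        have "1 / norm (pochhammer c n) \<le> C / (fact n * (real n + 1) powr (Re c - 1))"
          using C(2)[of n] pos pn by (simp add: field_simps)
        also have "\<dots> = C * ((real n + 1) powr (1 - Re c) / fact n)"
          using powr_minus_divide[of "real n + 1" "Re c - 1"] by (simp add: field_simps)
        finally show ?thesis
          using mult_left_mono[of _ _ "norm (rGamma c)"] by fastforce
      qed
      also have "\<dots> = (C * norm (rGamma c)) * ((real n + 1) powr (1 - Re c) / fact n)"
        by (simp add: mult_ac)
      also have "\<dots> \<le> (C * norm (rGamma c) + 1) * ((real n + 1) powr (1 - Re c) / fact n)"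
        by (intro mult_right_mono) auto
      finally show ?thesis .
    qed
    moreover have "C * norm (rGamma c) + 1 > 0" using C(1) by (simp add: add_nonneg_pos)
    ultimately show ?case by blast
  next
    case (Suc k)
    from Suc.prems have "Re (c + 1) > - real k" by simp
    from Suc.IH[OF this] obtain C where
      C: "C > 0" "\<And>n. norm (rGamma (c + 1 + of_nat n)) \<le> C * ((real n + 1) powr (1 - Re (c + 1)) / fact n)" by blast
    have "norm (rGamma (c + of_nat n)) \<le> ((norm c + 1) * C) * ((real n + 1) powr (1 - Re c) / fact n)" for n
    proof -
      have "norm (rGamma (c + of_nat n)) = norm (c + of_nat n) * norm (rGamma (c + 1 + of_nat n))"
        using rGamma_plus1[of "c + of_nat n"] by (simp add: norm_mult [symmetric] add_ac)
      also have "\<dots> \<le> ((norm c + 1) * (real n + 1)) * (C * ((real n + 1) powr (1 - Re (c + 1)) / fact n))"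
      proof (intro mult_mono C(2))
        have "norm (c + of_nat n) \<le> norm c + real n"
          using norm_triangle_ineq[of c "of_nat n"] by simp
        also have "\<dots> \<le> (norm c + 1) * (real n + 1)" by (simp add: algebra_simps)
        finally show "norm (c + of_nat n) \<le> (norm c + 1) * (real n + 1)" .
      qed (use C(1) in auto)
      also have "\<dots> = ((norm c + 1) * C) * ((real n + 1) powr (1 - Re c) / fact n)"
        using powr_mult_base[of "real n + 1" "- Re c"] by (simp add: mult_ac)
      finally show ?thesis .
    qed
    moreover have "(norm c + 1) * C > 0" using C(1) by (simp add: add_nonneg_pos)
    ultimately show ?case by blast
  qed
  obtain k where "- Re c < real k" using reals_Archimedean2 by blast
  hence "Re c > - real k" by simp
  from main[OF this] that show ?thesis by blast
qed

section \<open>Gauss's summation theorem\<close>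

text \<open>
  The terms of Gauss's series at \<open>1\<close> divided by \<open>\<Gamma>(c)\<close>. With \<open>1 / \<Gamma>(c + n)\<close> in place
  of \<open>1 / (c)\<^sub>n\<close> they make sense for every complex \<open>c\<close>.
\<close>

definition gauss_term :: "complex \<Rightarrow> complex \<Rightarrow> complex \<Rightarrow> nat \<Rightarrow> complex" where
  "gauss_term a b c n = pochhammer a n * pochhammer b n / fact n * rGamma (c + of_nat n)"

lemma norm_gauss_term_upper:
  obtains C where "C > 0"
    "\<And>n. norm (gauss_term a b c n) \<le> C * (real n + 1) powr (Re (a + b - c) - 1)"
proof -
  obtain A where A: "A > 0" "\<And>n. norm (pochhammer a n) \<le> A * (fact n * (real n + 1) powr (Re a - 1))"
    using norm_pochhammer_upper by blast
  obtain B where B: "B > 0" "\<And>n. norm (pochhammer b n) \<le> B * (fact n * (real n + 1) powr (Re b - 1))"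
    using norm_pochhammer_upper by blast
  obtain D where D: "D > 0" "\<And>n. norm (rGamma (c + of_nat n)) \<le> D * ((real n + 1) powr (1 - Re c) / fact n)"
    using norm_rGamma_upper by blast
  have "norm (gauss_term a b c n) \<le> (A * B * D) * (real n + 1) powr (Re (a + b - c) - 1)" for n
  proof -
    have "norm (gauss_term a b c n) = norm (pochhammer a n) * norm (pochhammer b n) / fact n * norm (rGamma (c + of_nat n))"
      by (simp add: gauss_term_def norm_mult norm_divide)
    also have "\<dots> \<le> (A * (fact n * (real n + 1) powr (Re a - 1))) * (B * (fact n * (real n + 1) powr (Re b - 1))) / fact n
        * (D * ((real n + 1) powr (1 - Re c) / fact n))"
      by (intro mult_mono divide_right_mono A B D) (use A(1) B(1) D(1) in auto)
    also have "\<dots> = (A * B * D) * ((real n + 1) powr (Re a - 1) * (real n + 1) powr (Re b - 1) * (real n + 1) powr (1 - Re c))"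
      by (simp add: field_simps)
    also have "(real n + 1) powr (Re a - 1) * (real n + 1) powr (Re b - 1) * (real n + 1) powr (1 - Re c)
        = (real n + 1) powr (Re (a + b - c) - 1)"
      by (simp add: powr_add [symmetric] algebra_simps)
    finally show ?thesis .
  qed
  moreover have "A * B * D > 0" using A(1) B(1) D(1) by simp
  ultimately show ?thesis using that by blast
qed

lemma summable_Suc_powr:
  assumes "s < -1"
  shows "summable (\<lambda>n. (real n + 1) powr s)"
proof -
  have "summable (\<lambda>n. real n powr s)" using assms by (simp add: summable_real_powr_iff)
  hence "summable (\<lambda>n. real (Suc n) powr s)" by (subst summable_Suc_iff)
  thus ?thesis by (simp add: add_ac)
qed

lemma summable_norm_gauss_term:
  assumes "Re (c - a - b) > 0"
  shows "summable (\<lambda>n. norm (gauss_term a b c n))"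
proof -
  obtain C where C: "C > 0" "\<And>n. norm (gauss_term a b c n) \<le> C * (real n + 1) powr (Re (a + b - c) - 1)"
    using norm_gauss_term_upper by blast
  have "summable (\<lambda>n. C * (real n + 1) powr (Re (a + b - c) - 1))"
    by (intro summable_mult summable_Suc_powr) (use assms in simp)
  thus ?thesis by (rule summable_comparison_test'[where N=0]) (use C in auto)
qed

lemma summable_gauss_term:
  assumes "Re (c - a - b) > 0"
  shows "summable (gauss_term a b c)"
  using summable_norm_gauss_term[OF assms] by (rule summable_norm_cancel)

text \<open>
  The contiguous relation at \<open>1\<close> that moves \<open>c\<close> to \<open>c + 1\<close>. The difference of the two sides
  telescopes, and the growth bound for the terms makes the boundary term tend to \<open>0\<close>.
\<close>

lemma gauss_sum_shift:
  assumes "Re (c - a - b) > 0"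
  shows "(c - a - b) * suminf (gauss_term a b c) = (c - a) * (c - b) * suminf (gauss_term a b (c + 1))"
proof -
  \<comment> \<open>The boundary term of the telescoping sum.\<close>
  define V where "V = (\<lambda>n. of_nat n * gauss_term a b c n)"
  have step: "(c - a - b) * gauss_term a b c n - (c - a) * (c - b) * gauss_term a b (c + 1) n = V n - V (Suc n)" for n
  proof -
    define t where "t = pochhammer a n * pochhammer b n / fact n * rGamma (c + 1 + of_nat n)"
    have 1: "gauss_term a b (c + 1) n = t" by (simp add: gauss_term_def t_def)
    have 2: "gauss_term a b c n = (c + of_nat n) * t"
      using rGamma_plus1[of "c + of_nat n"] by (simp add: gauss_term_def t_def add_ac mult_ac)
    have 3: "V (Suc n) = (a + of_nat n) * (b + of_nat n) * t"
    proof -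
      have "V (Suc n) = of_nat (Suc n) * (pochhammer a n * (a + of_nat n) * (pochhammer b n * (b + of_nat n))
            / (of_nat (Suc n) * fact n) * rGamma (c + 1 + of_nat n))"
        by (simp add: V_def gauss_term_def pochhammer_Suc add_ac)
      also have "\<dots> = (a + of_nat n) * (b + of_nat n) * t"
        using of_nat_neq_0[where 'a=complex, of n] by (simp add: t_def field_simps del: of_nat_Suc)
      finally show ?thesis .
    qed
    show ?thesis unfolding 1 3 unfolding V_def 2 by (simp add: algebra_simps)
  qed
  have V0: "V \<longlonglongrightarrow> 0"
  proof -
    obtain C where C: "C > 0" "\<And>n. norm (gauss_term a b c n) \<le> C * (real n + 1) powr (Re (a + b - c) - 1)"
      using norm_gauss_term_upper by blast
    define e where "e = Re (c - a - b)"
    have e: "e > 0" using assms by (simp add: e_def)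
    have "(\<lambda>n. C * (real n * (real n + 1) powr (-e - 1))) \<longlonglongrightarrow> C * 0"
      by (rule tendsto_mult[OF tendsto_const]) (use e in real_asymp)
    moreover have "norm (V n) \<le> C * (real n * (real n + 1) powr (-e - 1))" for n
      using mult_left_mono[OF C(2)[of n], of "real n"] by (simp add: V_def norm_mult e_def algebra_simps)
    ultimately show ?thesis
      by (intro Lim_null_comparison[of V "\<lambda>n. C * (real n * (real n + 1) powr (-e - 1))"] always_eventually) auto
  qed
  have "(\<lambda>n. V n - V (Suc n)) sums (V 0 - 0)"
    by (rule telescope_sums'[OF V0])
  hence "(\<lambda>n. V n - V (Suc n)) sums 0" by (simp add: V_def)
  moreover have "(\<lambda>n. V n - V (Suc n)) sums
      ((c - a - b) * suminf (gauss_term a b c) - (c - a) * (c - b) * suminf (gauss_term a b (c + 1)))"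
    unfolding step[symmetric]
    by (intro sums_diff sums_mult summable_sums summable_gauss_term) (use assms in auto)
  ultimately show ?thesis using sums_unique2 by fastforce
qed

lemma gauss_sum_shift_n:
  assumes "Re (c - a - b) > 0"
  shows "pochhammer (c - a - b) n * suminf (gauss_term a b c)
       = pochhammer (c - a) n * pochhammer (c - b) n * suminf (gauss_term a b (c + of_nat n))"
proof (induction n)
  case (Suc n)
  have "Re (c + of_nat n - a - b) > 0" using assms by (simp add: add_pos_nonneg algebra_simps)
  from gauss_sum_shift[OF this]
  have *: "(c - a - b + of_nat n) * suminf (gauss_term a b (c + of_nat n)) =
      (c - a + of_nat n) * (c - b + of_nat n) * suminf (gauss_term a b (c + of_nat (Suc n)))"
    by (simp add: algebra_simps)
  have "pochhammer (c - a - b) (Suc n) * suminf (gauss_term a b c)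
      = (pochhammer (c - a - b) n * suminf (gauss_term a b c)) * (c - a - b + of_nat n)"
    by (simp add: pochhammer_Suc mult_ac)
  also have "\<dots> = pochhammer (c - a) n * pochhammer (c - b) n *
      ((c - a - b + of_nat n) * suminf (gauss_term a b (c + of_nat n)))"
    by (simp only: Suc.IH) (simp add: mult_ac)
  also have "\<dots> = pochhammer (c - a) (Suc n) * pochhammer (c - b) (Suc n) * suminf (gauss_term a b (c + of_nat (Suc n)))"
    unfolding * by (simp add: pochhammer_Suc mult_ac)
  finally show ?case .
qed simp

lemma norm_pochhammer_ge:
  fixes c :: complex
  assumes "Re c > 0"
  shows "pochhammer (Re c) n \<le> norm (pochhammer c n)"
proof (induction n)
  case (Suc n)
  have "Re c + real n \<le> norm (c + of_nat n)"
    using complex_Re_le_cmod[of "c + of_nat n"] by simp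
  thus ?case using Suc assms
    by (simp add: pochhammer_Suc norm_mult mult_mono pochhammer_nonneg)
qed simp

lemma pochhammer_mono_base:
  fixes x y :: real
  assumes "0 < x" "x \<le> y"
  shows "pochhammer x n \<le> pochhammer y n"
  by (induction n) (use assms in \<open>auto simp: pochhammer_Suc intro!: mult_mono pochhammer_nonneg\<close>)

text \<open>
  As \<open>c\<close> moves to the right, every term of the normalised Gauss series but the first vanishes; Tannery's
  theorem passes to the limit in the sum.
\<close>

lemma gauss_sum_normalised_limit:
  fixes a b c :: complex
  shows "(\<lambda>N. Gamma (c + of_nat N) * suminf (gauss_term a b (c + of_nat N))) \<longlonglongrightarrow> 1"
proof -
  obtain N0 where N0: "real N0 > max (- Re c) (Re (a + b - c))" using reals_Archimedean2 by blast
  define r where "r = Re c + real N0"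
  have r: "r > 0" "r > Re (a + b)" using N0 by (auto simp: r_def)
  define f where "f = (\<lambda>n N. pochhammer a n * pochhammer b n / fact n / pochhammer (c + of_nat N) n)"
  have f_eq: "f n N = Gamma (c + of_nat N) * gauss_term a b (c + of_nat N) n" if "N \<ge> N0" for n N
  proof -
    have "Re (c + of_nat N) > 0" using N0 that by simp
    hence "c + of_nat N \<notin> \<int>\<^sub>\<le>\<^sub>0" by (rule half_plane_notin_nonpos_Ints)
    hence g: "Gamma (c + of_nat N) \<noteq> 0" "pochhammer (c + of_nat N) n \<noteq> 0"
      by (auto simp: Gamma_eq_zero_iff pochhammer_eq_0_iff)
    have "rGamma (c + of_nat N + of_nat n) = rGamma (c + of_nat N) / pochhammer (c + of_nat N) n"
      using pochhammer_rGamma[of "c + of_nat N" n] g by (simp add: field_simps)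
    thus ?thesis using g by (simp add: f_def gauss_term_def rGamma_inverse_Gamma field_simps)
  qed
  \<comment> \<open>The denominators grow with N, so the terms at N0, made real and positive, dominate all later ones.\<close>
  define M where "M = (\<lambda>n. norm (pochhammer a n * pochhammer b n / fact n) / pochhammer r n)"
  have sM: "summable M"
  proof -
    have "complex_of_real r \<notin> \<int>\<^sub>\<le>\<^sub>0" using r by (intro half_plane_notin_nonpos_Ints) simp
    have pr: "pochhammer r n > 0" for n using r by (intro pochhammer_pos)
    have "M = (\<lambda>n. norm (Gamma (of_real r :: complex)) * norm (gauss_term a b (of_real r) n))"
    proof
      fix n
      have g: "Gamma (complex_of_real r) \<noteq> 0"
        using \<open>complex_of_real r \<notin> \<int>\<^sub>\<le>\<^sub>0\<close> by (simp add: Gamma_eq_zero_iff)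
      have "rGamma (complex_of_real r) = of_real (pochhammer r n) * rGamma (of_real r + of_nat n)"
        using pochhammer_rGamma[of "complex_of_real r" n] by (simp add: pochhammer_of_real)
      hence "rGamma (of_real r + of_nat n) = rGamma (complex_of_real r) / of_real (pochhammer r n)"
        using pr[of n] by (simp add: field_simps)
      thus "M n = norm (Gamma (of_real r :: complex)) * norm (gauss_term a b (of_real r) n)" using g pr[of n]
        by (simp add: M_def gauss_term_def norm_mult norm_divide rGamma_inverse_Gamma field_simps)
    qed
    moreover have "summable (\<lambda>n. norm (gauss_term a b (of_real r) n))"
      by (rule summable_norm_gauss_term) (use r in simp)
    ultimately show ?thesis by (simp add: summable_mult)
  qed
  have bnd: "norm (f n N) \<le> M n" if "N \<ge> N0" for n N
  proof -
    have "pochhammer r n \<le> pochhammer (Re (c + of_nat N)) n"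
      by (rule pochhammer_mono_base) (use r that in \<open>auto simp: r_def\<close>)
    also have "\<dots> \<le> norm (pochhammer (c + of_nat N) n)"
      by (rule norm_pochhammer_ge) (use r that in \<open>auto simp: r_def\<close>)
    finally show ?thesis unfolding f_def M_def norm_divide[of _ "pochhammer (c + of_nat N) n"]
      using pochhammer_pos[OF r(1), of n] by (intro divide_left_mono mult_pos_pos) auto
  qed
  have lim: "(\<lambda>N. f n N) \<longlonglongrightarrow> (if n = 0 then 1 else 0)" for n
  proof (cases n)
    case (Suc k)
    have "filterlim (\<lambda>N. c + of_nat N) at_infinity sequentially"
      by (intro tendsto_add_filterlim_at_infinity[OF tendsto_const] tendsto_of_nat)
    hence z: "(\<lambda>N. norm (pochhammer a n * pochhammer b n / fact n) * inverse (norm (c + of_nat N))) \<longlonglongrightarrow> 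
       norm (pochhammer a n * pochhammer b n / fact n) * 0"
      by (intro tendsto_mult tendsto_const tendsto_inverse_0_at_top filterlim_at_infinity_imp_norm_at_top)
    obtain N1 where N1: "real N1 > 1 - Re c" using reals_Archimedean2 by blast
    have "\<forall>\<^sub>F N in sequentially. norm (f n N) \<le> norm (pochhammer a n * pochhammer b n / fact n) * inverse (norm (c + of_nat N))"
      using eventually_ge_at_top[of N1]
    proof eventually_elim
      case (elim N)
      have re: "Re (c + of_nat N) > 1" using N1 elim by simp
      have "1 \<le> pochhammer (1::real) k"
        by (simp flip: pochhammer_fact)
      also have "\<dots> \<le> pochhammer (Re (c + 1 + of_nat N)) k"
        by (rule pochhammer_mono_base) (use re in auto)
      also have "\<dots> \<le> norm (pochhammer (c + 1 + of_nat N) k)"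
        by (rule norm_pochhammer_ge) (use re in auto)
      finally have "norm (c + of_nat N) * 1 \<le> norm (c + of_nat N) * norm (pochhammer (c + 1 + of_nat N) k)"
        by (intro mult_left_mono) auto
      also have "\<dots> = norm (pochhammer (c + of_nat N) n)"
        by (simp add: Suc pochhammer_rec norm_mult add_ac)
      finally have "norm (c + of_nat N) \<le> norm (pochhammer (c + of_nat N) n)" by simp
      moreover have "norm (c + of_nat N) > 0" using re by (auto simp: complex_eq_iff)
      ultimately show ?case unfolding f_def norm_divide[of _ "pochhammer (c + of_nat N) n"]
        by (subst divide_inverse) (intro mult_left_mono le_imp_inverse_le, auto)
    qed
    hence "(\<lambda>N. f n N) \<longlonglongrightarrow> 0"
      by (rule Lim_null_comparison) (use z in simp)
    thus ?thesis by (simp add: Suc)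
  qed (simp add: f_def)
  have "((\<lambda>N. suminf (\<lambda>n. f n N)) \<longlongrightarrow> suminf (\<lambda>n. if n = 0 then 1 else 0)) sequentially"
  proof -
    have "\<forall>\<^sub>F (k, n) in sequentially \<times>\<^sub>F sequentially. norm (f k n) \<le> M k"
      unfolding eventually_prod_filter
      by (rule exI[of _ "\<lambda>_. True"], rule exI[of _ "\<lambda>N. N \<ge> N0"]) (auto simp: bnd eventually_ge_at_top)
    from tannerys_theorem[OF lim this sM] show ?thesis by simp
  qed
  also have "suminf (\<lambda>n. if n = 0 then 1 else 0) = (1::complex)"
    using sums_unique[OF sums_single[of 0 "\<lambda>_. 1::complex"]] by simp
  finally have "(\<lambda>N. suminf (\<lambda>n. f n N)) \<longlonglongrightarrow> 1" .
  moreover have "\<forall>\<^sub>F N in sequentially. suminf (\<lambda>n. f n N) = Gamma (c + of_nat N) * suminf (gauss_term a b (c + of_nat N))"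
    using eventually_ge_at_top[of N0]
  proof eventually_elim
    case (elim N)
    have "Re (c + of_nat N - a - b) > 0" using elim N0 by simp
    from summable_gauss_term[OF this] show ?case
      using elim by (simp add: f_eq suminf_mult)
  qed
  ultimately show ?thesis
    by (rule Lim_transform_eventually[OF _ eventually_mono]) simp
qed

lemma pochhammer_limit:
  fixes z :: complex
  shows "(\<lambda>N. pochhammer z N / (fact N * of_nat N powr (z - 1))) \<longlonglongrightarrow> rGamma z"
proof -
  have "(\<lambda>N. rGamma_series z N * (1 / (1 + z / of_nat N))) \<longlonglongrightarrow> rGamma z * (1 / (1 + 0))"
    by (intro tendsto_intros rGamma_series_LIMSEQ tendsto_divide_0[OF tendsto_const] tendsto_of_nat) auto
  moreover obtain M where M: "real M > norm z" using reals_Archimedean2 by blast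
  have "\<forall>\<^sub>F N in sequentially. rGamma_series z N * (1 / (1 + z / of_nat N)) =
      pochhammer z N / (fact N * of_nat N powr (z - 1))"
    using eventually_ge_at_top[of "Suc M"]
  proof eventually_elim
    case (elim N)
    have "norm z < real N" using M elim by simp
    hence nz: "z + of_nat N \<noteq> 0"
      by (metis add_eq_0_iff norm_minus_cancel norm_of_nat order_less_irrefl)
    have N: "of_nat N \<noteq> (0::complex)" using elim by simp
    have e: "exp (z * of_real (ln (real N))) = of_nat N powr (z - 1) * of_nat N"
    proof -
      have "exp (z * of_real (ln (real N))) = of_nat N powr z"
        using N elim by (simp add: powr_def Ln_of_nat)
      thus ?thesis using N by (simp add: powr_diff)
    qed
    have "1 / (1 + z / of_nat N) = of_nat N / (z + of_nat N)"
      using N nz by (simp add: field_simps)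
    thus ?case using N nz unfolding rGamma_series_def
      by (subst e) (simp add: pochhammer_Suc)
  qed
  ultimately show ?thesis by (simp add: filterlim_cong)
qed

lemma rGamma_shift_limit:
  fixes c :: complex
  shows "(\<lambda>N. rGamma (c + of_nat N) * (fact N * of_nat N powr (c - 1))) \<longlonglongrightarrow> 1"
proof -
  have main: "(\<lambda>N. rGamma (c + of_nat N) * (fact N * of_nat N powr (c - 1))) \<longlonglongrightarrow> 1"
    if "Re c > - real k" for k and c :: complex
    using that
  proof (induction k arbitrary: c)
    case 0
    hence c: "c \<notin> \<int>\<^sub>\<le>\<^sub>0" by (intro half_plane_notin_nonpos_Ints) simp
    hence "(\<lambda>N. rGamma c / (pochhammer c N / (fact N * of_nat N powr (c - 1)))) \<longlonglongrightarrow> rGamma c / rGamma c"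
      by (intro tendsto_divide tendsto_const pochhammer_limit) (simp add: rGamma_eq_zero_iff)
    moreover have "rGamma c / (pochhammer c N / (fact N * of_nat N powr (c - 1))) =
        rGamma (c + of_nat N) * (fact N * of_nat N powr (c - 1))" for N
    proof -
      have "pochhammer c N \<noteq> 0" using c by (auto simp: pochhammer_eq_0_iff)
      thus ?thesis using pochhammer_rGamma[of c N] by (simp add: field_simps)
    qed
    ultimately show ?case using c by (simp add: rGamma_eq_zero_iff)
  next
    case (Suc k)
    hence "Re (c + 1) > - real k" by simp
    from Suc.IH[OF this]
    have "(\<lambda>N. (1 + c / of_nat N) * (rGamma (c + 1 + of_nat N) * (fact N * of_nat N powr (c + 1 - 1)))) \<longlonglongrightarrow> (1 + 0) * 1"
      by (intro tendsto_mult tendsto_add tendsto_const tendsto_divide_0[OF tendsto_const] tendsto_of_nat)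
    moreover have "\<forall>\<^sub>F N in sequentially. (1 + c / of_nat N) * (rGamma (c + 1 + of_nat N) * (fact N * of_nat N powr (c + 1 - 1)))
       = rGamma (c + of_nat N) * (fact N * of_nat N powr (c - 1))"
      using eventually_gt_at_top[of 0]
    proof eventually_elim
      case (elim N)
      hence N: "of_nat N \<noteq> (0::complex)" by simp
      have "rGamma (c + of_nat N) = (c + of_nat N) * rGamma (c + 1 + of_nat N)"
        using rGamma_plus1[of "c + of_nat N"] by (simp add: add_ac)
      moreover have "of_nat N powr c = of_nat N powr (c - 1) * (of_nat N :: complex)"
        using N by (simp add: powr_diff)
      ultimately show ?case using N by (simp add: field_simps)
    qed
    ultimately have "(\<lambda>N. rGamma (c + of_nat N) * (fact N * of_nat N powr (c - 1))) \<longlonglongrightarrow> (1 + 0) * 1"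
      by (rule Lim_transform_eventually)
    thus ?case by simp
  qed
  obtain k where "- Re c < real k" using reals_Archimedean2 by blast
  hence "Re c > - real k" by simp
  from main[OF this] show ?thesis .
qed

text \<open>
  Iterating the shift \<open>N\<close> times leaves a quotient of Pochhammer symbols and a sum whose normalised limit is \<open>1\<close>.
  Each Pochhammer symbol, divided by a factorial and a power of \<open>N\<close>, tends to a reciprocal Gamma value;
  the factorials and powers cancel between them and \<open>1 / \<Gamma>(c + N)\<close>.
\<close>

theorem gauss_summation:
  assumes "Re (c - a - b) > 0"
  shows "suminf (gauss_term a b c) = Gamma (c - a - b) * rGamma (c - a) * rGamma (c - b)"
proof -
  define s where "s = c - a - b"
  have s: "s \<notin> \<int>\<^sub>\<le>\<^sub>0" using assms by (intro half_plane_notin_nonpos_Ints) (simp add: s_def)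
  have ps: "pochhammer s N \<noteq> 0" for N using s by (auto simp: pochhammer_eq_0_iff)
  define S where "S = (\<lambda>N. suminf (gauss_term a b (c + of_nat N)))"
  define P where "P = (\<lambda>z N. pochhammer z N / (fact N * of_nat N powr (z - 1)) :: complex)"
  have "(\<lambda>N. P (c - a) N * P (c - b) N / P s N * (rGamma (c + of_nat N) * (fact N * of_nat N powr (c - 1)))
          * (Gamma (c + of_nat N) * S N)) \<longlonglongrightarrow> rGamma (c - a) * rGamma (c - b) / rGamma s * 1 * 1"
    unfolding P_def S_def using s
    by (intro tendsto_intros pochhammer_limit rGamma_shift_limit gauss_sum_normalised_limit)
       (auto simp: rGamma_eq_zero_iff)
  moreover obtain M where M: "real M > norm c" using reals_Archimedean2 by blast
  have "\<forall>\<^sub>F N in sequentially. P (c - a) N * P (c - b) N / P s N *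
          (rGamma (c + of_nat N) * (fact N * of_nat N powr (c - 1))) * (Gamma (c + of_nat N) * S N)
          = suminf (gauss_term a b c)"
    using eventually_ge_at_top[of "Suc M"]
  proof eventually_elim
    case (elim N)
    have N: "of_nat N \<noteq> (0::complex)" using elim by simp
    have "\<bar>Re c\<bar> < real N" using M elim abs_Re_le_cmod[of c] by simp
    hence "c + of_nat N \<notin> \<int>\<^sub>\<le>\<^sub>0" by (intro half_plane_notin_nonpos_Ints) auto
    hence G: "rGamma (c + of_nat N) * Gamma (c + of_nat N) = 1"
      by (simp add: rGamma_inverse_Gamma Gamma_eq_zero_iff)
    have pw: "of_nat N powr (s - 1) * of_nat N powr (c - 1) =
        (of_nat N powr (c - a - 1) * of_nat N powr (c - b - 1) :: complex)"
      by (simp add: powr_add [symmetric] s_def algebra_simps)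
    have "pochhammer (c - a) N * pochhammer (c - b) N * S N = pochhammer s N * suminf (gauss_term a b c)"
      unfolding S_def s_def by (rule gauss_sum_shift_n[OF assms, symmetric])
    hence "suminf (gauss_term a b c) = pochhammer (c - a) N * pochhammer (c - b) N * S N / pochhammer s N"
      using ps[of N] by (simp add: field_simps)
    also have "\<dots> = pochhammer (c - a) N * pochhammer (c - b) N * S N / pochhammer s N * 1 * 1" by simp
    also have "\<dots> = pochhammer (c - a) N * pochhammer (c - b) N * S N / pochhammer s N *
        (rGamma (c + of_nat N) * Gamma (c + of_nat N)) *
        ((of_nat N powr (s - 1) * of_nat N powr (c - 1)) / (of_nat N powr (c - a - 1) * of_nat N powr (c - b - 1)))"
      unfolding G pw using N by simp
    also have "\<dots> = P (c - a) N * P (c - b) N / P s N *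
          (rGamma (c + of_nat N) * (fact N * of_nat N powr (c - 1))) * (Gamma (c + of_nat N) * S N)"
      using N ps[of N] by (simp add: P_def mult_ac)
    finally show ?case ..
  qed
  ultimately have "(\<lambda>N. suminf (gauss_term a b c)) \<longlonglongrightarrow> rGamma (c - a) * rGamma (c - b) / rGamma s * 1 * 1"
    by (rule Lim_transform_eventually)
  hence "suminf (gauss_term a b c) = rGamma (c - a) * rGamma (c - b) / rGamma s"
    by (intro LIMSEQ_unique[OF tendsto_const]) simp
  thus ?thesis by (simp add: s_def Gamma_def divide_inverse mult_ac)
qed

section \<open>Termwise integration and the complex Beta integral\<close>

abbreviation unit_lebesgue :: "real measure" where
  "unit_lebesgue \<equiv> restrict_space lborel {0<..<1}"

lemma continuous_imp_measurable_unit: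
  fixes f :: "real \<Rightarrow> 'a :: topological_space"
  assumes "continuous_on {0<..<1} f"
  shows "f \<in> borel_measurable unit_lebesgue"
  using borel_measurable_continuous_on_restrict[OF assms]
  by (subst measurable_cong_sets[OF sets_restrict_space_cong[OF sets_lborel] refl])

text \<open>
  The form of Fubini's theorem for series used throughout: only bounds on the absolute integrals are asked for,
  and these are computed as nonnegative integrals without knowing integrability beforehand.
\<close>

lemma suminf_integral_interchange:
  fixes f :: "nat \<Rightarrow> 'a \<Rightarrow> complex" and M :: "'a measure" and b :: "nat \<Rightarrow> real"
  assumes meas: "\<And>i. f i \<in> borel_measurable M"
    and bound: "\<And>i. (\<integral>\<^sup>+x. ennreal (norm (f i x)) \<partial>M) \<le> ennreal (b i)"
    and nonneg: "\<And>i. b i \<ge> 0" and summ: "summable b"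
  shows suminf_interchange_integrable: "integrable M (\<lambda>x. \<Sum>i. f i x)"
    and suminf_interchange_sums: "(\<lambda>i. integral\<^sup>L M (f i)) sums (\<integral>x. (\<Sum>i. f i x) \<partial>M)"
    and suminf_interchange_AE: "AE x in M. summable (\<lambda>i. norm (f i x))"
proof -
  have int: "integrable M (f i)" for i
    by (rule integrableI_bounded[OF meas]) (use bound[of i] in \<open>auto simp: less_top[symmetric] top_unique\<close>)
  have nn: "(\<integral>\<^sup>+x. (\<Sum>i. ennreal (norm (f i x))) \<partial>M) \<le> ennreal (\<Sum>i. b i)"
  proof -
    have "(\<integral>\<^sup>+x. (\<Sum>i. ennreal (norm (f i x))) \<partial>M) = (\<Sum>i. \<integral>\<^sup>+x. ennreal (norm (f i x)) \<partial>M)"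
      using meas by (intro nn_integral_suminf) measurable
    also have "\<dots> \<le> (\<Sum>i. ennreal (b i))"
      by (intro suminf_le bound) auto
    also have "\<dots> = ennreal (\<Sum>i. b i)"
      using nonneg summ by (rule suminf_ennreal2)
    finally show ?thesis .
  qed
  show AE: "AE x in M. summable (\<lambda>i. norm (f i x))"
  proof -
    have "AE x in M. (\<Sum>i. ennreal (norm (f i x))) \<noteq> \<infinity>"
      using nn meas by (intro nn_integral_PInf_AE) (auto simp: top_unique)
    thus ?thesis
      by eventually_elim (auto intro: summable_suminf_not_top)
  qed
  have le: "(\<integral>x. norm (f i x) \<partial>M) \<le> b i" for i
  proof -
    have "ennreal (\<integral>x. norm (f i x) \<partial>M) = (\<integral>\<^sup>+x. ennreal (norm (f i x)) \<partial>M)"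
      by (rule nn_integral_eq_integral[symmetric]) (use int in auto)
    with bound[of i] have "ennreal (\<integral>x. norm (f i x) \<partial>M) \<le> ennreal (b i)" by simp
    thus ?thesis using nonneg by (simp add: ennreal_le_iff)
  qed
  have summ': "summable (\<lambda>i. \<integral>x. norm (f i x) \<partial>M)"
    by (rule summable_comparison_test'[OF summ, of 0]) (use le in auto)
  show "integrable M (\<lambda>x. \<Sum>i. f i x)"
    by (rule integrable_suminf[OF int AE summ'])
  show "(\<lambda>i. integral\<^sup>L M (f i)) sums (\<integral>x. (\<Sum>i. f i x) \<partial>M)"
    by (rule sums_integral[OF int AE summ'])
qed

lemma nn_integral_Beta:
  assumes "a > 0" "b > (0::real)"
  shows "(\<integral>\<^sup>+t. ennreal (t powr (a - 1) * (1 - t) powr (b - 1)) \<partial>unit_lebesgue) = ennreal (Beta a b)"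
proof -
  have "((\<lambda>t. t powr (a - 1) * (1 - t) powr (b - 1)) has_integral Beta a b) {0<..<1}"
    using has_integral_Beta_real[OF assms] by (simp add: has_integral_Icc_iff_Ioo)
  from nn_integral_has_integral_lebesgue[OF _ this]
  have "(\<integral>\<^sup>+t. ennreal (indicator {0<..<1} t * (t powr (a - 1) * (1 - t) powr (b - 1))) \<partial>lborel) = ennreal (Beta a b)"
    by simp
  thus ?thesis
    by (subst nn_integral_restrict_space) (auto simp: ennreal_indicator ennreal_mult' mult.commute)
qed

lemma norm_of_real_powr:
  assumes "t > 0"
  shows "norm (complex_of_real t powr z) = t powr Re z"
  using assms by (simp add: norm_powr_real_powr)

lemma binomial_series:
  fixes a x :: complex
  assumes "norm x < 1"
  shows "(\<lambda>n. pochhammer a n / fact n * x ^ n) sums (1 - x) powr (- a)"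
proof -
  have "(\<lambda>n. (- a gchoose n) * (- x) ^ n) sums (1 + - x) powr (- a)"
    by (rule gen_binomial_complex) (use assms in simp)
  moreover have "(- a gchoose n) * (- x) ^ n = pochhammer a n / fact n * x ^ n" for n
  proof -
    have "(- 1) ^ n * (- x) ^ n = x ^ n" by (simp flip: power_mult_distrib)
    thus ?thesis by (simp add: gbinomial_pochhammer)
  qed
  ultimately show ?thesis by simp
qed

lemma lebesgue_unit_eq_integral:
  fixes f :: "real \<Rightarrow> complex"
  assumes "integrable unit_lebesgue f"
  shows "integral\<^sup>L unit_lebesgue f = integral {0..1} f"
proof -
  have "set_integrable lborel {0<..<1} f"
    using assms by (simp add: integrable_restrict_space set_integrable_def)
  from set_borel_integral_eq_integral(2)[OF this] show ?thesis
    by (simp add: integral_restrict_space set_lebesgue_integral_def integral_open_interval_real)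
qed

lemma power_integral:
  fixes s :: complex
  assumes "Re s > 0"
  shows "(\<integral>t. of_real t powr (s - 1) \<partial>unit_lebesgue) = 1 / s"
proof -
  have s: "s \<noteq> 0" using assms by auto
  have "integrable unit_lebesgue (\<lambda>t. of_real t powr (s - 1))"
  proof (rule integrableI_bounded)
    show "(\<lambda>t. complex_of_real t powr (s - 1)) \<in> borel_measurable unit_lebesgue"
      by (intro continuous_imp_measurable_unit continuous_intros) auto
    have "(\<integral>\<^sup>+t. ennreal (norm (complex_of_real t powr (s - 1))) \<partial>unit_lebesgue)
        = (\<integral>\<^sup>+t. ennreal (t powr (Re s - 1) * (1 - t) powr (1 - 1)) \<partial>unit_lebesgue)"
      by (intro nn_integral_cong) (auto simp: space_restrict_space norm_of_real_powr)
    also have "\<dots> < \<infinity>"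
      by (subst nn_integral_Beta) (use assms in auto)
    finally show "(\<integral>\<^sup>+t. ennreal (norm (complex_of_real t powr (s - 1))) \<partial>unit_lebesgue) < \<infinity>" .
  qed
  hence "(\<integral>t. of_real t powr (s - 1) \<partial>unit_lebesgue) = integral {0..1} (\<lambda>t. complex_of_real t powr (s - 1))"
    by (rule lebesgue_unit_eq_integral)
  also have "((\<lambda>t. complex_of_real t powr (s - 1)) has_integral of_real 1 powr s / s - of_real 0 powr s / s) {0..1}"
  proof (rule fundamental_theorem_of_calculus_interior)
    show "continuous_on {0..1} (\<lambda>t. complex_of_real t powr s / s)"
      using assms s by (intro continuous_intros) auto
    fix t :: real assume t: "t \<in> {0<..<1}"
    have "((\<lambda>z. z powr s / s) has_field_derivative (of_real t powr (s - 1))) (at (complex_of_real t))"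
      using t s by (auto intro!: derivative_eq_intros simp: complex_nonpos_Reals_iff)
    hence "((\<lambda>z. z powr s / s) \<circ> complex_of_real has_vector_derivative (of_real 1 * (of_real t powr (s - 1)))) (at t)"
      by (intro field_vector_diff_chain_at) (auto intro!: derivative_eq_intros has_vector_derivative_of_real)
    thus "((\<lambda>t. complex_of_real t powr s / s) has_vector_derivative (of_real t powr (s - 1))) (at t)"
      by (simp add: o_def)
  qed auto
  hence "integral {0..1} (\<lambda>t. complex_of_real t powr (s - 1)) = 1 / s"
    by (simp add: integral_unique)
  finally show ?thesis .
qed

text \<open>
  Expand \<open>(1 - t) powr (c - 1)\<close> binomially. Integrating term by term gives the terms
  \<open>(1 - c)\<^sub>n / (n! (s + n))\<close>, which up to the factor \<open>\<Gamma>(s)\<close> are those of Gauss's series with parameters \<open>1 - c\<close>, \<open>s\<close>; \<open>s + 1\<close>.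
\<close>

theorem complex_Beta_integral:
  fixes s c :: complex
  assumes s: "Re s > 0" and c: "Re c > 0"
  shows "integrable unit_lebesgue (\<lambda>t. of_real t powr (s - 1) * of_real (1 - t) powr (c - 1))"
    and "(\<integral>t. of_real t powr (s - 1) * of_real (1 - t) powr (c - 1) \<partial>unit_lebesgue)
          = Gamma s * Gamma c * rGamma (s + c)"
proof -
  define k where "k = (\<lambda>n. pochhammer (1 - c) n / fact n)"
  define f where "f = (\<lambda>n t. k n * complex_of_real t powr (s + of_nat n - 1))"
  have s0: "s \<notin> \<int>\<^sub>\<le>\<^sub>0" using s by (rule half_plane_notin_nonpos_Ints)
  have sn: "s + of_nat n \<noteq> 0" for n using s by (auto simp: complex_eq_iff)
  have trm: "k n / (s + of_nat n) = Gamma s * gauss_term (1 - c) s (s + 1) n" for n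
  proof -
    have "rGamma s = pochhammer s n * ((s + of_nat n) * rGamma (s + 1 + of_nat n))"
      using pochhammer_rGamma[of s n] rGamma_plus1[of "s + of_nat n"] by (simp add: add_ac)
    hence "1 / (s + of_nat n) = Gamma s * (pochhammer s n * rGamma (s + 1 + of_nat n))"
      using sn[of n] s0 by (simp add: rGamma_inverse_Gamma Gamma_eq_zero_iff field_simps)
    hence "k n * (1 / (s + of_nat n)) = k n * (Gamma s * (pochhammer s n * rGamma (s + 1 + of_nat n)))" by simp
    thus ?thesis by (simp add: gauss_term_def k_def)
  qed
  have meas: "f n \<in> borel_measurable unit_lebesgue" for n
    unfolding f_def by (intro continuous_imp_measurable_unit continuous_intros) auto
  have gs: "Re (s + 1 - (1 - c) - s) > 0" using c by simp
  \<comment> \<open>K compensates for replacing |s + n| by its real part, which is what the absolute integral yields.\<close>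
  define K where "K = norm s / Re s"
  have K: "K \<ge> 1" using s complex_Re_le_cmod[of s] by (simp add: K_def)
  have bnd: "(\<integral>\<^sup>+t. ennreal (norm (f n t)) \<partial>unit_lebesgue) \<le> ennreal (K * norm (k n / (s + of_nat n)))" for n
  proof -
    have le: "1 / (Re s + n) \<le> K / norm (s + of_nat n)"
    proof -
      have "norm (s + of_nat n) \<le> norm s + real n" using norm_triangle_ineq[of s "of_nat n"] by simp
      also have "\<dots> \<le> K * Re s + K * real n" using K s mult_right_mono[of 1 K "real n"] by (simp add: K_def)
      finally have "norm (s + of_nat n) \<le> K * (Re s + real n)" by (simp add: distrib_left)
      moreover have "norm (s + of_nat n) > 0" using sn by simp
      moreover have "Re s + real n > 0" using s by simp
      ultimately show ?thesis by (simp add: divide_le_eq le_divide_eq mult_ac)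
    qed
    have "(\<integral>\<^sup>+t. ennreal (norm (f n t)) \<partial>unit_lebesgue)
        = (\<integral>\<^sup>+t. ennreal (norm (k n)) * ennreal (t powr ((Re s + n) - 1) * (1 - t) powr (1 - 1)) \<partial>unit_lebesgue)"
      by (intro nn_integral_cong)
         (auto simp: space_restrict_space norm_of_real_powr f_def norm_mult ennreal_mult[symmetric])
    also have "\<dots> = ennreal (norm (k n)) * (\<integral>\<^sup>+t. ennreal (t powr ((Re s + n) - 1) * (1 - t) powr (1 - 1)) \<partial>unit_lebesgue)"
      by (rule nn_integral_cmult) (intro measurable_restrict_space1, measurable)
    also have "\<dots> = ennreal (norm (k n)) * ennreal (Beta (Re s + n) 1)"
      by (subst nn_integral_Beta) (use s in auto)
    also have "Beta (Re s + n) 1 = 1 / (Re s + n)"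
    proof -
      have "Re s + n > 0" using s by simp
      hence "Re s + n \<notin> \<int>\<^sub>\<le>\<^sub>0" by (auto elim!: nonpos_Ints_cases)
      thus ?thesis using Gamma_plus1[of "Re s + n"] by (simp add: Beta_def Gamma_eq_zero_iff)
    qed
    also have "ennreal (norm (k n)) * ennreal (1 / (Re s + n)) \<le> ennreal (norm (k n)) * ennreal (K / norm (s + of_nat n))"
      by (intro mult_left_mono ennreal_leI le) auto
    also have "\<dots> = ennreal (K * norm (k n / (s + of_nat n)))"
      using K by (simp add: ennreal_mult[symmetric] norm_divide mult_ac)
    finally show ?thesis by simp
  qed
  have summ: "summable (\<lambda>n. K * norm (k n / (s + of_nat n)))"
    unfolding trm norm_mult using summable_norm_gauss_term[OF gs] by (intro summable_mult)
  have sum_f: "(\<Sum>n. f n t) = of_real t powr (s - 1) * of_real (1 - t) powr (c - 1)" if "t \<in> {0<..<1}" for t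
  proof -
    have "(\<lambda>n. of_real t powr (s - 1) * (k n * of_real t ^ n)) sums
        (of_real t powr (s - 1) * (1 - of_real t) powr (- (1 - c)))"
      unfolding k_def by (intro sums_mult binomial_series) (use that in auto)
    moreover have "f n t = of_real t powr (s - 1) * (k n * of_real t ^ n)" for n
    proof -
      have "complex_of_real t powr (s + of_nat n - 1) = of_real t powr (s - 1) * of_real t powr of_nat n"
        by (simp add: powr_add [symmetric] algebra_simps)
      thus ?thesis using that by (simp add: f_def powr_nat' mult_ac)
    qed
    ultimately show ?thesis by (simp add: sums_iff)
  qed
  have "integrable unit_lebesgue (\<lambda>t. \<Sum>n. f n t)"
    by (rule suminf_interchange_integrable[OF meas bnd _ summ]) (use K in auto)
  thus "integrable unit_lebesgue (\<lambda>t. of_real t powr (s - 1) * of_real (1 - t) powr (c - 1))"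
    by (subst Bochner_Integration.integrable_cong[OF refl sum_f[symmetric]]) (auto simp: space_restrict_space)
  have "(\<lambda>n. integral\<^sup>L unit_lebesgue (f n)) sums (\<integral>t. (\<Sum>n. f n t) \<partial>unit_lebesgue)"
    by (rule suminf_interchange_sums[OF meas bnd _ summ]) (use K in auto)
  moreover have "(\<integral>t. (\<Sum>n. f n t) \<partial>unit_lebesgue) = (\<integral>t. of_real t powr (s - 1) * of_real (1 - t) powr (c - 1) \<partial>unit_lebesgue)"
    by (intro Bochner_Integration.integral_cong refl sum_f) (auto simp: space_restrict_space)
  moreover have "integral\<^sup>L unit_lebesgue (f n) = Gamma s * gauss_term (1 - c) s (s + 1) n" for n
    using power_integral[of "s + of_nat n"] s by (simp add: f_def trm [symmetric])
  ultimately have "(\<lambda>n. Gamma s * gauss_term (1 - c) s (s + 1) n) sums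
      (\<integral>t. of_real t powr (s - 1) * of_real (1 - t) powr (c - 1) \<partial>unit_lebesgue)" by simp
  moreover have "(\<lambda>n. Gamma s * gauss_term (1 - c) s (s + 1) n) sums (Gamma s * suminf (gauss_term (1 - c) s (s + 1)))"
    by (intro sums_mult summable_sums summable_gauss_term gs)
  ultimately have "(\<integral>t. of_real t powr (s - 1) * of_real (1 - t) powr (c - 1) \<partial>unit_lebesgue)
      = Gamma s * suminf (gauss_term (1 - c) s (s + 1))"
    by (rule sums_unique2)
  also have "\<dots> = Gamma s * Gamma c * rGamma (s + c)"
    using gauss_summation[OF gs] by (simp add: add_ac)
  finally show "(\<integral>t. of_real t powr (s - 1) * of_real (1 - t) powr (c - 1) \<partial>unit_lebesgue)
          = Gamma s * Gamma c * rGamma (s + c)" .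
qed

section \<open>The hypergeometric series and Euler's integral\<close>

definition hyp_coeff :: "complex \<Rightarrow> complex \<Rightarrow> complex \<Rightarrow> nat \<Rightarrow> complex" where
  "hyp_coeff a b c n = pochhammer a n * pochhammer b n / (pochhammer c n * fact n)"

definition hyp_series :: "complex \<Rightarrow> complex \<Rightarrow> complex \<Rightarrow> complex \<Rightarrow> complex" where
  "hyp_series a b c z = (\<Sum>n. hyp_coeff a b c n * z ^ n)"

lemma pochhammer_half_plane_nonzero:
  fixes c :: complex
  assumes "Re c > 0"
  shows "pochhammer c n \<noteq> 0"
  using half_plane_notin_nonpos_Ints[OF assms] by (auto simp: pochhammer_eq_0_iff)

lemma rGamma_shift:
  fixes c :: complex
  assumes "Re c > 0"
  shows "rGamma (c + of_nat n) = rGamma c / pochhammer c n"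
  using pochhammer_rGamma[of c n] pochhammer_half_plane_nonzero[OF assms, of n] by (simp add: field_simps)

lemma hyp_coeff_eq_gauss_term:
  assumes "Re c > 0"
  shows "hyp_coeff a b c n = Gamma c * gauss_term a b c n"
proof -
  have "Gamma c * rGamma c = 1"
    using half_plane_notin_nonpos_Ints[OF assms] by (simp add: rGamma_inverse_Gamma Gamma_eq_zero_iff)
  thus ?thesis using pochhammer_half_plane_nonzero[OF assms, of n]
    by (simp add: hyp_coeff_def gauss_term_def rGamma_shift[OF assms] field_simps)
qed

lemma summable_norm_hyp_series:
  assumes "Re c > 0" "norm z < 1"
  shows "summable (\<lambda>n. norm (hyp_coeff a b c n * z ^ n))"
proof -
  obtain C where C: "C > 0"
    "\<And>n. norm (gauss_term a b c n) \<le> C * (real n + 1) powr (Re (a + b - c) - 1)"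
    using norm_gauss_term_upper by blast
  define e where "e = Re (a + b - c) - 1"
  \<comment> \<open>Room between |z| and 1: r0 is positive even for z = 0, and the geometric gap between r0 and r
    absorbs the polynomial growth of the coefficients.\<close>
  define r0 where "r0 = (1 + norm z) / 2"
  define r where "r = (1 + r0) / 2"
  have r: "norm z \<le> r0" "0 < r0" "r0 < r" "r < 1" 
    using assms add_pos_nonneg[of 1 "norm z"] by (auto simp: r_def r0_def)
  define q where "q = r0 / r"
  have q: "0 < q" "q < 1" using r by (auto simp: q_def)
  have "(\<lambda>n. (real n + 1) powr e * q ^ n) \<longlonglongrightarrow> 0" using q by real_asymp
  hence "Bseq (\<lambda>n. (real n + 1) powr e * q ^ n)" using convergentI convergent_imp_Bseq by blast
  then obtain B where B: "B > 0" "\<And>n. norm ((real n + 1) powr e * q ^ n) \<le> B" by (auto elim!: BseqE)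
  have bnd: "norm (norm (hyp_coeff a b c n * z ^ n)) \<le> (norm (Gamma c) * C * B) * r ^ n" for n
  proof -
    have "norm (hyp_coeff a b c n * z ^ n) = norm (Gamma c) * norm (gauss_term a b c n) * norm z ^ n"
      by (simp add: hyp_coeff_eq_gauss_term[OF assms(1)] norm_mult norm_power)
    also have "\<dots> \<le> norm (Gamma c) * (C * (real n + 1) powr e) * r0 ^ n"
      using C r by (intro mult_mono mult_left_mono power_mono) (auto simp: e_def)
    also have "r0 ^ n = q ^ n * r ^ n" using r by (simp add: q_def flip: power_mult_distrib)
    also have "norm (Gamma c) * (C * (real n + 1) powr e) * (q ^ n * r ^ n) =
        (norm (Gamma c) * C) * ((real n + 1) powr e * q ^ n) * r ^ n" by (simp add: mult_ac)
    also have "\<dots> \<le> (norm (Gamma c) * C) * B * r ^ n"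
      using B(2)[of n] C(1) r by (intro mult_right_mono mult_left_mono) auto
    finally show ?thesis by simp
  qed
  have "summable (\<lambda>n. (norm (Gamma c) * C * B) * r ^ n)"
    using r by (intro summable_mult summable_geometric) auto
  thus ?thesis by (rule summable_comparison_test'[of _ 0]) (use bnd in auto)
qed

lemma hyp_series_sums:
  assumes "Re c > 0" "norm z < 1"
  shows "(\<lambda>n. hyp_coeff a b c n * z ^ n) sums hyp_series a b c z"
  unfolding hyp_series_def
  using summable_norm_cancel[OF summable_norm_hyp_series[OF assms]] by (rule summable_sums)

text \<open>
  All contiguous relations below have the shape \<open>F = F' + k z F''\<close> and amount to an identity
  between the coefficients with index \<open>n + 1\<close>, \<open>n + 1\<close> and \<open>n\<close>. They raise parameters and divide only by
  \<open>c\<close> and \<open>c + 1\<close>, so they never leave the half-plane \<open>Re c > 0\<close>.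
\<close>

lemma hyp_series_contiguousI:
  assumes "\<And>n. hyp_coeff a b c (Suc n) = hyp_coeff a' b' c' (Suc n) + k * hyp_coeff a'' b'' c'' n"
    and "Re c > 0" "Re c' > 0" "Re c'' > 0" "norm z < 1"
  shows "hyp_series a b c z = hyp_series a' b' c' z + k * z * hyp_series a'' b'' c'' z"
proof -
  have 1: "(\<lambda>n. hyp_coeff a' b' c' (Suc n) * z ^ Suc n) sums (hyp_series a' b' c' z - 1)"
    using hyp_series_sums[of c' z a' b'] assms by (subst sums_Suc_iff) (simp add: hyp_coeff_def)
  have 2: "(\<lambda>n. k * z * (hyp_coeff a'' b'' c'' n * z ^ n)) sums (k * z * hyp_series a'' b'' c'' z)"
    using assms by (intro sums_mult hyp_series_sums)
  have "(\<lambda>n. hyp_coeff a b c (Suc n) * z ^ Suc n) sums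
      ((hyp_series a' b' c' z - 1) + k * z * hyp_series a'' b'' c'' z)"
    using sums_add[OF 1 2] by (simp add: assms(1) algebra_simps)
  hence "(\<lambda>n. hyp_coeff a b c n * z ^ n) sums
      ((hyp_series a' b' c' z - 1) + k * z * hyp_series a'' b'' c'' z + 1)"
    by (subst (asm) sums_Suc_iff) (simp add: hyp_coeff_def)
  with hyp_series_sums[of c z a b] assms show ?thesis
    using sums_unique2 by fastforce
qed

lemma hyp_series_raise_b:
  assumes "Re c > 0" "norm z < 1"
  shows "hyp_series a b c z = hyp_series a (b + 1) c z + (- a / c) * z * hyp_series (a + 1) (b + 1) (c + 1) z"
proof (rule hyp_series_contiguousI)
  fix n
  have nz: "pochhammer (c + 1) n \<noteq> 0" "c \<noteq> 0"
    using assms pochhammer_half_plane_nonzero[of "c + 1" n] by auto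
  have s: "1 + of_nat n \<noteq> (0::complex)" by (metis of_nat_Suc of_nat_neq_0)
  have 1: "pochhammer (b + 1) (Suc n) = pochhammer (b + 1) n * (b + 1 + of_nat n)" by (simp add: pochhammer_Suc)
  show "hyp_coeff a b c (Suc n) = hyp_coeff a (b + 1) c (Suc n) + - a / c * hyp_coeff (a + 1) (b + 1) (c + 1) n"
    unfolding hyp_coeff_def 1 using nz s by (simp add: pochhammer_rec divide_simps) (simp add: algebra_simps)
qed (use assms in auto)

lemma hyp_series_raise_c:
  assumes "Re c > 0" "norm z < 1"
  shows "hyp_series a b c z = hyp_series a b (c + 1) z + (a * b / (c * (c + 1))) * z * hyp_series (a + 1) (b + 1) (c + 2) z"
proof (rule hyp_series_contiguousI)
  fix n
  have nz: "pochhammer (c + 2) n \<noteq> 0" "pochhammer (c + 1) n \<noteq> 0" "c \<noteq> 0" "c + 1 \<noteq> 0" "c + 1 + of_nat n \<noteq> 0"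
    using assms pochhammer_half_plane_nonzero[of "c + 1" n] pochhammer_half_plane_nonzero[of "c + 2" n]
    by (simp_all add: complex_eq_iff)
  have s: "1 + of_nat n \<noteq> (0::complex)" by (metis of_nat_Suc of_nat_neq_0)
  have "(c + 1) * pochhammer (c + 1 + 1) n = pochhammer (c + 1) n * (c + 1 + of_nat n)"
    using pochhammer_rec[of "c + 1" n] by (simp add: pochhammer_Suc)
  hence 1: "pochhammer (c + 2) n = pochhammer (c + 1) n * (c + 1 + of_nat n) / (c + 1)"
    using nz by (simp add: field_simps)
  have 2: "pochhammer (c + 1) (Suc n) = pochhammer (c + 1) n * (c + 1 + of_nat n)" by (simp add: pochhammer_Suc)
  show "hyp_coeff a b c (Suc n) = hyp_coeff a b (c + 1) (Suc n) + a * b / (c * (c + 1)) * hyp_coeff (a + 1) (b + 1) (c + 2) n"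
    unfolding hyp_coeff_def 1 2 using nz s
    by (simp add: pochhammer_rec divide_simps) (simp add: algebra_simps)
qed (use assms in auto)

text \<open>
  This is \<open>hyp_series_raise_c\<close> seen through Pfaff's transformation, under which \<open>b\<close> becomes \<open>c - b\<close>.
\<close>

lemma hyp_series_raise_b_c:
  assumes "Re c > 0" "norm z < 1"
  shows "hyp_series a b c z = hyp_series a (b + 1) (c + 1) z
       + (- a * (c - b) / (c * (c + 1))) * z * hyp_series (a + 1) (b + 1) (c + 2) z"
proof (rule hyp_series_contiguousI)
  fix n
  have nz: "pochhammer (c + 2) n \<noteq> 0" "pochhammer (c + 1) n \<noteq> 0" "c \<noteq> 0" "c + 1 \<noteq> 0" "c + 1 + of_nat n \<noteq> 0"
    using assms pochhammer_half_plane_nonzero[of "c + 1" n] pochhammer_half_plane_nonzero[of "c + 2" n]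
    by (simp_all add: complex_eq_iff)
  have s: "1 + of_nat n \<noteq> (0::complex)" by (metis of_nat_Suc of_nat_neq_0)
  have "(c + 1) * pochhammer (c + 1 + 1) n = pochhammer (c + 1) n * (c + 1 + of_nat n)"
    using pochhammer_rec[of "c + 1" n] by (simp add: pochhammer_Suc)
  hence 1: "pochhammer (c + 2) n = pochhammer (c + 1) n * (c + 1 + of_nat n) / (c + 1)"
    using nz by (simp add: field_simps)
  have 2: "pochhammer (c + 1) (Suc n) = pochhammer (c + 1) n * (c + 1 + of_nat n)" 
          "pochhammer (b + 1) (Suc n) = pochhammer (b + 1) n * (b + 1 + of_nat n)" by (simp_all add: pochhammer_Suc)
  show "hyp_coeff a b c (Suc n) = hyp_coeff a (b + 1) (c + 1) (Suc n)
      + - a * (c - b) / (c * (c + 1)) * hyp_coeff (a + 1) (b + 1) (c + 2) n"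
    unfolding hyp_coeff_def 1 2 using nz s
    by (simp add: pochhammer_rec divide_simps) (simp add: algebra_simps)
qed (use assms in auto)

abbreviation cut_plane :: "complex set" where
  "cut_plane \<equiv> - complex_of_real ` {1..}"

lemma open_cut_plane: "open cut_plane"
proof -
  have "complex_of_real ` {1..} = {z. Im z = 0} \<inter> {z. Re z \<ge> 1}"
    by (auto simp: complex_eq_iff image_iff)
  moreover have "closed ({z. Im z = 0} \<inter> {z. Re z \<ge> 1})"
    by (intro closed_Int closed_Collect_eq closed_Collect_le continuous_intros)
  ultimately show ?thesis by (metis open_Compl)
qed

lemma cut_plane_linear_factor:
  assumes "z \<in> cut_plane" "t \<in> {0..1}"
  shows "1 - z * of_real t \<notin> \<real>\<^sub>\<le>\<^sub>0"
proof
  assume "1 - z * of_real t \<in> \<real>\<^sub>\<le>\<^sub>0"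
  then obtain r where r: "r \<le> 0" "1 - z * of_real t = of_real r"
    by (auto elim!: nonpos_Reals_cases)
  hence zt: "z * of_real t = of_real (1 - r)" by (simp add: algebra_simps)
  with r have "t \<noteq> 0" by (auto simp: of_real_eq_0_iff simp del: of_real_diff)
  hence "z = of_real ((1 - r) / t)" using zt by (simp add: field_simps)
  moreover have "(1 - r) / t \<ge> 1" using \<open>t \<noteq> 0\<close> assms r by (simp add: field_simps)
  ultimately have "z \<in> complex_of_real ` {1..}" by (metis atLeast_iff imageI)
  thus False using assms(1) by simp
qed

definition euler_integrand :: "complex \<Rightarrow> complex \<Rightarrow> complex \<Rightarrow> complex \<Rightarrow> real \<Rightarrow> complex" where
  "euler_integrand a b c z t =
     of_real t powr (b - 1) * of_real (1 - t) powr (c - b - 1) * (1 - z * of_real t) powr (- a)"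

lemma continuous_on_euler_integrand:
  assumes "Re b > 1" "Re (c - b) > 1" "U \<subseteq> cut_plane"
  shows "continuous_on (U \<times> {0..1}) (\<lambda>(z, t). euler_integrand a b c z t)"
  unfolding euler_integrand_def case_prod_beta
proof (intro continuous_intros)
  show "U \<times> {0..1} \<subseteq> {x. 0 \<le> Re (1 - fst x * complex_of_real (snd x)) \<or> Im (1 - fst x * complex_of_real (snd x)) \<noteq> 0}"
    using cut_plane_linear_factor assms(3) by (fastforce simp: complex_nonpos_Reals_iff)
  show "z \<in> U \<times> {0..1} \<Longrightarrow> 1 - fst z * complex_of_real (snd z) = 0 \<Longrightarrow> 0 < Re (- a)" for z
    using cut_plane_linear_factor[of "fst z" "snd z"] assms(3) by auto
qed (use assms in auto)

text \<open>
  Parameters with \<open>Re b > 1\<close> and \<open>Re (c - b) > 1\<close> make the integrand continuous up to both endpoints, so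
  differentiation under the integral sign applies on a closed interval.
\<close>

lemma euler_integral_holomorphic:
  assumes "Re b > 1" "Re (c - b) > 1"
  shows "(\<lambda>z. integral {0..1} (euler_integrand a b c z)) holomorphic_on cut_plane"
proof (rule holomorphic_onI)
  fix z0 assume "z0 \<in> cut_plane"
  then obtain e where e: "e > 0" "ball z0 e \<subseteq> cut_plane"
    using open_cut_plane openE by blast
  have "(\<lambda>z. integral (cbox 0 1) (euler_integrand a b c z)) holomorphic_on ball z0 e"
  proof (rule leibniz_rule_holomorphic)
    fix z and t :: real
    assume z: "z \<in> ball z0 e" and t: "t \<in> cbox 0 1"
    hence "1 - z * of_real t \<notin> \<real>\<^sub>\<le>\<^sub>0" using e by (intro cut_plane_linear_factor) auto
    thus "((\<lambda>z. euler_integrand a b c z t) has_field_derivative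
        a * of_real t * euler_integrand (a + 1) b c z t) (at z within ball z0 e)"
      unfolding euler_integrand_def minus_add_distrib add_uminus_conv_diff
      by (auto intro!: derivative_eq_intros simp: mult_ac)
  next
    show "euler_integrand a b c z integrable_on cbox 0 1" if "z \<in> ball z0 e" for z
    proof (rule integrable_continuous)
      have "continuous_on (cbox 0 1) ((\<lambda>(z, t). euler_integrand a b c z t) \<circ> (\<lambda>t. (z, t)))"
        using that e by (intro continuous_on_compose continuous_intros
          continuous_on_subset[OF continuous_on_euler_integrand[OF assms e(2)]]) auto
      thus "continuous_on (cbox 0 1) (euler_integrand a b c z)" by (simp add: o_def)
    qed
    have "continuous_on (ball z0 e \<times> {0..1}) (\<lambda>x. a * of_real (snd x) * (\<lambda>(z, t). euler_integrand (a + 1) b c z t) x)"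
      by (intro continuous_intros continuous_on_euler_integrand assms e)
    thus "continuous_on (ball z0 e \<times> cbox 0 1) (\<lambda>(z, t). a * of_real t * euler_integrand (a + 1) b c z t)"
      by (simp add: case_prod_beta)
  qed auto
  hence "(\<lambda>z. integral {0..1} (euler_integrand a b c z)) field_differentiable at z0"
    using e by (simp add: holomorphic_on_imp_differentiable_at)
  thus "(\<lambda>z. integral {0..1} (euler_integrand a b c z)) field_differentiable at z0 within cut_plane"
    by (rule field_differentiable_at_within)
qed

lemma euler_integral_series:
  assumes b: "Re b > 0" and cb: "Re (c - b) > 0" and z: "norm z < 1"
  shows "integrable unit_lebesgue (euler_integrand a b c z)"
    and "integral\<^sup>L unit_lebesgue (euler_integrand a b c z) = Gamma b * Gamma (c - b) * rGamma c * hyp_series a b c z"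
proof -
  define k where "k = (\<lambda>n. pochhammer a n / fact n * z ^ n)"
  define f where "f = (\<lambda>n t. k n * (of_real t powr (b + of_nat n - 1) * of_real (1 - t) powr (c - b - 1)))"
  have c: "Re c > 0" using b cb by simp
  have f_eq: "f n t = of_real t powr (b - 1) * of_real (1 - t) powr (c - b - 1) *
      (pochhammer a n / fact n * (z * of_real t) ^ n)" if "t \<in> {0<..<1}" for t n
  proof -
    have "complex_of_real t powr (b + of_nat n - 1) = of_real t powr (b - 1) * of_real t powr of_nat n"
      by (simp add: powr_add [symmetric] algebra_simps)
    thus ?thesis using that by (simp add: f_def k_def powr_nat' power_mult_distrib mult_ac)
  qed
  have sum_f: "(\<Sum>n. f n t) = euler_integrand a b c z t" if "t \<in> {0<..<1}" for t
  proof -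
    have "norm (z * of_real t) < 1"
      using z that mult_strict_mono'[of "norm z" 1 t 1] by (simp add: norm_mult)
    from binomial_series[OF this, of a]
    have "(\<lambda>n. of_real t powr (b - 1) * of_real (1 - t) powr (c - b - 1) *
      (pochhammer a n / fact n * (z * of_real t) ^ n)) sums euler_integrand a b c z t"
      unfolding euler_integrand_def by (rule sums_mult)
    thus ?thesis by (simp add: f_eq[OF that] sums_iff)
  qed
  have meas: "f n \<in> borel_measurable unit_lebesgue" for n
    unfolding f_def by (intro continuous_imp_measurable_unit continuous_intros) auto
  have bnd: "(\<integral>\<^sup>+t. ennreal (norm (f n t)) \<partial>unit_lebesgue) \<le> ennreal (norm (k n) * Beta (Re b) (Re (c - b)))" for n
  proof -
    have "(\<integral>\<^sup>+t. ennreal (norm (f n t)) \<partial>unit_lebesgue) \<le>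
        (\<integral>\<^sup>+t. ennreal (norm (k n)) * ennreal (t powr (Re b - 1) * (1 - t) powr (Re (c - b) - 1)) \<partial>unit_lebesgue)"
    proof (rule nn_integral_mono)
      fix t assume "t \<in> space unit_lebesgue"
      hence t: "0 < t" "t < 1" by (auto simp: space_restrict_space)
      have "norm (f n t) = norm (k n) * (t powr (Re b + n - 1) * (1 - t) powr (Re (c - b) - 1))"
        using t norm_of_real_powr[of t] norm_of_real_powr[of "1 - t"] by (simp add: f_def norm_mult del: of_real_diff)
      also have "\<dots> \<le> norm (k n) * (t powr (Re b - 1) * (1 - t) powr (Re (c - b) - 1))"
        using t by (intro mult_left_mono mult_right_mono powr_mono') auto
      finally show "ennreal (norm (f n t)) \<le> ennreal (norm (k n)) * ennreal (t powr (Re b - 1) * (1 - t) powr (Re (c - b) - 1))"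
        by (simp add: ennreal_mult[symmetric] ennreal_leI)
    qed
    also have "\<dots> = ennreal (norm (k n)) * (\<integral>\<^sup>+t. ennreal (t powr (Re b - 1) * (1 - t) powr (Re (c - b) - 1)) \<partial>unit_lebesgue)"
      by (rule nn_integral_cmult) (intro measurable_restrict_space1, measurable)
    also have "\<dots> = ennreal (norm (k n)) * ennreal (Beta (Re b) (Re (c - b)))"
      by (subst nn_integral_Beta) (use b cb in auto)
    also have "\<dots> = ennreal (norm (k n) * Beta (Re b) (Re (c - b)))"
      by (simp add: ennreal_mult')
    finally show ?thesis .
  qed
  have Beta_nonneg: "Beta (Re b) (Re (c - b)) \<ge> 0"
    unfolding Beta_def using b cb by (intro divide_nonneg_nonneg mult_nonneg_nonneg less_imp_le[OF Gamma_real_pos]) auto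
  have summ: "summable (\<lambda>n. norm (k n) * Beta (Re b) (Re (c - b)))"
  proof (rule summable_mult2)
    \<comment> \<open>The binomial series is itself hypergeometric.\<close>
    have "k = (\<lambda>n. hyp_coeff a 1 1 n * z ^ n)"
      by (auto simp: fun_eq_iff k_def hyp_coeff_def simp flip: pochhammer_fact)
    thus "summable (\<lambda>n. norm (k n))" using summable_norm_hyp_series[of 1 z a 1] z by simp
  qed
  have "integrable unit_lebesgue (\<lambda>t. \<Sum>n. f n t)"
    by (rule suminf_interchange_integrable[OF meas bnd _ summ]) (use Beta_nonneg in auto)
  thus "integrable unit_lebesgue (euler_integrand a b c z)"
    by (subst Bochner_Integration.integrable_cong[OF refl sum_f[symmetric]]) (auto simp: space_restrict_space)
  have "(\<lambda>n. integral\<^sup>L unit_lebesgue (f n)) sums (\<integral>t. (\<Sum>n. f n t) \<partial>unit_lebesgue)"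
    by (rule suminf_interchange_sums[OF meas bnd _ summ]) (use Beta_nonneg in auto)
  moreover have "(\<integral>t. (\<Sum>n. f n t) \<partial>unit_lebesgue) = integral\<^sup>L unit_lebesgue (euler_integrand a b c z)"
    by (intro Bochner_Integration.integral_cong refl sum_f) (auto simp: space_restrict_space)
  moreover have "integral\<^sup>L unit_lebesgue (f n) = Gamma b * Gamma (c - b) * rGamma c * (hyp_coeff a b c n * z ^ n)" for n
  proof -
    have "integral\<^sup>L unit_lebesgue (f n) = k n * (Gamma (b + of_nat n) * Gamma (c - b) * rGamma (c + of_nat n))"
      using complex_Beta_integral(2)[of "b + of_nat n" "c - b"] b cb by (simp add: f_def algebra_simps)
    also have "Gamma (b + of_nat n) = Gamma b * pochhammer b n"
      using half_plane_notin_nonpos_Ints[OF b] by (simp add: pochhammer_Gamma Gamma_eq_zero_iff)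
    finally show ?thesis by (simp add: rGamma_shift[OF c] k_def hyp_coeff_def mult_ac)
  qed
  ultimately have "(\<lambda>n. Gamma b * Gamma (c - b) * rGamma c * (hyp_coeff a b c n * z ^ n)) sums
     integral\<^sup>L unit_lebesgue (euler_integrand a b c z)" by simp
  moreover have "(\<lambda>n. Gamma b * Gamma (c - b) * rGamma c * (hyp_coeff a b c n * z ^ n)) sums
     (Gamma b * Gamma (c - b) * rGamma c * hyp_series a b c z)"
    by (intro sums_mult hyp_series_sums c z)
  ultimately show "integral\<^sup>L unit_lebesgue (euler_integrand a b c z) = Gamma b * Gamma (c - b) * rGamma c * hyp_series a b c z"
    by (rule sums_unique2)
qed

text \<open>
  The substitution \<open>t\<close> to \<open>1 - t\<close> proves Pfaff's transformation. For negative \<open>x\<close> all bases of the powers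
  are positive reals, so no branch question arises.
\<close>

lemma euler_integral_reflect:
  assumes "Re b > 1" "Re (c - b) > 1" and x: "x < 0"
  shows "integral {0..1} (euler_integrand a b c (of_real x))
       = of_real (1 - x) powr (- a) * integral {0..1} (euler_integrand a (c - b) c (of_real (x / (x - 1))))"
proof -
  have "of_real x \<in> cut_plane" using x by auto
  hence "continuous_on {0..1} ((\<lambda>(z, t). euler_integrand a b c z t) \<circ> (\<lambda>t. (of_real x, t)))"
    using assms by (intro continuous_on_compose continuous_intros
          continuous_on_subset[OF continuous_on_euler_integrand[OF assms(1,2), of "{of_real x}"]]) auto
  hence "euler_integrand a b c (of_real x) integrable_on cbox 0 1"
    by (intro integrable_continuous) (simp add: o_def)
  hence "((\<lambda>t. euler_integrand a b c (of_real x) t) has_integral integral {0..1} (euler_integrand a b c (of_real x))) (cbox 0 1)"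
    by (simp add: integrable_integral)
  from has_integral_affinity[OF this, of "-1" 1]
  have "((\<lambda>t. euler_integrand a b c (of_real x) (1 - t)) has_integral integral {0..1} (euler_integrand a b c (of_real x))) {0..1}"
    by simp
  moreover have "euler_integrand a b c (of_real x) (1 - t) =
      of_real (1 - x) powr (- a) * euler_integrand a (c - b) c (of_real (x / (x - 1))) t" if t: "t \<in> {0..1}" for t
  proof -
    define w where "w = x / (x - 1)"
    have w: "0 < w" "w < 1" using x by (auto simp: w_def field_simps)
    have "1 - x * (1 - t) = (1 - x) * (1 - w * t)" using x by (simp add: w_def field_simps)
    hence "1 - of_real x * of_real (1 - t) = (of_real (1 - x) * of_real (1 - w * t) :: complex)"
      by (metis of_real_1 of_real_diff of_real_mult)
    moreover have "w * t < 1" using w t by (metis atLeastAtMost_iff less_le_trans mult.commute mult_left_le_one_le less_imp_le le_less_trans)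
    hence "(of_real (1 - x) * of_real (1 - w * t) :: complex) powr (- a) = of_real (1 - x) powr (- a) * of_real (1 - w * t) powr (- a)"
      using x by (intro powr_times_real) auto
    ultimately show ?thesis by (simp add: euler_integrand_def w_def mult_ac)
  qed
  ultimately have "((\<lambda>t. of_real (1 - x) powr (- a) * euler_integrand a (c - b) c (of_real (x / (x - 1))) t)
      has_integral integral {0..1} (euler_integrand a b c (of_real x))) {0..1}"
    by (rule has_integral_eq[rotated]) auto
  from integral_unique[OF this] show ?thesis by simp
qed

section \<open>Continuation of the Gauss function to the cut plane\<close>

text \<open>
  The third clause is Pfaff's transformation on the negative axis. It belongs to the definition so that a single
  induction on the parameters yields the continuation and the transformation together.
\<close>

definition hyp_continuation :: "complex \<Rightarrow> complex \<Rightarrow> complex \<Rightarrow> (complex \<Rightarrow> complex) \<Rightarrow> bool" where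
  "hyp_continuation a b c H \<longleftrightarrow>
     H holomorphic_on cut_plane \<and>
     (\<forall>z. norm z < 1 \<longrightarrow> H z = hyp_series a b c z) \<and>
     (\<forall>x<0. H (of_real x) = of_real (1 - x) powr (- a) * hyp_series a (c - b) c (of_real (x / (x - 1))))"

lemma hyp_continuation_euler:
  assumes b: "Re b > 1" and cb: "Re (c - b) > 1"
  shows "\<exists>H. hyp_continuation a b c H"
proof -
  define k where "k = Gamma c * rGamma b * rGamma (c - b)"
  have k: "k * (Gamma b * Gamma (c - b) * rGamma c) = 1"
  proof -
    have *: "Gamma z * rGamma z = 1" if "Re z > 0" for z :: complex
      using half_plane_notin_nonpos_Ints[OF that] by (simp add: rGamma_inverse_Gamma Gamma_eq_zero_iff)
    have "k * (Gamma b * Gamma (c - b) * rGamma c) =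
        (Gamma b * rGamma b) * (Gamma c * rGamma c) * (Gamma (c - b) * rGamma (c - b))"
      by (simp add: k_def mult_ac)
    also have "\<dots> = 1" using b cb by (simp add: *)
    finally show ?thesis .
  qed
  define H where "H = (\<lambda>z. k * integral {0..1} (euler_integrand a b c z))"
  have val: "integral {0..1} (euler_integrand a b' c z) = Gamma b' * Gamma (c - b') * rGamma c * hyp_series a b' c z"
    if "Re b' > 0" "Re (c - b') > 0" "norm z < 1" for b' z
    using euler_integral_series[OF that, of a] by (simp add: lebesgue_unit_eq_integral)
  have "H holomorphic_on cut_plane"
    unfolding H_def by (intro holomorphic_intros euler_integral_holomorphic assms)
  moreover have "H z = hyp_series a b c z" if "norm z < 1" for z
  proof -
    have "H z = (k * (Gamma b * Gamma (c - b) * rGamma c)) * hyp_series a b c z"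
      unfolding H_def using b cb that by (subst val) (auto simp: mult_ac)
    thus ?thesis by (simp add: k)
  qed
  moreover have "H (of_real x) = of_real (1 - x) powr (- a) * hyp_series a (c - b) c (of_real (x / (x - 1)))"
    if x: "x < 0" for x
  proof -
    have "norm (complex_of_real (x / (x - 1))) < 1"
      unfolding norm_of_real using x by (simp add: field_simps)
    hence "integral {0..1} (euler_integrand a (c - b) c (of_real (x / (x - 1)))) =
        Gamma (c - b) * Gamma b * rGamma c * hyp_series a (c - b) c (of_real (x / (x - 1)))"
      using val[of "c - b" "of_real (x / (x - 1))"] b cb by simp
    hence "H (of_real x) = (k * (Gamma b * Gamma (c - b) * rGamma c)) *
        (of_real (1 - x) powr (- a) * hyp_series a (c - b) c (of_real (x / (x - 1))))"
      unfolding H_def euler_integral_reflect[OF assms x] by (simp add: mult_ac)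
    thus ?thesis by (simp add: k)
  qed
  ultimately show ?thesis unfolding hyp_continuation_def by blast
qed

lemma pfaff_argument_bound:
  fixes x :: real
  assumes "x < 0"
  shows "norm (complex_of_real (x / (x - 1))) < 1"
  unfolding norm_of_real using assms by (simp add: field_simps)

text \<open>
  Both the power series and the right-hand side of Pfaff's transformation satisfy the relation that raises \<open>c\<close>:
  for the latter it is \<open>hyp_series_raise_b_c\<close> at \<open>w = x / (x - 1)\<close>, using \<open>x = - w (1 - x)\<close>.
\<close>

lemma hyp_continuation_lower_c:
  assumes c: "Re c > 0"
    and "\<exists>H. hyp_continuation a b (c + 1) H" "\<exists>H. hyp_continuation (a + 1) (b + 1) (c + 2) H"
  shows "\<exists>H. hyp_continuation a b c H"
proof -
  obtain H1 H2 where H: "hyp_continuation a b (c + 1) H1" "hyp_continuation (a + 1) (b + 1) (c + 2) H2"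
    using assms by blast
  define H where "H = (\<lambda>z. H1 z + (a * b / (c * (c + 1))) * z * H2 z)"
  have "H holomorphic_on cut_plane"
    unfolding H_def using H by (intro holomorphic_intros) (auto simp: hyp_continuation_def)
  moreover have "H z = hyp_series a b c z" if "norm z < 1" for z
    using H that hyp_series_raise_c[OF c that, of a b] by (simp add: H_def hyp_continuation_def)
  moreover have "H (of_real x) = of_real (1 - x) powr (- a) * hyp_series a (c - b) c (of_real (x / (x - 1)))"
    if x: "x < 0" for x
  proof -
    define w where "w = complex_of_real (x / (x - 1))"
    define k where "k = a * b / (c * (c + 1))"
    define P where "P = complex_of_real (1 - x) powr (- a)"
    define Q where "Q = complex_of_real (1 - x) powr (- a - 1)"
    have w: "norm w < 1" unfolding w_def by (rule pfaff_argument_bound[OF x])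
    have PQ: "P = Q * of_real (1 - x)"
      using x by (simp add: P_def Q_def powr_diff)
    have "x = - (x / (x - 1)) * (1 - x)" using x by (simp add: field_simps)
    hence xw: "of_real x = - w * of_real (1 - x)"
      unfolding w_def by (metis of_real_minus of_real_mult)
    have xQ: "of_real x * Q = - w * P"
      unfolding PQ by (subst xw) (simp add: mult_ac)
    have ex: "- (a + 1) = - a - 1" "c + 1 - b = c - b + 1" "c + 2 - (b + 1) = c - b + 1"
      by simp_all
    have e1: "H1 (of_real x) = P * hyp_series a (c - b + 1) (c + 1) w"
      using H(1) x unfolding hyp_continuation_def P_def w_def by (metis ex)
    have e2: "H2 (of_real x) = Q * hyp_series (a + 1) (c - b + 1) (c + 2) w"
      using H(2) x unfolding hyp_continuation_def Q_def w_def by (metis ex)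
    have "H (of_real x) = P * hyp_series a (c - b + 1) (c + 1) w + k * (of_real x * Q) * hyp_series (a + 1) (c - b + 1) (c + 2) w"
      unfolding H_def e1 e2 k_def[symmetric] by (simp only: mult_ac)
    also have "\<dots> = P * (hyp_series a (c - b + 1) (c + 1) w + - k * w * hyp_series (a + 1) (c - b + 1) (c + 2) w)"
      unfolding xQ by (simp add: algebra_simps)
    also have "\<dots> = P * hyp_series a (c - b) c w"
      using hyp_series_raise_b_c[OF c w, of a "c - b"] by (simp add: k_def)
    finally show ?thesis by (simp add: w_def P_def)
  qed
  ultimately show ?thesis unfolding hyp_continuation_def by blast
qed

lemma hyp_continuation_lower_b:
  assumes c: "Re c > 0"
    and "\<exists>H. hyp_continuation a (b + 1) c H" "\<exists>H. hyp_continuation (a + 1) (b + 1) (c + 1) H"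
  shows "\<exists>H. hyp_continuation a b c H"
proof -
  obtain H1 H2 where H: "hyp_continuation a (b + 1) c H1" "hyp_continuation (a + 1) (b + 1) (c + 1) H2"
    using assms by blast
  define H where "H = (\<lambda>z. H1 z + (- a / c) * z * H2 z)"
  have "H holomorphic_on cut_plane"
    unfolding H_def using H by (intro holomorphic_intros) (auto simp: hyp_continuation_def)
  moreover have "H z = hyp_series a b c z" if "norm z < 1" for z
    using H that hyp_series_raise_b[OF c that, of a b] by (simp add: H_def hyp_continuation_def)
  moreover have "H (of_real x) = of_real (1 - x) powr (- a) * hyp_series a (c - b) c (of_real (x / (x - 1)))"
    if x: "x < 0" for x
  proof -
    define w where "w = complex_of_real (x / (x - 1))"
    define k where "k = - a / c"
    define P where "P = complex_of_real (1 - x) powr (- a)"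
    define Q where "Q = complex_of_real (1 - x) powr (- a - 1)"
    have w: "norm w < 1" unfolding w_def by (rule pfaff_argument_bound[OF x])
    have PQ: "P = Q * of_real (1 - x)"
      using x by (simp add: P_def Q_def powr_diff)
    have "x = - (x / (x - 1)) * (1 - x)" using x by (simp add: field_simps)
    hence xw: "of_real x = - w * of_real (1 - x)"
      unfolding w_def by (metis of_real_minus of_real_mult)
    have xQ: "of_real x * Q = - w * P"
      unfolding PQ by (subst xw) (simp add: mult_ac)
    have ex: "- (a + 1) = - a - 1" "c - (b + 1) = c - b - 1" "c + 1 - (b + 1) = c - b"
      by simp_all
    have e1: "H1 (of_real x) = P * hyp_series a (c - b - 1) c w"
      using H(1) x unfolding hyp_continuation_def P_def w_def by (metis ex)
    have e2: "H2 (of_real x) = Q * hyp_series (a + 1) (c - b) (c + 1) w"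
      using H(2) x unfolding hyp_continuation_def Q_def w_def by (metis ex)
    have "H (of_real x) = P * hyp_series a (c - b - 1) c w + k * (of_real x * Q) * hyp_series (a + 1) (c - b) (c + 1) w"
      unfolding H_def e1 e2 k_def[symmetric] by (simp only: mult_ac)
    also have "\<dots> = P * (hyp_series a (c - b - 1) c w + - k * w * hyp_series (a + 1) (c - b) (c + 1) w)"
      unfolding xQ by (simp add: algebra_simps)
    also have "\<dots> = P * hyp_series a (c - b) c w"
      using hyp_series_raise_b[OF c w, of a "c - b - 1"] by (simp add: k_def)
    finally show ?thesis by (simp add: w_def P_def)
  qed
  ultimately show ?thesis unfolding hyp_continuation_def by blast
qed

text \<open>
  Raising \<open>c\<close> increases \<open>Re (c - b)\<close> and raising \<open>b\<close> increases \<open>Re b\<close>, until Euler's integral applies. The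
  order matters: \<open>hyp_continuation_lower_c\<close> preserves \<open>Re b > 1\<close>, whereas \<open>hyp_continuation_lower_b\<close> may decrease
  \<open>Re (c - b)\<close> and is used once that quantity is unrestricted.
\<close>

lemma hyp_continuation_exists:
  assumes c: "Re c > 0"
  shows "\<exists>H. hyp_continuation a b c H"
proof -
  have 1: "\<exists>H. hyp_continuation a b c H" if "Re c > 0" "Re b > 1" "Re (c - b) > 1 - real k" for k a b c
    using that
  proof (induction k arbitrary: a b c)
    case 0
    thus ?case by (intro hyp_continuation_euler) auto
  next
    case (Suc k)
    show ?case
    proof (rule hyp_continuation_lower_c[OF Suc.prems(1)])
      show "\<exists>H. hyp_continuation a b (c + 1) H" using Suc.prems by (intro Suc.IH) auto
      show "\<exists>H. hyp_continuation (a + 1) (b + 1) (c + 2) H" using Suc.prems by (intro Suc.IH) auto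
    qed
  qed
  have 2: "\<exists>H. hyp_continuation a b c H" if "Re c > 0" "Re b > 1" for a b c
  proof -
    obtain k where "1 - Re (c - b) < real k" using reals_Archimedean2 by blast
    thus ?thesis using 1[OF that, of k] by simp
  qed
  have 3: "\<exists>H. hyp_continuation a b c H" if "Re c > 0" "Re b > 1 - real k" for k a b c
    using that
  proof (induction k arbitrary: a b c)
    case 0
    thus ?case by (intro 2) auto
  next
    case (Suc k)
    show ?case
    proof (rule hyp_continuation_lower_b[OF Suc.prems(1)])
      show "\<exists>H. hyp_continuation a (b + 1) c H" using Suc.prems by (intro Suc.IH) auto
      show "\<exists>H. hyp_continuation (a + 1) (b + 1) (c + 1) H" using Suc.prems by (intro Suc.IH) auto
    qed
  qed
  obtain k where "1 - Re b < real k" using reals_Archimedean2 by blast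
  thus ?thesis using 3[OF c, of k b a] by simp
qed

lemma hyp2F1_unfold:
  "hyp2F1 a b c = (SOME F. F holomorphic_on cut_plane \<and> (\<forall>z. norm z < 1 \<longrightarrow> F z = hyp_series a b c z))"
  by (simp add: hyp2F1_def hyp_series_def hyp_coeff_def)

lemma hyp2F1_continues_series:
  assumes "Re c > 0"
  shows "hyp2F1 a b c holomorphic_on cut_plane" "norm z < 1 \<Longrightarrow> hyp2F1 a b c z = hyp_series a b c z"
proof -
  obtain H where H: "hyp_continuation a b c H" using hyp_continuation_exists[OF assms] by blast
  have "hyp2F1 a b c holomorphic_on cut_plane \<and> (\<forall>z. norm z < 1 \<longrightarrow> hyp2F1 a b c z = hyp_series a b c z)"
    unfolding hyp2F1_unfold by (rule someI[of _ H]) (use H in \<open>auto simp: hyp_continuation_def\<close>)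
  thus "hyp2F1 a b c holomorphic_on cut_plane" "norm z < 1 \<Longrightarrow> hyp2F1 a b c z = hyp_series a b c z" by auto
qed

lemma connected_cut_plane: "connected cut_plane"
proof (rule starlike_imp_connected)
  have "closed_segment 0 z \<subseteq> cut_plane" if z: "z \<in> cut_plane" for z
  proof
    fix w assume "w \<in> closed_segment 0 z"
    then obtain u where u: "0 \<le> u" "u \<le> 1" "w = of_real u * z"
      by (auto simp: in_segment scaleR_conv_of_real)
    show "w \<in> cut_plane"
    proof (rule ccontr)
      assume "w \<notin> cut_plane"
      then obtain r where r: "r \<ge> 1" "w = of_real r" by auto
      have "1 - z * of_real u = of_real (1 - r)" using u r by (simp add: mult.commute)
      hence "1 - z * of_real u \<in> \<real>\<^sub>\<le>\<^sub>0" using r by (simp add: complex_nonpos_Reals_iff)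
      thus False using cut_plane_linear_factor[OF z, of u] u by simp
    qed
  qed
  moreover have "0 \<in> cut_plane" by auto
  ultimately show "starlike cut_plane" unfolding starlike_def by blast
qed

lemma unit_disc_subset_cut_plane: "ball 0 1 \<subseteq> cut_plane"
  by auto

text \<open>
  The identity theorem removes the choice in \<open>hyp2F1\<close>: identities between power series on the unit disc extend
  to the cut plane.
\<close>

lemma hyp2F1_unique:
  assumes c: "Re c > 0" and H: "H holomorphic_on cut_plane"
    "\<And>z. norm z < 1 \<Longrightarrow> H z = hyp_series a b c z" and z: "z \<in> cut_plane"
  shows "hyp2F1 a b c z = H z"
proof (rule analytic_continuation_open[of "ball 0 1" cut_plane "hyp2F1 a b c" H])
  show "hyp2F1 a b c z = H z" if "z \<in> ball 0 1" for z
    using that hyp2F1_continues_series(2)[OF c, of z a b] H(2)[of z] by simp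
qed (use assms hyp2F1_continues_series[OF c] open_cut_plane connected_cut_plane unit_disc_subset_cut_plane in auto)

lemma hyp2F1_pfaff:
  assumes c: "Re c > 0" and x: "x < 0"
  shows "hyp2F1 a b c (of_real x) = of_real (1 - x) powr (- a) * hyp_series a (c - b) c (of_real (x / (x - 1)))"
proof -
  obtain H where H: "hyp_continuation a b c H" using hyp_continuation_exists[OF c] by blast
  have "hyp2F1 a b c (of_real x) = H (of_real x)"
    by (rule hyp2F1_unique[OF c]) (use H x in \<open>auto simp: hyp_continuation_def\<close>)
  thus ?thesis using H x by (simp add: hyp_continuation_def)
qed

lemma hyp2F1_commute: "hyp2F1 a b c = hyp2F1 b a c"
  by (simp add: hyp2F1_def mult.commute)

lemma hyp2F1_raise_c:
  assumes c: "Re c > 0" and z: "z \<in> cut_plane"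
  shows "hyp2F1 a b c z = hyp2F1 a b (c + 1) z + (a * b / (c * (c + 1))) * z * hyp2F1 (a + 1) (b + 1) (c + 2) z"
proof (rule hyp2F1_unique[OF c _ _ z])
  show "(\<lambda>z. hyp2F1 a b (c + 1) z + (a * b / (c * (c + 1))) * z * hyp2F1 (a + 1) (b + 1) (c + 2) z) holomorphic_on cut_plane"
    by (intro holomorphic_intros hyp2F1_continues_series) (use c in auto)
  show "hyp2F1 a b (c + 1) z + (a * b / (c * (c + 1))) * z * hyp2F1 (a + 1) (b + 1) (c + 2) z = hyp_series a b c z"
    if "norm z < 1" for z
    using c that by (simp add: hyp2F1_continues_series hyp_series_raise_c[OF c that, of a b])
qed

lemma hyp2F1_raise_a:
  assumes c: "Re c > 0" and z: "z \<in> cut_plane"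
  shows "hyp2F1 a b c z = hyp2F1 (a + 1) b c z + (- b / c) * z * hyp2F1 (a + 1) (b + 1) (c + 1) z"
  unfolding hyp2F1_commute[of a] hyp2F1_commute[of "a + 1"]
proof (rule hyp2F1_unique[OF c _ _ z])
  show "(\<lambda>z. hyp2F1 b (a + 1) c z + (- b / c) * z * hyp2F1 (b + 1) (a + 1) (c + 1) z) holomorphic_on cut_plane"
    by (intro holomorphic_intros hyp2F1_continues_series) (use c in auto)
  show "hyp2F1 b (a + 1) c z + (- b / c) * z * hyp2F1 (b + 1) (a + 1) (c + 1) z = hyp_series b a c z"
    if "norm z < 1" for z
    using c that by (simp add: hyp2F1_continues_series hyp_series_raise_b[OF c that, of b a])
qed

section \<open>The Mellin transform of the Gauss function\<close>

lemma norm_pochhammer_of_real: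
  assumes "x > 0"
  shows "norm (pochhammer (complex_of_real x) n) = pochhammer x n"
  using pochhammer_pos[OF assms, of n] by (simp add: pochhammer_of_real)

lemma Gamma_shift_real:
  fixes x :: real
  assumes "x > 0"
  shows "Gamma (x + real n) = Gamma x * pochhammer x n"
proof -
  have "x \<notin> \<int>\<^sub>\<le>\<^sub>0" using assms by (auto elim!: nonpos_Ints_cases)
  thus ?thesis by (simp add: pochhammer_Gamma Gamma_eq_zero_iff)
qed

lemma Gamma_ratio_upper:
  fixes x y :: real
  assumes "x > 0" "y > 0"
  obtains C where "C > 0" "\<And>n. Gamma (x + real n) * rGamma (y + real n) \<le> C * (real n + 1) powr (x - y)"
proof -
  obtain A where A: "A > 0" "\<And>n. norm (pochhammer (complex_of_real x) n) \<le> A * (fact n * (real n + 1) powr (Re x - 1))"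
    using norm_pochhammer_upper by blast
  obtain B where B: "B > 0" "\<And>n. fact n * (real n + 1) powr (Re y - 1) \<le> B * norm (pochhammer (complex_of_real y) n)"
    using norm_pochhammer_lower[of "complex_of_real y"] assms by auto
  have "Gamma (x + real n) * rGamma (y + real n) \<le> (Gamma x * A * B / Gamma y) * (real n + 1) powr (x - y)" for n
  proof -
    have px: "pochhammer x n \<le> A * (fact n * (real n + 1) powr (x - 1))"
      using A(2)[of n] assms by (simp add: norm_pochhammer_of_real)
    have py: "fact n * (real n + 1) powr (y - 1) \<le> B * pochhammer y n"
      using B(2)[of n] assms by (simp add: norm_pochhammer_of_real)
    have pos: "pochhammer y n > 0" "Gamma x > 0" "Gamma y > 0" using assms by (auto intro: pochhammer_pos Gamma_real_pos)
    have "pochhammer x n / pochhammer y n \<le> A * (fact n * (real n + 1) powr (x - 1)) / pochhammer y n"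
      using px pos by (intro divide_right_mono) auto
    also have "\<dots> \<le> A * (fact n * (real n + 1) powr (x - 1)) / (fact n * (real n + 1) powr (y - 1) / B)"
      using py pos A B by (intro divide_left_mono mult_nonneg_nonneg mult_pos_pos) (auto simp: field_simps)
    also have "\<dots> = A * B * (real n + 1) powr (x - y)"
      by (simp add: powr_diff)
    finally have "Gamma x / Gamma y * (pochhammer x n / pochhammer y n) \<le> Gamma x / Gamma y * (A * B * (real n + 1) powr (x - y))"
      using pos by (intro mult_left_mono) auto
    thus ?thesis using assms by (simp add: rGamma_inverse_Gamma Gamma_shift_real field_simps)
  qed
  moreover have "Gamma x * A * B / Gamma y > 0" using A B assms by (simp add: Gamma_real_pos)
  ultimately show ?thesis using that by blast
qed

lemma Beta_eq_ratio:
  fixes q h :: real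
  shows "Beta q (h + real n) = Gamma q * (Gamma (h + real n) * rGamma (q + h + real n))"
  by (simp add: Beta_def rGamma_inverse_Gamma divide_inverse add_ac)

lemma Beta_upper:
  fixes q h :: real
  assumes "q > 0" "h > 0"
  obtains C where "C > 0" "\<And>n. Beta q (h + real n) \<le> C * (real n + 1) powr (- q)"
proof -
  obtain C where C: "C > 0" "\<And>n. Gamma (h + real n) * rGamma (q + h + real n) \<le> C * (real n + 1) powr (h - (q + h))"
    using Gamma_ratio_upper[of h "q + h"] assms by auto
  have "Beta q (h + real n) \<le> (Gamma q * C) * (real n + 1) powr (- q)" for n
    using mult_left_mono[OF C(2)[of n], of "Gamma q"] assms Gamma_real_pos[of q] by (simp add: Beta_eq_ratio)
  moreover have "Gamma q * C > 0" using C assms by (simp add: Gamma_real_pos)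
  ultimately show ?thesis using that by blast
qed

lemma Beta_pos_real:
  fixes q h :: real
  assumes "q > 0" "h > 0"
  shows "Beta q h > 0"
  using assms by (simp add: Beta_def Gamma_real_pos)

text \<open>
  Both sides decay like \<open>n powr (- q)\<close>, whatever the fixed shifts \<open>h\<close> and \<open>g\<close> are.
\<close>

lemma Beta_comparison:
  fixes q h g :: real
  assumes "q > 0" "h > 0" "g > 0"
  obtains C where "C > 0" "\<And>n. Beta q (h + real n) \<le> C * Beta q (g + real n)"
proof -
  obtain C where C: "C > 0" "\<And>n. Beta q (h + real n) \<le> C * (real n + 1) powr (- q)"
    using Beta_upper[OF assms(1,2)] by blast
  obtain D where D: "D > 0" "\<And>n. Gamma (q + g + real n) * rGamma (g + real n) \<le> D * (real n + 1) powr (q + g - g)"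
    using Gamma_ratio_upper[of "q + g" g] assms by auto
  have "Beta q (h + real n) \<le> (C * D / Gamma q) * Beta q (g + real n)" for n
  proof -
    have pos: "Gamma q > 0" "Gamma (g + real n) > 0" "Gamma (q + g + real n) > 0" "(real n + 1) powr q > 0"
      using assms by (auto intro!: Gamma_real_pos)
    have "1 / (D * (real n + 1) powr q) \<le> 1 / (Gamma (q + g + real n) * rGamma (g + real n))"
      using D(2)[of n] pos D(1) by (intro divide_left_mono) (auto simp: rGamma_inverse_Gamma)
    hence "(real n + 1) powr (- q) \<le> D * (Gamma (g + real n) * rGamma (q + g + real n))"
      using D(1) pos by (simp add: rGamma_inverse_Gamma powr_minus field_simps)
    hence "C * (real n + 1) powr (- q) \<le> C * (D * (Gamma (g + real n) * rGamma (q + g + real n)))"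
      using C(1) by (intro mult_left_mono) auto
    with C(2)[of n] show ?thesis using pos by (simp add: Beta_eq_ratio mult_ac)
  qed
  moreover have "C * D / Gamma q > 0" using C D assms by (simp add: Gamma_real_pos)
  ultimately show ?thesis using that by blast
qed

lemma hyp2F1_pfaff_unit:
  assumes c: "Re c > 0" and t: "0 < t" "t < 1"
  shows "hyp2F1 a b c (of_real (1 - 1 / t)) = of_real t powr a * hyp_series a (c - b) c (of_real (1 - t))"
proof -
  have x: "1 - 1 / t < 0" using t by (simp add: field_simps)
  have w: "(1 - 1 / t) / (1 - 1 / t - 1) = 1 - t" using t by (simp add: field_simps)
  have "complex_of_real (1 - (1 - 1 / t)) powr (- a) = of_real t powr a"
  proof -
    have "complex_of_real (1 / t) powr (- a) = of_real t powr a"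
      using t by (simp add: powr_def Ln_of_real ln_div flip: of_real_divide)
    thus ?thesis by simp
  qed
  thus ?thesis using hyp2F1_pfaff[OF c x, of a b] by (simp only: w)
qed

lemma cut_plane_unit:
  assumes "0 < t" "t < 1"
  shows "complex_of_real (1 - 1 / t) \<in> cut_plane"
proof -
  have "1 - 1 / t < 0" using assms by (simp add: field_simps)
  thus ?thesis by (auto simp del: of_real_diff)
qed

lemma continuous_on_hyp2F1_unit:
  assumes "Re c > 0"
  shows "continuous_on {0<..<1} (\<lambda>t. hyp2F1 a b c (of_real (1 - 1 / t)))"
proof -
  have "continuous_on {0<..<1} (hyp2F1 a b c \<circ> (\<lambda>t. complex_of_real (1 - 1 / t)))"
  proof (rule continuous_on_compose)
    show "continuous_on {0<..<1} (\<lambda>t. complex_of_real (1 - 1 / t))" by (intro continuous_intros) auto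
    show "continuous_on ((\<lambda>t. complex_of_real (1 - 1 / t)) ` {0<..<1}) (hyp2F1 a b c)"
      by (rule continuous_on_subset[OF holomorphic_on_imp_continuous_on[OF hyp2F1_continues_series(1)[OF assms]]])
         (intro image_subsetI cut_plane_unit, auto)
  qed
  thus ?thesis by (simp add: o_def)
qed

text \<open>
  After Pfaff's transformation the integrand is a series in \<open>1 - t\<close> whose terms are Beta integrands, and their
  values are the terms of Gauss's series with parameters \<open>a\<close>, \<open>c - b\<close>; \<open>s + c\<close>. Gauss's convergence condition
  becomes \<open>Re (s + b - a) > 0\<close>.
\<close>

theorem mellin_hyp2F1:
  fixes a b c s :: complex
  assumes c: "Re c > 0" and s: "Re s > 0" and sba: "Re (s + b - a) > 0"
  defines "f \<equiv> \<lambda>t. of_real t powr (s - a - 1) * of_real (1 - t) powr (c - 1) * hyp2F1 a b c (of_real (1 - 1 / t))"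
  shows "integrable unit_lebesgue f"
    and "integral\<^sup>L unit_lebesgue f = Gamma c * Gamma s * Gamma (s + b - a) * rGamma (s + c - a) * rGamma (s + b)"
proof -
  define F where "F = (\<lambda>n t. hyp_coeff a (c - b) c n * (complex_of_real t powr (s - 1) * of_real (1 - t) powr (c + of_nat n - 1)))"
  have sumF: "(\<Sum>n. F n t) = f t" if t: "t \<in> {0<..<1}" for t
  proof -
    have "(\<lambda>n. of_real t powr (s - 1) * of_real (1 - t) powr (c - 1) * (hyp_coeff a (c - b) c n * of_real (1 - t) ^ n)) sums
       (of_real t powr (s - 1) * of_real (1 - t) powr (c - 1) * hyp_series a (c - b) c (of_real (1 - t)))"
      using t by (intro sums_mult hyp_series_sums c) (auto simp del: of_real_diff)
    moreover have "of_real t powr (s - 1) * of_real (1 - t) powr (c - 1) * (hyp_coeff a (c - b) c n * of_real (1 - t) ^ n) = F n t" for n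
    proof -
      have "complex_of_real (1 - t) powr (c + of_nat n - 1) = of_real (1 - t) powr (c - 1) * of_real (1 - t) powr of_nat n"
        by (simp add: powr_add [symmetric] algebra_simps)
      also have "complex_of_real (1 - t) powr of_nat n = of_real (1 - t) ^ n"
        using t by (simp add: powr_nat' del: of_real_diff)
      finally show ?thesis by (simp add: F_def mult_ac)
    qed
    moreover have "of_real t powr (s - 1) * of_real (1 - t) powr (c - 1) * hyp_series a (c - b) c (of_real (1 - t)) = f t"
    proof -
      have "complex_of_real t powr (s - 1) = of_real t powr (s - a - 1) * of_real t powr a"
        by (simp add: powr_add [symmetric])
      thus ?thesis using t by (simp add: f_def hyp2F1_pfaff_unit[OF c] mult_ac del: of_real_diff)
    qed
    ultimately show ?thesis by (simp add: sums_iff)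
  qed
  have meas: "F n \<in> borel_measurable unit_lebesgue" for n
    unfolding F_def by (intro continuous_imp_measurable_unit continuous_intros) auto
  have bnd: "(\<integral>\<^sup>+t. ennreal (norm (F n t)) \<partial>unit_lebesgue) \<le> ennreal (norm (hyp_coeff a (c - b) c n) * Beta (Re s) (Re c + n))" for n
  proof -
    have "(\<integral>\<^sup>+t. ennreal (norm (F n t)) \<partial>unit_lebesgue) =
        (\<integral>\<^sup>+t. ennreal (norm (hyp_coeff a (c - b) c n)) * ennreal (t powr (Re s - 1) * (1 - t) powr (Re c + n - 1)) \<partial>unit_lebesgue)"
    proof (rule nn_integral_cong)
      fix t assume "t \<in> space unit_lebesgue"
      hence t: "0 < t" "t < 1" by (auto simp: space_restrict_space)
      have "norm (F n t) = norm (hyp_coeff a (c - b) c n) * (t powr (Re s - 1) * (1 - t) powr (Re c + n - 1))"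
        using t norm_of_real_powr[of t] norm_of_real_powr[of "1 - t"] by (simp add: F_def norm_mult del: of_real_diff)
      thus "ennreal (norm (F n t)) = ennreal (norm (hyp_coeff a (c - b) c n)) * ennreal (t powr (Re s - 1) * (1 - t) powr (Re c + n - 1))"
        by (simp add: ennreal_mult[symmetric])
    qed
    also have "\<dots> = ennreal (norm (hyp_coeff a (c - b) c n)) * (\<integral>\<^sup>+t. ennreal (t powr (Re s - 1) * (1 - t) powr (Re c + n - 1)) \<partial>unit_lebesgue)"
      by (rule nn_integral_cmult) (intro measurable_restrict_space1, measurable)
    also have "\<dots> = ennreal (norm (hyp_coeff a (c - b) c n)) * ennreal (Beta (Re s) (Re c + n))"
      by (subst nn_integral_Beta) (use s c in auto)
    also have "\<dots> = ennreal (norm (hyp_coeff a (c - b) c n) * Beta (Re s) (Re c + n))"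
      by (simp add: ennreal_mult')
    finally show ?thesis by simp
  qed
  have nonneg: "0 \<le> norm (hyp_coeff a (c - b) c n) * Beta (Re s) (Re c + n)" for n
    using Beta_pos_real[of "Re s" "Re c + n"] s c by simp
  have summ: "summable (\<lambda>n. norm (hyp_coeff a (c - b) c n) * Beta (Re s) (Re c + n))"
  proof -
    obtain C where C: "C > 0" "\<And>n. norm (gauss_term a (c - b) c n) \<le> C * (real n + 1) powr (Re (a + (c - b) - c) - 1)"
      using norm_gauss_term_upper by blast
    obtain D where D: "D > 0" "\<And>n. Beta (Re s) (Re c + real n) \<le> D * (real n + 1) powr (- Re s)"
      using Beta_upper[OF s c] by blast
    have le: "norm (norm (hyp_coeff a (c - b) c n) * Beta (Re s) (Re c + n)) \<le> (norm (Gamma c) * C * D) * (real n + 1) powr (Re (a - b - s) - 1)" for n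
    proof -
      have "norm (norm (hyp_coeff a (c - b) c n) * Beta (Re s) (Re c + n)) =
          norm (Gamma c) * norm (gauss_term a (c - b) c n) * Beta (Re s) (Re c + n)"
        using nonneg[of n] by (simp add: hyp_coeff_eq_gauss_term[OF c] norm_mult)
      also have "\<dots> \<le> norm (Gamma c) * (C * (real n + 1) powr (Re (a + (c - b) - c) - 1)) * (D * (real n + 1) powr (- Re s))"
        using C D Beta_pos_real[of "Re s" "Re c + n"] s c by (intro mult_mono mult_left_mono) auto
      also have "\<dots> = (norm (Gamma c) * C * D) * ((real n + 1) powr (Re (a + (c - b) - c) - 1) * (real n + 1) powr (- Re s))"
        by (simp add: mult_ac)
      also have "(real n + 1) powr (Re (a + (c - b) - c) - 1) * (real n + 1) powr (- Re s) = (real n + 1) powr (Re (a - b - s) - 1)"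
        by (simp add: powr_add [symmetric] algebra_simps)
      finally show ?thesis .
    qed
    have "summable (\<lambda>n. (norm (Gamma c) * C * D) * (real n + 1) powr (Re (a - b - s) - 1))"
      by (intro summable_mult summable_Suc_powr) (use sba in simp)
    thus ?thesis by (rule summable_comparison_test'[of _ 0]) (rule le)
  qed
  have "integrable unit_lebesgue (\<lambda>t. \<Sum>n. F n t)"
    by (rule suminf_interchange_integrable[OF meas bnd nonneg summ])
  thus "integrable unit_lebesgue f"
    by (subst Bochner_Integration.integrable_cong[OF refl sumF[symmetric]]) (auto simp: space_restrict_space)
  have "(\<lambda>n. integral\<^sup>L unit_lebesgue (F n)) sums (\<integral>t. (\<Sum>n. F n t) \<partial>unit_lebesgue)"
    by (rule suminf_interchange_sums[OF meas bnd nonneg summ])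
  moreover have "(\<integral>t. (\<Sum>n. F n t) \<partial>unit_lebesgue) = integral\<^sup>L unit_lebesgue f"
    by (intro Bochner_Integration.integral_cong refl sumF) (auto simp: space_restrict_space)
  moreover have "integral\<^sup>L unit_lebesgue (F n) = Gamma s * Gamma c * gauss_term a (c - b) (s + c) n" for n
  proof -
    have "integral\<^sup>L unit_lebesgue (F n) = hyp_coeff a (c - b) c n * (Gamma s * Gamma (c + of_nat n) * rGamma (s + c + of_nat n))"
      using complex_Beta_integral(2)[of s "c + of_nat n"] s c by (simp add: F_def add.assoc)
    also have "Gamma (c + of_nat n) = Gamma c * pochhammer c n"
      using half_plane_notin_nonpos_Ints[OF c] by (simp add: pochhammer_Gamma Gamma_eq_zero_iff)
    finally show ?thesis using pochhammer_half_plane_nonzero[OF c, of n]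
      by (simp add: gauss_term_def hyp_coeff_def)
  qed
  ultimately have sums: "(\<lambda>n. Gamma s * Gamma c * gauss_term a (c - b) (s + c) n) sums integral\<^sup>L unit_lebesgue f" by simp
  have gs: "Re (s + c - a - (c - b)) > 0" using sba by simp
  have "(\<lambda>n. Gamma s * Gamma c * gauss_term a (c - b) (s + c) n) sums (Gamma s * Gamma c * suminf (gauss_term a (c - b) (s + c)))"
    by (intro sums_mult summable_sums summable_gauss_term gs)
  with sums have "integral\<^sup>L unit_lebesgue f = Gamma s * Gamma c * suminf (gauss_term a (c - b) (s + c))"
    by (rule sums_unique2)
  also have "\<dots> = Gamma c * Gamma s * Gamma (s + b - a) * rGamma (s + c - a) * rGamma (s + b)"
    unfolding gauss_summation[OF gs] by (simp add: algebra_simps)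
  finally show "integral\<^sup>L unit_lebesgue f = Gamma c * Gamma s * Gamma (s + b - a) * rGamma (s + c - a) * rGamma (s + b)" .
qed

section \<open>Absolute moments, uniformly in the third parameter\<close>

definition hyp_moment :: "real \<Rightarrow> real \<Rightarrow> complex \<Rightarrow> complex \<Rightarrow> complex \<Rightarrow> ennreal" where
  "hyp_moment \<sigma> h a b c =
     (\<integral>\<^sup>+t. ennreal (t powr (\<sigma> - 1) * (1 - t) powr (h - 1) * norm (hyp2F1 a b c (of_real (1 - 1 / t)))) \<partial>unit_lebesgue)"

text \<open>
  The exponent is dictated by scaling: for large \<open>m\<close> the factor \<open>(1 - t)\<^sup>m\<close> confines the integral to \<open>t\<close> of
  size \<open>1/m\<close>, where the Gauss function with third parameter \<open>\<gamma> + m\<close> is essentially a function of \<open>m t\<close>. The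
  weight exponent \<open>h\<close> is independent of \<open>\<gamma>\<close> because lowering \<open>c\<close> changes \<open>\<gamma>\<close> but not the weight.
\<close>

definition moment_bound :: "real \<Rightarrow> real \<Rightarrow> complex \<Rightarrow> complex \<Rightarrow> complex \<Rightarrow> bool" where
  "moment_bound \<sigma> h a b \<gamma> \<longleftrightarrow>
     (\<exists>C>0. \<forall>m. hyp_moment \<sigma> (h + real m) a b (\<gamma> + of_nat m) \<le> ennreal (C * (real m + 1) powr (- \<sigma>)))"

text \<open>
  The constant does not depend on the shift \<open>m\<close>: the shifted symbol is a quotient of two unshifted ones, and the
  denominator is at least its real counterpart.
\<close>

lemma norm_shifted_pochhammer_upper:
  fixes x :: complex
  assumes x: "Re x > 0"
  obtains C where "C > 0" "\<And>m n. norm (pochhammer (x + of_nat m) n) \<le> C * pochhammer (Re x + real m) n"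
proof -
  obtain A where A: "A > 0" "\<And>n. norm (pochhammer x n) \<le> A * (fact n * (real n + 1) powr (Re x - 1))"
    using norm_pochhammer_upper by blast
  obtain B where B: "B > 0" "\<And>n. fact n * (real n + 1) powr (Re x - 1) \<le> B * norm (pochhammer (complex_of_real (Re x)) n)"
    using norm_pochhammer_lower[of "complex_of_real (Re x)"] x by auto
  have le: "norm (pochhammer x n) \<le> (A * B) * pochhammer (Re x) n" for n
    using order_trans[OF A(2)[of n] mult_left_mono[OF B(2)[of n]]] A(1) x by (simp add: norm_pochhammer_of_real mult_ac)
  have "norm (pochhammer (x + of_nat m) n) \<le> (A * B) * pochhammer (Re x + real m) n" for m n
  proof -
    have px: "norm (pochhammer x m) > 0" using pochhammer_half_plane_nonzero[OF x] by simp
    have "norm (pochhammer x m) * norm (pochhammer (x + of_nat m) n) = norm (pochhammer x (m + n))"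
      by (simp add: pochhammer_product' norm_mult)
    also have "\<dots> \<le> (A * B) * (pochhammer (Re x) m * pochhammer (Re x + real m) n)"
      using le[of "m + n"] by (simp add: pochhammer_product')
    also have "\<dots> \<le> (A * B) * (norm (pochhammer x m) * pochhammer (Re x + real m) n)"
      using A(1) B(1) x norm_pochhammer_ge[OF x, of m] pochhammer_pos[of "Re x + real m" n]
      by (intro mult_left_mono mult_right_mono) auto
    finally have "norm (pochhammer x m) * norm (pochhammer (x + of_nat m) n) \<le>
        norm (pochhammer x m) * ((A * B) * pochhammer (Re x + real m) n)" by (simp add: mult_ac)
    thus ?thesis using px by (simp only: mult_le_cancel_left_pos)
  qed
  moreover have "A * B > 0" using A B by simp
  ultimately show ?thesis using that by blast
qed

lemma gauss_summation_real:
  fixes a b c :: real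
  assumes "c - a - b > 0"
  shows "(\<lambda>n. pochhammer a n * pochhammer b n / fact n * rGamma (c + real n)) sums
    (Gamma (c - a - b) * rGamma (c - a) * rGamma (c - b))"
proof -
  have re: "Re (complex_of_real c - of_real a - of_real b) > 0" using assms by simp
  have "gauss_term (of_real a) (of_real b) (of_real c) sums
      (Gamma (complex_of_real c - of_real a - of_real b) * rGamma (of_real c - of_real a) * rGamma (of_real c - of_real b))"
    using summable_sums[OF summable_gauss_term[OF re]] by (simp only: gauss_summation[OF re])
  also have "gauss_term (of_real a) (of_real b) (of_real c) =
      (\<lambda>n. complex_of_real (pochhammer a n * pochhammer b n / fact n * rGamma (c + real n)))"
    by (auto simp: fun_eq_iff gauss_term_def pochhammer_of_real rGamma_complex_of_real[symmetric])
  also have "Gamma (complex_of_real c - of_real a - of_real b) * rGamma (of_real c - of_real a) * rGamma (of_real c - of_real b)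
      = complex_of_real (Gamma (c - a - b) * rGamma (c - a) * rGamma (c - b))"
    by (simp add: rGamma_complex_of_real[symmetric] Gamma_complex_of_real[symmetric])
  finally show ?thesis by (simp only: sums_of_real_iff)
qed

lemma norm_hyp2F1_le_suminf:
  assumes c: "Re c > 0" and t: "0 < t" "t < 1"
  shows "ennreal (norm (hyp2F1 a b c (of_real (1 - 1 / t)))) \<le>
         (\<Sum>n. ennreal (t powr Re a * (norm (hyp_coeff a (c - b) c n) * (1 - t) ^ n)))"
proof -
  have n1: "norm (complex_of_real (1 - t)) < 1" using t by (simp del: of_real_diff)
  have nt: "norm (hyp_coeff a (c - b) c n * complex_of_real (1 - t) ^ n) = norm (hyp_coeff a (c - b) c n) * (1 - t) ^ n" for n
    using t by (simp add: norm_mult norm_power del: of_real_diff)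
  have summ: "summable (\<lambda>n. norm (hyp_coeff a (c - b) c n) * (1 - t) ^ n)"
    using summable_norm_hyp_series[OF c n1, of a "c - b"] by (simp only: nt)
  have "norm (hyp_series a (c - b) c (of_real (1 - t))) \<le> (\<Sum>n. norm (hyp_coeff a (c - b) c n) * (1 - t) ^ n)"
    using summable_norm[OF summable_norm_hyp_series[OF c n1, of a "c - b"]] by (simp only: nt hyp_series_def)
  hence "norm (hyp2F1 a b c (of_real (1 - 1 / t))) \<le> t powr Re a * (\<Sum>n. norm (hyp_coeff a (c - b) c n) * (1 - t) ^ n)"
    unfolding hyp2F1_pfaff_unit[OF c t] norm_mult norm_of_real_powr[OF t(1)] by (intro mult_left_mono) auto
  also have "\<dots> = (\<Sum>n. t powr Re a * (norm (hyp_coeff a (c - b) c n) * (1 - t) ^ n))"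
    using summ by (rule suminf_mult[symmetric])
  finally have "ennreal (norm (hyp2F1 a b c (of_real (1 - 1 / t)))) \<le>
      ennreal (\<Sum>n. t powr Re a * (norm (hyp_coeff a (c - b) c n) * (1 - t) ^ n))" by (rule ennreal_leI)
  also have "\<dots> = (\<Sum>n. ennreal (t powr Re a * (norm (hyp_coeff a (c - b) c n) * (1 - t) ^ n)))"
    by (rule suminf_ennreal2[symmetric]) (use t summ in \<open>auto intro!: summable_mult\<close>)
  finally show ?thesis .
qed

lemma hyp_moment_le_suminf:
  assumes c: "Re c > 0" and h: "h > 0" and \<sigma>: "\<sigma> + Re a > 0"
  shows "hyp_moment \<sigma> h a b c \<le> (\<Sum>n. ennreal (norm (hyp_coeff a (c - b) c n) * Beta (\<sigma> + Re a) (h + real n)))"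
proof -
  have "hyp_moment \<sigma> h a b c \<le> (\<integral>\<^sup>+t. (\<Sum>n. ennreal (norm (hyp_coeff a (c - b) c n)) *
      ennreal (t powr (\<sigma> + Re a - 1) * (1 - t) powr (h + real n - 1))) \<partial>unit_lebesgue)"
    unfolding hyp_moment_def
  proof (rule nn_integral_mono)
    fix t assume "t \<in> space unit_lebesgue"
    hence t: "0 < t" "t < 1" by (auto simp: space_restrict_space)
    have "ennreal (t powr (\<sigma> - 1) * (1 - t) powr (h - 1) * norm (hyp2F1 a b c (of_real (1 - 1 / t)))) =
       ennreal (t powr (\<sigma> - 1) * (1 - t) powr (h - 1)) * ennreal (norm (hyp2F1 a b c (of_real (1 - 1 / t))))"
      by (rule ennreal_mult) auto
    also have "\<dots> \<le> ennreal (t powr (\<sigma> - 1) * (1 - t) powr (h - 1)) *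
        (\<Sum>n. ennreal (t powr Re a * (norm (hyp_coeff a (c - b) c n) * (1 - t) ^ n)))"
      by (intro mult_left_mono norm_hyp2F1_le_suminf c t) auto
    also have "\<dots> = (\<Sum>n. ennreal (t powr (\<sigma> - 1) * (1 - t) powr (h - 1)) *
        ennreal (t powr Re a * (norm (hyp_coeff a (c - b) c n) * (1 - t) ^ n)))"
      by (rule ennreal_suminf_cmult[symmetric])
    also have "\<dots> = (\<Sum>n. ennreal (norm (hyp_coeff a (c - b) c n)) *
      ennreal (t powr (\<sigma> + Re a - 1) * (1 - t) powr (h + real n - 1)))"
    proof (rule suminf_cong)
      fix n
      have 1: "t powr (\<sigma> + Re a - 1) = t powr (\<sigma> - 1) * t powr Re a" by (simp add: powr_add [symmetric] algebra_simps)
      have "(1 - t) powr (h + real n - 1) = (1 - t) powr (h - 1) * (1 - t) powr real n"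
        by (simp add: powr_add [symmetric] algebra_simps)
      hence 2: "(1 - t) powr (h + real n - 1) = (1 - t) powr (h - 1) * (1 - t) ^ n"
        using t by (simp add: powr_realpow)
      show "ennreal (t powr (\<sigma> - 1) * (1 - t) powr (h - 1)) *
        ennreal (t powr Re a * (norm (hyp_coeff a (c - b) c n) * (1 - t) ^ n)) =
        ennreal (norm (hyp_coeff a (c - b) c n)) *
          ennreal (t powr (\<sigma> + Re a - 1) * (1 - t) powr (h + real n - 1))"
        unfolding 1 2 using t by (simp add: ennreal_mult[symmetric] mult_ac)
    qed
    finally show "ennreal (t powr (\<sigma> - 1) * (1 - t) powr (h - 1) * norm (hyp2F1 a b c (of_real (1 - 1 / t)))) \<le>
      (\<Sum>n. ennreal (norm (hyp_coeff a (c - b) c n)) * ennreal (t powr (\<sigma> + Re a - 1) * (1 - t) powr (h + real n - 1)))" .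
  qed
  also have "\<dots> = (\<Sum>n. \<integral>\<^sup>+t. ennreal (norm (hyp_coeff a (c - b) c n)) *
      ennreal (t powr (\<sigma> + Re a - 1) * (1 - t) powr (h + real n - 1)) \<partial>unit_lebesgue)"
    by (rule nn_integral_suminf) (intro measurable_restrict_space1, measurable)
  also have "\<dots> = (\<Sum>n. ennreal (norm (hyp_coeff a (c - b) c n) * Beta (\<sigma> + Re a) (h + real n)))"
  proof (rule suminf_cong)
    fix n
    have "(\<integral>\<^sup>+t. ennreal (norm (hyp_coeff a (c - b) c n)) *
        ennreal (t powr (\<sigma> + Re a - 1) * (1 - t) powr (h + real n - 1)) \<partial>unit_lebesgue) =
        ennreal (norm (hyp_coeff a (c - b) c n)) *
        (\<integral>\<^sup>+t. ennreal (t powr (\<sigma> + Re a - 1) * (1 - t) powr (h + real n - 1)) \<partial>unit_lebesgue)"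
      by (rule nn_integral_cmult) (intro measurable_restrict_space1, measurable)
    also have "\<dots> = ennreal (norm (hyp_coeff a (c - b) c n)) * ennreal (Beta (\<sigma> + Re a) (h + real n))"
      by (subst nn_integral_Beta) (use h \<sigma> in auto)
    also have "\<dots> = ennreal (norm (hyp_coeff a (c - b) c n) * Beta (\<sigma> + Re a) (h + real n))"
      by (simp add: ennreal_mult')
    finally show "(\<integral>\<^sup>+t. ennreal (norm (hyp_coeff a (c - b) c n)) *
        ennreal (t powr (\<sigma> + Re a - 1) * (1 - t) powr (h + real n - 1)) \<partial>unit_lebesgue) =
        ennreal (norm (hyp_coeff a (c - b) c n) * Beta (\<sigma> + Re a) (h + real n))" .
  qed
  finally show ?thesis .
qed

text \<open>
  When \<open>Re a > 0\<close> and \<open>Re (\<gamma> - b) > 0\<close>, all Pochhammer symbols of the series in \<open>1 - t\<close> are comparable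
  to those of their real parts, uniformly in \<open>m\<close>. The majorant is a Gauss series with real parameters, so its sum is
  known exactly, and its dependence on \<open>m\<close> is \<open>\<Gamma>(g + m) / \<Gamma>(\<sigma> + g + m)\<close> with \<open>g = Re \<gamma>\<close>.
\<close>

lemma moment_bound_base:
  assumes \<gamma>: "Re \<gamma> > 0" and h: "h > 0" and a: "Re a > 0" and gb: "Re (\<gamma> - b) > 0"
    and sa: "\<sigma> + Re a > 0" and sb: "\<sigma> + Re b > 0"
  shows "moment_bound \<sigma> h a b \<gamma>"
proof -
  define A g X q where "A = Re a" and "g = Re \<gamma>" and "X = Re (\<gamma> - b)" and "q = \<sigma> + Re a"
  have pos: "A > 0" "g > 0" "X > 0" "q > 0" "\<sigma> + g > 0" using assms by (auto simp: A_def g_def X_def q_def)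
  obtain C1 where C1: "C1 > 0" "\<And>m n. norm (pochhammer (a + of_nat m) n) \<le> C1 * pochhammer (Re a + real m) n"
    using norm_shifted_pochhammer_upper[OF a] by blast
  obtain C2 where C2: "C2 > 0" "\<And>m n. norm (pochhammer (\<gamma> - b + of_nat m) n) \<le> C2 * pochhammer (Re (\<gamma> - b) + real m) n"
    using norm_shifted_pochhammer_upper[OF gb] by blast
  obtain C3 where C3: "C3 > 0" "\<And>n. Beta q (h + real n) \<le> C3 * Beta q (g + real n)"
    using Beta_comparison[OF pos(4) h pos(2)] by blast
  obtain C4 where C4: "C4 > 0" "\<And>m. Gamma (g + real m) * rGamma (\<sigma> + g + real m) \<le> C4 * (real m + 1) powr (g - (\<sigma> + g))"
    using Gamma_ratio_upper[OF pos(2,5)] by blast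
  define D where "D = C1 * C2 * C3 * (Gamma q * Gamma (\<sigma> + Re b) * rGamma (\<sigma> + A + Re b)) * C4"
  have G: "Gamma q > 0" "Gamma (\<sigma> + Re b) > 0" "rGamma (\<sigma> + A + Re b) > 0"
    using pos sb by (auto intro!: Gamma_real_pos simp: rGamma_inverse_Gamma)
  have D: "D > 0" using C1 C2 C3 C4 G by (simp add: D_def)
  have main: "hyp_moment \<sigma> (h + real m) a b (\<gamma> + of_nat m) \<le> ennreal (D * (real m + 1) powr (- \<sigma>))" for m
  proof -
    have c: "Re (\<gamma> + of_nat m) > 0" using \<gamma> by simp
    define r where "r = (\<lambda>n. pochhammer A n * pochhammer (X + real m) n / fact n * rGamma (q + g + real m + real n))"
    have r_sums: "r sums (Gamma (\<sigma> + Re b) * rGamma (\<sigma> + g + real m) * rGamma (\<sigma> + A + Re b))"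
    proof -
      have "(q + g + real m) - A - (X + real m) > 0" using sb by (simp add: q_def A_def X_def g_def)
      from gauss_summation_real[OF this]
      have "r sums (Gamma (q + g + real m - A - (X + real m)) * rGamma (q + g + real m - A) * rGamma (q + g + real m - (X + real m)))"
        by (simp add: r_def)
      moreover have "q + g + real m - A - (X + real m) = \<sigma> + Re b" "q + g + real m - A = \<sigma> + g + real m"
         "q + g + real m - (X + real m) = \<sigma> + A + Re b"
        by (auto simp: q_def g_def X_def A_def)
      ultimately show ?thesis by (simp only:)
    qed
    have r_nonneg: "r n \<ge> 0" for n
      using pos pochhammer_pos[of A n] pochhammer_pos[of "X + real m" n] Gamma_real_pos[of "q + g + real m + real n"]
      by (auto simp: r_def rGamma_inverse_Gamma)
    \<comment> \<open>The weight exponent h is traded for g = Re gamma, for which the Gauss series closes up.\<close>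
    have term_le: "norm (hyp_coeff a (\<gamma> + of_nat m - b) (\<gamma> + of_nat m) n) * Beta q (h + real m + real n)
        \<le> (C1 * C2 * C3 * (Gamma q * Gamma (g + real m))) * r n" for n
    proof -
      have pp: "pochhammer A n > 0" "pochhammer (X + real m) n > 0" "pochhammer (g + real m) n > 0"
        using pos by (auto intro!: pochhammer_pos)
      have eq: "\<gamma> + of_nat m - b = \<gamma> - b + of_nat m" by simp
      have 1: "norm (pochhammer a n) \<le> C1 * pochhammer A n" using C1(2)[of 0 n] by (simp add: A_def)
      have 2: "norm (pochhammer (\<gamma> + of_nat m - b) n) \<le> C2 * pochhammer (X + real m) n"
        unfolding eq using C2(2)[of m n] by (simp add: X_def)
      have 3: "pochhammer (g + real m) n \<le> norm (pochhammer (\<gamma> + of_nat m) n)"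
        using norm_pochhammer_ge[OF c, of n] by (simp add: g_def)
      have "norm (hyp_coeff a (\<gamma> + of_nat m - b) (\<gamma> + of_nat m) n) =
         norm (pochhammer a n) * norm (pochhammer (\<gamma> + of_nat m - b) n) / (norm (pochhammer (\<gamma> + of_nat m) n) * fact n)"
        by (simp add: hyp_coeff_def norm_mult norm_divide)
      also have "\<dots> \<le> (C1 * pochhammer A n) * (C2 * pochhammer (X + real m) n) / (pochhammer (g + real m) n * fact n)"
        using pp C1(1) C2(1) by (intro frac_le mult_mono mult_right_mono 1 2 3) auto
      finally have 4: "norm (hyp_coeff a (\<gamma> + of_nat m - b) (\<gamma> + of_nat m) n) \<le>
          (C1 * pochhammer A n) * (C2 * pochhammer (X + real m) n) / (pochhammer (g + real m) n * fact n)" .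
      have 5: "Beta q (h + real m + real n) \<le> C3 * Beta q (g + real m + real n)"
        using C3(2)[of "m + n"] by (simp add: add.assoc)
      have 6: "Beta q (g + real m + real n) = Gamma q * (Gamma (g + real m) * pochhammer (g + real m) n * rGamma (q + g + real m + real n))"
      proof -
        have "g + real m > 0" using pos by simp
        from Gamma_shift_real[OF this, of n] show ?thesis
          using Beta_eq_ratio[of q "g + real m" n] by (simp add: add.assoc)
      qed
      have "norm (hyp_coeff a (\<gamma> + of_nat m - b) (\<gamma> + of_nat m) n) * Beta q (h + real m + real n) \<le>
         ((C1 * pochhammer A n) * (C2 * pochhammer (X + real m) n) / (pochhammer (g + real m) n * fact n)) *
         (C3 * Beta q (g + real m + real n))"
        using pp C1(1) C2(1) pos h Beta_pos_real[of q "h + real m + real n"]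
        by (intro mult_mono 4 5) auto
      also have "\<dots> = (C1 * C2 * C3 * (Gamma q * Gamma (g + real m))) * r n"
        unfolding 6 r_def using pp by (simp add: field_simps)
      finally show ?thesis .
    qed
    have Gg: "Gamma (g + real m) > 0" using pos by (intro Gamma_real_pos) auto
    have "hyp_moment \<sigma> (h + real m) a b (\<gamma> + of_nat m) \<le>
        (\<Sum>n. ennreal (norm (hyp_coeff a (\<gamma> + of_nat m - b) (\<gamma> + of_nat m) n) * Beta q (h + real m + real n)))"
      unfolding q_def by (rule hyp_moment_le_suminf[OF c]) (use h sa in auto)
    also have "\<dots> \<le> (\<Sum>n. ennreal ((C1 * C2 * C3 * (Gamma q * Gamma (g + real m))) * r n))"
      by (intro suminf_le ennreal_leI term_le) auto
    also have "\<dots> = ennreal (\<Sum>n. (C1 * C2 * C3 * (Gamma q * Gamma (g + real m))) * r n)"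
      using C1 C2 C3 G Gg r_nonneg sums_summable[OF r_sums]
      by (intro suminf_ennreal2 summable_mult mult_nonneg_nonneg) (auto intro: less_imp_le)
    also have "(\<Sum>n. (C1 * C2 * C3 * (Gamma q * Gamma (g + real m))) * r n) =
        (C1 * C2 * C3 * (Gamma q * Gamma (g + real m))) * (Gamma (\<sigma> + Re b) * rGamma (\<sigma> + g + real m) * rGamma (\<sigma> + A + Re b))"
      using sums_mult[OF r_sums] by (simp only: sums_iff)
    also have "\<dots> = C1 * C2 * C3 * (Gamma q * Gamma (\<sigma> + Re b) * rGamma (\<sigma> + A + Re b)) * (Gamma (g + real m) * rGamma (\<sigma> + g + real m))"
      by (simp only: mult_ac)
    also have "ennreal \<dots> \<le> ennreal (C1 * C2 * C3 * (Gamma q * Gamma (\<sigma> + Re b) * rGamma (\<sigma> + A + Re b)) * (C4 * (real m + 1) powr (g - (\<sigma> + g))))"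
      using C1 C2 C3 G by (intro ennreal_leI mult_left_mono C4) auto
    also have "\<dots> = ennreal (D * (real m + 1) powr (- \<sigma>))"
      by (simp add: D_def mult.assoc)
    finally show ?thesis .
  qed
  show ?thesis unfolding moment_bound_def using D main by blast
qed

lemma measurable_hyp_moment:
  assumes "Re c > 0"
  shows "(\<lambda>t. ennreal (t powr p * (1 - t) powr q * norm (hyp2F1 a b c (of_real (1 - 1 / t))))) \<in> borel_measurable unit_lebesgue"
proof -
  have "(\<lambda>t. hyp2F1 a b c (of_real (1 - 1 / t))) \<in> borel_measurable unit_lebesgue"
    by (intro continuous_imp_measurable_unit continuous_on_hyp2F1_unit assms)
  moreover have "(\<lambda>t::real. t powr p * (1 - t) powr q) \<in> borel_measurable unit_lebesgue"
    by (intro measurable_restrict_space1) measurable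
  ultimately show ?thesis by measurable
qed

lemma ennreal_add_mult:
  fixes x y z :: real
  assumes "x \<ge> 0" "y \<ge> 0" "z \<ge> 0"
  shows "ennreal (x + y * z) = ennreal x + ennreal y * ennreal z"
  using assms by (simp add: ennreal_mult)

text \<open>
  A contiguous relation contributes the factor \<open>z = 1 - 1/t\<close> and a coefficient of size \<open>1/m\<close>. The factor
  \<open>(1 - t)/t\<close> moves the exponents to \<open>\<sigma> - 1\<close> and \<open>h + 1\<close>, and the loss of one power of \<open>m\<close> in the moment is made
  up by the coefficient.
\<close>

lemma moment_bound_step:
  assumes k: "k \<ge> 0" and g: "Re \<gamma>1 > 0" "Re \<gamma>2 > 0"
    and le: "\<And>m t. 0 < t \<Longrightarrow> t < 1 \<Longrightarrow> norm (hyp2F1 a b (\<gamma> + of_nat m) (of_real (1 - 1 / t))) \<le>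
       norm (hyp2F1 a1 b1 (\<gamma>1 + of_nat m) (of_real (1 - 1 / t))) +
       k / (real m + 1) * ((1 - t) / t) * norm (hyp2F1 a2 b2 (\<gamma>2 + of_nat m) (of_real (1 - 1 / t)))"
    and m1: "moment_bound \<sigma> h a1 b1 \<gamma>1" and m2: "moment_bound (\<sigma> - 1) (h + 1) a2 b2 \<gamma>2"
  shows "moment_bound \<sigma> h a b \<gamma>"
proof -
  obtain C1 where C1: "C1 > 0" "\<And>m. hyp_moment \<sigma> (h + real m) a1 b1 (\<gamma>1 + of_nat m) \<le> ennreal (C1 * (real m + 1) powr (- \<sigma>))"
    using m1 unfolding moment_bound_def by blast
  obtain C2 where C2: "C2 > 0" "\<And>m. hyp_moment (\<sigma> - 1) (h + 1 + real m) a2 b2 (\<gamma>2 + of_nat m) \<le> ennreal (C2 * (real m + 1) powr (- (\<sigma> - 1)))"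
    using m2 unfolding moment_bound_def by blast
  have "hyp_moment \<sigma> (h + real m) a b (\<gamma> + of_nat m) \<le> ennreal ((C1 + k * C2) * (real m + 1) powr (- \<sigma>))" for m
  proof -
    have re: "Re (\<gamma>1 + of_nat m) > 0" "Re (\<gamma>2 + of_nat m) > 0" using g by auto
    define F1 where "F1 = (\<lambda>t. ennreal (t powr (\<sigma> - 1) * (1 - t) powr (h + real m - 1) * norm (hyp2F1 a1 b1 (\<gamma>1 + of_nat m) (of_real (1 - 1 / t)))))"
    define F2 where "F2 = (\<lambda>t. ennreal (t powr (\<sigma> - 1 - 1) * (1 - t) powr (h + 1 + real m - 1) * norm (hyp2F1 a2 b2 (\<gamma>2 + of_nat m) (of_real (1 - 1 / t)))))"
    have meas: "F1 \<in> borel_measurable unit_lebesgue" "F2 \<in> borel_measurable unit_lebesgue"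
      unfolding F1_def F2_def by (intro measurable_hyp_moment re)+
    have "hyp_moment \<sigma> (h + real m) a b (\<gamma> + of_nat m) \<le> (\<integral>\<^sup>+t. F1 t + ennreal (k / (real m + 1)) * F2 t \<partial>unit_lebesgue)"
      unfolding hyp_moment_def
    proof (rule nn_integral_mono)
      fix t assume "t \<in> space unit_lebesgue"
      hence t: "0 < t" "t < 1" by (auto simp: space_restrict_space)
      define w where "w = t powr (\<sigma> - 1) * (1 - t) powr (h + real m - 1)"
      have w: "w \<ge> 0" by (simp add: w_def)
      have w2: "t powr (\<sigma> - 1 - 1) * (1 - t) powr (h + 1 + real m - 1) = w * ((1 - t) / t)"
      proof -
        have "t powr (\<sigma> - 1 - 1) = t powr (\<sigma> - 1) / t" using t powr_diff[of t "\<sigma> - 1" 1] by simp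
        moreover have "(1 - t) powr (h + 1 + real m - 1) = (1 - t) powr (h + real m - 1) * (1 - t)"
        proof -
          have "(1 - t) powr (h + 1 + real m - 1) = (1 - t) powr ((h + real m - 1) + 1)" by (simp add: algebra_simps)
          also have "\<dots> = (1 - t) powr (h + real m - 1) * (1 - t)" using t by (simp only: powr_add) simp
          finally show ?thesis .
        qed
        ultimately show ?thesis by (simp add: w_def)
      qed
      have "w * norm (hyp2F1 a b (\<gamma> + of_nat m) (of_real (1 - 1 / t))) \<le>
         w * (norm (hyp2F1 a1 b1 (\<gamma>1 + of_nat m) (of_real (1 - 1 / t))) +
       k / (real m + 1) * ((1 - t) / t) * norm (hyp2F1 a2 b2 (\<gamma>2 + of_nat m) (of_real (1 - 1 / t))))"
        using le[OF t, of m] w by (intro mult_left_mono) 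
      also have "\<dots> = w * norm (hyp2F1 a1 b1 (\<gamma>1 + of_nat m) (of_real (1 - 1 / t))) +
         k / (real m + 1) * (w * ((1 - t) / t) * norm (hyp2F1 a2 b2 (\<gamma>2 + of_nat m) (of_real (1 - 1 / t))))"
        by (simp add: distrib_left mult_ac)
      finally have "ennreal (w * norm (hyp2F1 a b (\<gamma> + of_nat m) (of_real (1 - 1 / t)))) \<le>
          ennreal (w * norm (hyp2F1 a1 b1 (\<gamma>1 + of_nat m) (of_real (1 - 1 / t))) +
         k / (real m + 1) * (w * ((1 - t) / t) * norm (hyp2F1 a2 b2 (\<gamma>2 + of_nat m) (of_real (1 - 1 / t)))))"
        by (rule ennreal_leI)
      also have "\<dots> = F1 t + ennreal (k / (real m + 1)) * F2 t"
      proof -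
        show ?thesis
          unfolding F1_def F2_def w2 w_def[symmetric] by (rule ennreal_add_mult) (use w k t in auto)
      qed
      finally show "ennreal (t powr (\<sigma> - 1) * (1 - t) powr (h + real m - 1) * norm (hyp2F1 a b (\<gamma> + of_nat m) (of_real (1 - 1 / t))))
          \<le> F1 t + ennreal (k / (real m + 1)) * F2 t" by (simp add: w_def)
    qed
    also have "\<dots> = hyp_moment \<sigma> (h + real m) a1 b1 (\<gamma>1 + of_nat m) +
        ennreal (k / (real m + 1)) * hyp_moment (\<sigma> - 1) (h + 1 + real m) a2 b2 (\<gamma>2 + of_nat m)"
      using meas by (simp add: nn_integral_add nn_integral_cmult hyp_moment_def F1_def F2_def)
    also have "\<dots> \<le> ennreal (C1 * (real m + 1) powr (- \<sigma>)) + ennreal (k / (real m + 1)) * ennreal (C2 * (real m + 1) powr (- (\<sigma> - 1)))"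
      by (intro add_mono mult_left_mono C1 C2) auto
    also have "\<dots> = ennreal (C1 * (real m + 1) powr (- \<sigma>) + k / (real m + 1) * (C2 * (real m + 1) powr (- (\<sigma> - 1))))"
      by (rule ennreal_add_mult[symmetric]) (use k C1(1) C2(1) in auto)
    also have "(real m + 1) powr (- (\<sigma> - 1)) = (real m + 1) * (real m + 1) powr (- \<sigma>)"
      by (simp add: powr_mult_base)
    also have "C1 * (real m + 1) powr (- \<sigma>) + k / (real m + 1) * (C2 * ((real m + 1) * (real m + 1) powr (- \<sigma>))) =
        (C1 + k * C2) * (real m + 1) powr (- \<sigma>)"
      by (simp add: field_simps)
    finally show ?thesis .
  qed
  moreover have "C1 + k * C2 > 0" using C1 C2 k by (simp add: add_pos_nonneg)
  ultimately show ?thesis unfolding moment_bound_def by blast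
qed

lemma inverse_norm_shift_le:
  assumes "Re \<gamma> > 0"
  shows "1 / norm (\<gamma> + of_nat m) \<le> (1 + 1 / Re \<gamma>) / (real m + 1)"
proof -
  have pos: "norm (\<gamma> + of_nat m) > 0" using assms by (auto simp: complex_eq_iff)
  have "real m + 1 \<le> (1 + 1 / Re \<gamma>) * (Re \<gamma> + real m)" using assms by (simp add: field_simps)
  also have "\<dots> \<le> (1 + 1 / Re \<gamma>) * norm (\<gamma> + of_nat m)"
    using assms complex_Re_le_cmod[of "\<gamma> + of_nat m"] by (intro mult_left_mono) auto
  finally show ?thesis using pos by (simp add: field_simps)
qed

lemma norm_one_minus_inverse:
  fixes t :: real
  assumes "0 < t" "t < 1"
  shows "norm (complex_of_real (1 - 1 / t)) = (1 - t) / t"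
  unfolding norm_of_real using assms by (simp add: field_simps)

lemma moment_bound_lower_c:
  assumes \<gamma>: "Re \<gamma> > 0" and "moment_bound \<sigma> h a b (\<gamma> + 1)" "moment_bound (\<sigma> - 1) (h + 1) (a + 1) (b + 1) (\<gamma> + 2)"
  shows "moment_bound \<sigma> h a b \<gamma>"
proof (rule moment_bound_step[where k = "norm (a * b) * (1 + 1 / Re \<gamma>)", OF _ _ _ _ assms(2,3)])
  fix m and t :: real assume t: "0 < t" "t < 1"
  define z where "z = complex_of_real (1 - 1 / t)"
  define c where "c = \<gamma> + of_nat m"
  have c: "Re c > 0" using \<gamma> by (simp add: c_def)
  have z: "z \<in> cut_plane" "norm z = (1 - t) / t"
    unfolding z_def using cut_plane_unit[OF t] norm_one_minus_inverse[OF t] by auto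
  have "1 \<le> norm (c + 1)" using complex_Re_le_cmod[of "c + 1"] c by simp
  hence "norm (a * b) / (norm c * norm (c + 1)) \<le> norm (a * b) / (norm c * 1)"
    using c by (intro divide_left_mono mult_left_mono mult_pos_pos) (auto simp: complex_eq_iff)
  also have "\<dots> \<le> norm (a * b) * (1 + 1 / Re \<gamma>) / (real m + 1)"
    using mult_left_mono[OF inverse_norm_shift_le[OF \<gamma>, of m], of "norm (a * b)"] by (simp add: c_def)
  finally have k: "norm (a * b / (c * (c + 1))) \<le> norm (a * b) * (1 + 1 / Re \<gamma>) / (real m + 1)"
    by (simp add: norm_divide norm_mult)
  have "norm (hyp2F1 a b c z) \<le> norm (hyp2F1 a b (c + 1) z) + norm ((a * b / (c * (c + 1))) * z * hyp2F1 (a + 1) (b + 1) (c + 2) z)"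
    unfolding hyp2F1_raise_c[OF c z(1), of a b] by (rule norm_triangle_ineq)
  also have "norm ((a * b / (c * (c + 1))) * z * hyp2F1 (a + 1) (b + 1) (c + 2) z) =
      norm (a * b / (c * (c + 1))) * ((1 - t) / t) * norm (hyp2F1 (a + 1) (b + 1) (c + 2) z)"
    by (simp only: norm_mult z(2))
  also have "\<dots> \<le> norm (a * b) * (1 + 1 / Re \<gamma>) / (real m + 1) * ((1 - t) / t) * norm (hyp2F1 (a + 1) (b + 1) (c + 2) z)"
    using t by (intro mult_right_mono k) auto
  finally show "norm (hyp2F1 a b (\<gamma> + of_nat m) (of_real (1 - 1 / t))) \<le>
       norm (hyp2F1 a b (\<gamma> + 1 + of_nat m) (of_real (1 - 1 / t))) +
       norm (a * b) * (1 + 1 / Re \<gamma>) / (real m + 1) * ((1 - t) / t) *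
       norm (hyp2F1 (a + 1) (b + 1) (\<gamma> + 2 + of_nat m) (of_real (1 - 1 / t)))"
    unfolding c_def z_def by (simp only: add_ac)
qed (use \<gamma> in auto)

lemma moment_bound_lower_a:
  assumes \<gamma>: "Re \<gamma> > 0" and "moment_bound \<sigma> h (a + 1) b \<gamma>" "moment_bound (\<sigma> - 1) (h + 1) (a + 1) (b + 1) (\<gamma> + 1)"
  shows "moment_bound \<sigma> h a b \<gamma>"
proof (rule moment_bound_step[where k = "norm b * (1 + 1 / Re \<gamma>)", OF _ _ _ _ assms(2,3)])
  fix m and t :: real assume t: "0 < t" "t < 1"
  define z where "z = complex_of_real (1 - 1 / t)"
  define c where "c = \<gamma> + of_nat m"
  have c: "Re c > 0" using \<gamma> by (simp add: c_def)
  have z: "z \<in> cut_plane" "norm z = (1 - t) / t"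
    unfolding z_def using cut_plane_unit[OF t] norm_one_minus_inverse[OF t] by auto
  have k: "norm (- b / c) \<le> norm b * (1 + 1 / Re \<gamma>) / (real m + 1)"
    using mult_left_mono[OF inverse_norm_shift_le[OF \<gamma>, of m], of "norm b"] by (simp add: c_def norm_divide)
  have "norm (hyp2F1 a b c z) \<le> norm (hyp2F1 (a + 1) b c z) + norm ((- b / c) * z * hyp2F1 (a + 1) (b + 1) (c + 1) z)"
    unfolding hyp2F1_raise_a[OF c z(1), of a b] by (rule norm_triangle_ineq)
  also have "norm ((- b / c) * z * hyp2F1 (a + 1) (b + 1) (c + 1) z) =
      norm (- b / c) * ((1 - t) / t) * norm (hyp2F1 (a + 1) (b + 1) (c + 1) z)"
    by (simp only: norm_mult z(2))
  also have "\<dots> \<le> norm b * (1 + 1 / Re \<gamma>) / (real m + 1) * ((1 - t) / t) * norm (hyp2F1 (a + 1) (b + 1) (c + 1) z)"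
    using t by (intro mult_right_mono k) auto
  finally show "norm (hyp2F1 a b (\<gamma> + of_nat m) (of_real (1 - 1 / t))) \<le>
       norm (hyp2F1 (a + 1) b (\<gamma> + of_nat m) (of_real (1 - 1 / t))) +
       norm b * (1 + 1 / Re \<gamma>) / (real m + 1) * ((1 - t) / t) *
       norm (hyp2F1 (a + 1) (b + 1) (\<gamma> + 1 + of_nat m) (of_real (1 - 1 / t)))"
    unfolding c_def z_def by (simp only: add_ac)
qed (use \<gamma> in auto)

text \<open>
  Lowering \<open>c\<close> removes the restriction on \<open>Re (\<gamma> - b)\<close> while \<open>Re a > 0\<close>; lowering \<open>a\<close> then removes
  the restriction on \<open>Re a\<close>. All steps preserve \<open>\<sigma> + Re a > 0\<close> and \<open>\<sigma> + Re b > 0\<close>, since \<open>\<sigma>\<close> drops by one only where \<open>a\<close> and \<open>b\<close> both rise by one.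
\<close>

theorem hyp2F1_moment_bound:
  assumes "Re \<gamma> > 0" "h > 0" "\<sigma> + Re a > 0" "\<sigma> + Re b > 0"
  shows "moment_bound \<sigma> h a b \<gamma>"
proof -
  have 1: "moment_bound \<sigma> h a b \<gamma>"
    if "Re \<gamma> > 0" "h > 0" "\<sigma> + Re a > 0" "\<sigma> + Re b > 0" "Re a > 0" "Re (\<gamma> - b) > - real k" for k \<sigma> h a b \<gamma>
    using that
  proof (induction k arbitrary: \<sigma> h a b \<gamma>)
    case 0
    thus ?case by (intro moment_bound_base) auto
  next
    case (Suc k)
    show ?case
    proof (rule moment_bound_lower_c[OF Suc.prems(1)])
      show "moment_bound \<sigma> h a b (\<gamma> + 1)" using Suc.prems by (intro Suc.IH) auto
      show "moment_bound (\<sigma> - 1) (h + 1) (a + 1) (b + 1) (\<gamma> + 2)" using Suc.prems by (intro Suc.IH) auto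
    qed
  qed
  have 2: "moment_bound \<sigma> h a b \<gamma>"
    if "Re \<gamma> > 0" "h > 0" "\<sigma> + Re a > 0" "\<sigma> + Re b > 0" "Re a > 0" for \<sigma> h a b \<gamma>
  proof -
    obtain k where "- Re (\<gamma> - b) < real k" using reals_Archimedean2 by blast
    thus ?thesis by (intro 1[OF that, of k]) auto
  qed
  have 3: "moment_bound \<sigma> h a b \<gamma>"
    if "Re \<gamma> > 0" "h > 0" "\<sigma> + Re a > 0" "\<sigma> + Re b > 0" "Re a > - real k" for k \<sigma> h a b \<gamma>
    using that
  proof (induction k arbitrary: \<sigma> h a b \<gamma>)
    case 0
    thus ?case by (intro 2) auto
  next
    case (Suc k)
    show ?case
    proof (rule moment_bound_lower_a[OF Suc.prems(1)])
      show "moment_bound \<sigma> h (a + 1) b \<gamma>" using Suc.prems by (intro Suc.IH) auto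
      show "moment_bound (\<sigma> - 1) (h + 1) (a + 1) (b + 1) (\<gamma> + 1)" using Suc.prems by (intro Suc.IH) auto
    qed
  qed
  obtain k where "- Re a < real k" using reals_Archimedean2 by blast
  thus ?thesis by (intro 3[OF assms, of k]) auto
qed

section \<open>The transform of a power and of the Bessel series\<close>

text \<open>
  Integrate the series over \<open>m\<close> term by term with \<open>mellin_hyp2F1\<close> and sum by Gauss's theorem with parameters
  \<open>\<alpha>\<close>, \<open>\<beta>\<close>; \<open>s + \<gamma> - \<alpha>'\<close>. The moment bound with \<open>\<sigma> = Re (s - \<alpha>')\<close> justifies the interchange; it also shows
  that the series for \<open>F\<^sub>3\<close> converges almost everywhere, which is why \<open>f\<close> is identified with the sum only
  almost everywhere.
\<close>

theorem mellin_appell_F3: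
  fixes \<alpha> \<alpha>' \<beta> \<beta>' \<gamma> s :: complex
  assumes \<gamma>: "Re \<gamma> > 0" and s: "Re s > 0" and s1: "Re (s + \<beta>' - \<alpha>') > 0"
    and s2: "Re (s + \<gamma> - \<alpha> - \<alpha>' - \<beta>) > 0"
  defines "f \<equiv> \<lambda>t. of_real t powr (s - \<alpha>' - 1) * of_real (1 - t) powr (\<gamma> - 1)
                  * appell_F3 \<alpha> \<alpha>' \<beta> \<beta>' \<gamma> (of_real (1 - t)) (of_real (1 - 1 / t))"
  shows "integrable unit_lebesgue f"
    and "integral\<^sup>L unit_lebesgue f =
       Gamma \<gamma> * (Gamma s * Gamma (s + \<gamma> - \<alpha> - \<alpha>' - \<beta>) * Gamma (s + \<beta>' - \<alpha>')
        * (rGamma (s + \<beta>') * rGamma (s + \<gamma> - \<alpha> - \<alpha>') * rGamma (s + \<gamma> - \<alpha>' - \<beta>)))"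
proof -
  define F where "F = (\<lambda>m t. hyp_coeff \<alpha> \<beta> \<gamma> m * (complex_of_real t powr (s - \<alpha>' - 1) *
     of_real (1 - t) powr (\<gamma> + of_nat m - 1) * hyp2F1 \<alpha>' \<beta>' (\<gamma> + of_nat m) (of_real (1 - 1 / t))))"
  have \<gamma>m: "Re (\<gamma> + of_nat m) > 0" for m using \<gamma> by simp
  have sumF: "(\<Sum>m. F m t) = f t" if t: "t \<in> {0<..<1}" and summ: "summable (\<lambda>m. norm (F m t))" for t
  proof -
    define w where "w = complex_of_real t powr (s - \<alpha>' - 1) * of_real (1 - t) powr (\<gamma> - 1)"
    have w: "w \<noteq> 0" using t by (simp add: w_def del: of_real_diff)
    have F_eq: "F m t = w * (pochhammer \<alpha> m * pochhammer \<beta> m / (pochhammer \<gamma> m * fact m) * of_real (1 - t) ^ m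
        * hyp2F1 \<alpha>' \<beta>' (\<gamma> + of_nat m) (of_real (1 - 1 / t)))" for m
    proof -
      have "complex_of_real (1 - t) powr (\<gamma> + of_nat m - 1) = of_real (1 - t) powr (\<gamma> - 1) * of_real (1 - t) powr of_nat m"
        by (simp add: powr_add [symmetric] algebra_simps)
      also have "complex_of_real (1 - t) powr of_nat m = of_real (1 - t) ^ m"
        using t by (simp add: powr_nat' del: of_real_diff)
      finally show ?thesis by (simp add: F_def w_def hyp_coeff_def mult_ac)
    qed
    have "summable (\<lambda>m. F m t)" using summ by (rule summable_norm_cancel)
    hence "summable (\<lambda>m. pochhammer \<alpha> m * pochhammer \<beta> m / (pochhammer \<gamma> m * fact m) * of_real (1 - t) ^ m
        * hyp2F1 \<alpha>' \<beta>' (\<gamma> + of_nat m) (of_real (1 - 1 / t)))"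
      unfolding F_eq using w by (subst (asm) summable_cmult_iff) simp
    from suminf_mult[OF this, of w] show ?thesis
      unfolding F_eq by (simp only: f_def w_def appell_F3_def)
  qed
  have meas: "F m \<in> borel_measurable unit_lebesgue" for m
    unfolding F_def
    by (intro continuous_imp_measurable_unit continuous_on_mult continuous_on_const
          continuous_on_hyp2F1_unit \<gamma>m continuous_on_powr_complex continuous_on_of_real
          continuous_on_id continuous_on_diff) auto
  define \<sigma> where "\<sigma> = Re (s - \<alpha>')"
  have "moment_bound \<sigma> (Re \<gamma>) \<alpha>' \<beta>' \<gamma>"
    by (rule hyp2F1_moment_bound) (use \<gamma> s s1 in \<open>auto simp: \<sigma>_def\<close>)
  then obtain C where C: "C > 0"
    "\<And>m. hyp_moment \<sigma> (Re \<gamma> + real m) \<alpha>' \<beta>' (\<gamma> + of_nat m) \<le> ennreal (C * (real m + 1) powr (- \<sigma>))"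
    unfolding moment_bound_def by blast
  have bnd: "(\<integral>\<^sup>+t. ennreal (norm (F m t)) \<partial>unit_lebesgue) \<le>
      ennreal (norm (hyp_coeff \<alpha> \<beta> \<gamma> m) * (C * (real m + 1) powr (- \<sigma>)))" for m
  proof -
    have "(\<integral>\<^sup>+t. ennreal (norm (F m t)) \<partial>unit_lebesgue) =
       (\<integral>\<^sup>+t. ennreal (norm (hyp_coeff \<alpha> \<beta> \<gamma> m)) * ennreal (t powr (\<sigma> - 1) * (1 - t) powr (Re \<gamma> + real m - 1) *
          norm (hyp2F1 \<alpha>' \<beta>' (\<gamma> + of_nat m) (of_real (1 - 1 / t)))) \<partial>unit_lebesgue)"
    proof (rule nn_integral_cong)
      fix t assume "t \<in> space unit_lebesgue"
      hence t: "0 < t" "t < 1" by (auto simp: space_restrict_space)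
      have "norm (F m t) = norm (hyp_coeff \<alpha> \<beta> \<gamma> m) * (t powr (\<sigma> - 1) * (1 - t) powr (Re \<gamma> + real m - 1) *
          norm (hyp2F1 \<alpha>' \<beta>' (\<gamma> + of_nat m) (of_real (1 - 1 / t))))"
        using t norm_of_real_powr[of t] norm_of_real_powr[of "1 - t"]
        by (simp add: F_def norm_mult \<sigma>_def del: of_real_diff)
      thus "ennreal (norm (F m t)) = ennreal (norm (hyp_coeff \<alpha> \<beta> \<gamma> m)) * ennreal (t powr (\<sigma> - 1) * (1 - t) powr (Re \<gamma> + real m - 1) *
          norm (hyp2F1 \<alpha>' \<beta>' (\<gamma> + of_nat m) (of_real (1 - 1 / t))))"
        by (simp add: ennreal_mult[symmetric] del: of_real_diff)
    qed
    also have "\<dots> = ennreal (norm (hyp_coeff \<alpha> \<beta> \<gamma> m)) * hyp_moment \<sigma> (Re \<gamma> + real m) \<alpha>' \<beta>' (\<gamma> + of_nat m)"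
      unfolding hyp_moment_def by (intro nn_integral_cmult measurable_hyp_moment \<gamma>m)
    also have "\<dots> \<le> ennreal (norm (hyp_coeff \<alpha> \<beta> \<gamma> m)) * ennreal (C * (real m + 1) powr (- \<sigma>))"
      by (intro mult_left_mono C) auto
    also have "\<dots> = ennreal (norm (hyp_coeff \<alpha> \<beta> \<gamma> m) * (C * (real m + 1) powr (- \<sigma>)))"
      using C(1) by (simp add: ennreal_mult)
    finally show ?thesis .
  qed
  have nonneg: "0 \<le> norm (hyp_coeff \<alpha> \<beta> \<gamma> m) * (C * (real m + 1) powr (- \<sigma>))" for m using C(1) by simp
  have summ: "summable (\<lambda>m. norm (hyp_coeff \<alpha> \<beta> \<gamma> m) * (C * (real m + 1) powr (- \<sigma>)))"
  proof -
    obtain D where D: "D > 0" "\<And>n. norm (gauss_term \<alpha> \<beta> \<gamma> n) \<le> D * (real n + 1) powr (Re (\<alpha> + \<beta> - \<gamma>) - 1)"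
      using norm_gauss_term_upper by blast
    have le: "norm (norm (hyp_coeff \<alpha> \<beta> \<gamma> m) * (C * (real m + 1) powr (- \<sigma>))) \<le>
        (norm (Gamma \<gamma>) * D * C) * (real m + 1) powr (Re (\<alpha> + \<beta> - \<gamma>) - 1 - \<sigma>)" for m
    proof -
      have "norm (norm (hyp_coeff \<alpha> \<beta> \<gamma> m) * (C * (real m + 1) powr (- \<sigma>))) =
          norm (Gamma \<gamma>) * norm (gauss_term \<alpha> \<beta> \<gamma> m) * (C * (real m + 1) powr (- \<sigma>))"
        using C(1) by (simp add: hyp_coeff_eq_gauss_term[OF \<gamma>] norm_mult)
      also have "\<dots> \<le> norm (Gamma \<gamma>) * (D * (real m + 1) powr (Re (\<alpha> + \<beta> - \<gamma>) - 1)) * (C * (real m + 1) powr (- \<sigma>))"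
        using D C(1) by (intro mult_right_mono mult_left_mono) auto
      also have "\<dots> = (norm (Gamma \<gamma>) * D * C) * ((real m + 1) powr (Re (\<alpha> + \<beta> - \<gamma>) - 1) * (real m + 1) powr (- \<sigma>))"
        by (simp add: mult_ac)
      also have "(real m + 1) powr (Re (\<alpha> + \<beta> - \<gamma>) - 1) * (real m + 1) powr (- \<sigma>) = (real m + 1) powr (Re (\<alpha> + \<beta> - \<gamma>) - 1 - \<sigma>)"
        by (simp add: powr_add [symmetric] algebra_simps)
      finally show ?thesis .
    qed
    have "summable (\<lambda>m. (norm (Gamma \<gamma>) * D * C) * (real m + 1) powr (Re (\<alpha> + \<beta> - \<gamma>) - 1 - \<sigma>))"
      by (intro summable_mult summable_Suc_powr) (use s2 in \<open>simp add: \<sigma>_def\<close>)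
    thus ?thesis by (rule summable_comparison_test'[of _ 0]) (rule le)
  qed
  have AE_eq: "AE t in unit_lebesgue. (\<Sum>m. F m t) = f t"
    using suminf_interchange_AE[OF meas bnd nonneg summ] AE_space
    by eventually_elim (auto intro!: sumF simp: space_restrict_space)
  have meas_f: "f \<in> borel_measurable unit_lebesgue"
  proof -
    have 1: "(\<lambda>t. \<Sum>m. pochhammer \<alpha> m * pochhammer \<beta> m / (pochhammer \<gamma> m * fact m) * of_real (1 - t) ^ m
        * hyp2F1 \<alpha>' \<beta>' (\<gamma> + of_nat m) (of_real (1 - 1 / t))) \<in> borel_measurable unit_lebesgue"
      by (intro borel_measurable_suminf continuous_imp_measurable_unit continuous_on_mult continuous_on_const
          continuous_on_hyp2F1_unit \<gamma>m continuous_on_power continuous_on_of_real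
          continuous_on_id continuous_on_diff)
    have 2: "(\<lambda>t. complex_of_real t powr (s - \<alpha>' - 1) * of_real (1 - t) powr (\<gamma> - 1)) \<in> borel_measurable unit_lebesgue"
      by (intro continuous_imp_measurable_unit continuous_intros) auto
    show ?thesis unfolding f_def appell_F3_def by (rule borel_measurable_times[OF 2 1])
  qed
  have intS: "integrable unit_lebesgue (\<lambda>t. \<Sum>m. F m t)"
    by (rule suminf_interchange_integrable[OF meas bnd nonneg summ])
  show "integrable unit_lebesgue f"
    using integrable_cong_AE_imp[OF intS meas_f] AE_eq by (simp add: eq_commute)
  have "(\<lambda>m. integral\<^sup>L unit_lebesgue (F m)) sums (\<integral>t. (\<Sum>m. F m t) \<partial>unit_lebesgue)"
    by (rule suminf_interchange_sums[OF meas bnd nonneg summ])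
  also have "(\<integral>t. (\<Sum>m. F m t) \<partial>unit_lebesgue) = integral\<^sup>L unit_lebesgue f"
    by (rule integral_cong_AE[OF borel_measurable_integrable[OF intS] meas_f AE_eq])
  also have "(\<lambda>m. integral\<^sup>L unit_lebesgue (F m)) = (\<lambda>m. Gamma \<gamma> * Gamma s * Gamma (s + \<beta>' - \<alpha>') * rGamma (s + \<beta>') *
      gauss_term \<alpha> \<beta> (s + \<gamma> - \<alpha>') m)"
  proof
    fix m
    have "integral\<^sup>L unit_lebesgue (F m) = hyp_coeff \<alpha> \<beta> \<gamma> m *
       (Gamma (\<gamma> + of_nat m) * Gamma s * Gamma (s + \<beta>' - \<alpha>') * rGamma (s + (\<gamma> + of_nat m) - \<alpha>') * rGamma (s + \<beta>'))"
      using mellin_hyp2F1(2)[OF \<gamma>m s s1, of m] unfolding F_def by (simp del: of_real_diff)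
    also have "Gamma (\<gamma> + of_nat m) = Gamma \<gamma> * pochhammer \<gamma> m"
      using half_plane_notin_nonpos_Ints[OF \<gamma>] by (simp add: pochhammer_Gamma Gamma_eq_zero_iff)
    also have "s + (\<gamma> + of_nat m) - \<alpha>' = s + \<gamma> - \<alpha>' + of_nat m" by simp
    finally show "integral\<^sup>L unit_lebesgue (F m) = Gamma \<gamma> * Gamma s * Gamma (s + \<beta>' - \<alpha>') * rGamma (s + \<beta>') *
      gauss_term \<alpha> \<beta> (s + \<gamma> - \<alpha>') m"
      using pochhammer_half_plane_nonzero[OF \<gamma>, of m] by (simp add: gauss_term_def hyp_coeff_def)
  qed
  finally have sums: "(\<lambda>m. Gamma \<gamma> * Gamma s * Gamma (s + \<beta>' - \<alpha>') * rGamma (s + \<beta>') * gauss_term \<alpha> \<beta> (s + \<gamma> - \<alpha>') m)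
     sums integral\<^sup>L unit_lebesgue f" .
  have gs: "Re (s + \<gamma> - \<alpha>' - \<alpha> - \<beta>) > 0" using s2 by simp
  have "(\<lambda>m. Gamma \<gamma> * Gamma s * Gamma (s + \<beta>' - \<alpha>') * rGamma (s + \<beta>') * gauss_term \<alpha> \<beta> (s + \<gamma> - \<alpha>') m)
     sums (Gamma \<gamma> * Gamma s * Gamma (s + \<beta>' - \<alpha>') * rGamma (s + \<beta>') * suminf (gauss_term \<alpha> \<beta> (s + \<gamma> - \<alpha>')))"
    by (intro sums_mult summable_sums summable_gauss_term gs)
  with sums have "integral\<^sup>L unit_lebesgue f =
      Gamma \<gamma> * Gamma s * Gamma (s + \<beta>' - \<alpha>') * rGamma (s + \<beta>') * suminf (gauss_term \<alpha> \<beta> (s + \<gamma> - \<alpha>'))"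
    by (rule sums_unique2)
  also have "suminf (gauss_term \<alpha> \<beta> (s + \<gamma> - \<alpha>')) =
      Gamma (s + \<gamma> - \<alpha> - \<alpha>' - \<beta>) * rGamma (s + \<gamma> - \<alpha> - \<alpha>') * rGamma (s + \<gamma> - \<alpha>' - \<beta>)"
  proof -
    have "s + \<gamma> - \<alpha>' - \<alpha> - \<beta> = s + \<gamma> - \<alpha> - \<alpha>' - \<beta>" "s + \<gamma> - \<alpha>' - \<alpha> = s + \<gamma> - \<alpha> - \<alpha>'" by simp_all
    thus ?thesis unfolding gauss_summation[OF gs] by (simp only:)
  qed
  finally show "integral\<^sup>L unit_lebesgue f =
       Gamma \<gamma> * (Gamma s * Gamma (s + \<gamma> - \<alpha> - \<alpha>' - \<beta>) * Gamma (s + \<beta>' - \<alpha>')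
        * (rGamma (s + \<beta>') * rGamma (s + \<gamma> - \<alpha> - \<alpha>') * rGamma (s + \<gamma> - \<alpha>' - \<beta>)))"
    by (simp only: mult_ac)
qed

text \<open>
  The series converges for every \<open>y\<close>; since \<open>1 / \<Gamma>(\<kappa> + k)\<close> grows at most polynomially, writing \<open>y = (1/2) (2 y)\<close>
  lets \<open>(1/2)\<^sup>k\<close> absorb it, and the exponential series in \<open>2 y\<close> remains.
\<close>

lemma summable_bessel_coeff:
  fixes \<kappa> y :: complex
  shows "summable (\<lambda>k. norm (y ^ k * rGamma (\<kappa> + of_nat k) / fact k))"
proof -
  obtain C where C: "C > 0" "\<And>k. norm (rGamma (\<kappa> + of_nat k)) \<le> C * ((real k + 1) powr (1 - Re \<kappa>) / fact k)"
    using norm_rGamma_upper by blast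
  define e where "e = 1 - Re \<kappa>"
  have "(\<lambda>k. (real k + 1) powr e * (1 / 2) ^ k) \<longlonglongrightarrow> 0" by real_asymp
  hence "Bseq (\<lambda>k. (real k + 1) powr e * (1 / 2) ^ k)" using convergentI convergent_imp_Bseq by blast
  then obtain B where B: "B > 0" "\<And>k. norm ((real k + 1) powr e * (1 / 2) ^ k) \<le> B" by (auto elim!: BseqE)
  have le: "norm (norm (y ^ k * rGamma (\<kappa> + of_nat k) / fact k)) \<le> (C * B) * (inverse (fact k) * (2 * norm y) ^ k)" for k
  proof -
    have "norm (norm (y ^ k * rGamma (\<kappa> + of_nat k) / fact k)) = norm y ^ k * norm (rGamma (\<kappa> + of_nat k)) / fact k"
      by (simp add: norm_mult norm_divide norm_power)
    also have "\<dots> \<le> norm y ^ k * (C * (real k + 1) powr e) / fact k"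
    proof (intro divide_right_mono mult_left_mono)
      have "norm (rGamma (\<kappa> + of_nat k)) \<le> C * ((real k + 1) powr e / fact k)" using C(2)[of k] by (simp add: e_def)
      also have "\<dots> \<le> C * ((real k + 1) powr e / 1)"
        using C(1) by (intro mult_left_mono divide_left_mono) auto
      finally show "norm (rGamma (\<kappa> + of_nat k)) \<le> C * (real k + 1) powr e" by simp
    qed auto
    also have "\<dots> = C * ((real k + 1) powr e * (1 / 2) ^ k) * (inverse (fact k) * (2 * norm y) ^ k)"
      by (simp add: field_simps power_mult_distrib)
    also have "\<dots> \<le> C * B * (inverse (fact k) * (2 * norm y) ^ k)"
      using B(2)[of k] C(1) by (intro mult_right_mono mult_left_mono) auto
    finally show ?thesis by simp
  qed
  have "summable (\<lambda>k. (C * B) * (inverse (fact k) * (2 * norm y) ^ k))"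
    by (intro summable_mult summable_exp)
  thus ?thesis by (rule summable_comparison_test'[of _ 0]) (rule le)
qed

theorem theorem2p1:
  fixes \<alpha> \<alpha>' \<beta> \<beta>' \<gamma> \<rho> p b c :: complex and x :: real
  assumes "p + (b + 1) / 2 \<notin> \<int>\<^sub>\<le>\<^sub>0"
    and "Re \<gamma> > 0"
    and "Re (\<rho> + p) > Max {0, Re (\<alpha> + \<alpha>' + \<beta> - \<gamma>), Re (\<alpha>' - \<beta>')}"
    and "x > 0"
  shows "set_integrable lborel {0<..<x}
           (\<lambda>t. saigo_maeda_kernel \<alpha> \<alpha>' \<beta> \<beta>' \<gamma> x t
                 * (of_real t powr (\<rho> - 1) * gen_bessel p b c (of_real t)))
         \<and> saigo_maeda_I \<alpha> \<alpha>' \<beta> \<beta>' \<gamma>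
             (\<lambda>t. of_real t powr (\<rho> - 1) * gen_bessel p b c (of_real t)) x
           = of_real x powr (\<rho> + p - \<alpha> - \<alpha>' + \<gamma> - 1) / 2 powr p
             * wright_psi
                 [(\<rho> + p, 2), (\<rho> + p + \<gamma> - \<alpha> - \<alpha>' - \<beta>, 2), (\<rho> + p + \<beta>' - \<alpha>', 2)]
                 [(\<rho> + p + \<beta>', 2), (\<rho> + p + \<gamma> - \<alpha> - \<alpha>', 2), (\<rho> + p + \<gamma> - \<alpha>' - \<beta>, 2),
                  (p + (b + 1) / 2, 1)]
                 (- (c * of_real x ^ 2) / 4)"
proof -
  define s where "s = (\<lambda>k. \<rho> + p + 2 * of_nat k)"
  define \<kappa> where "\<kappa> = p + (b + 1) / 2"
  define z where "z = - (c * of_real x ^ 2) / 4"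
  define d where "d = (\<lambda>k. z ^ k * rGamma (\<kappa> + of_nat k) / fact k)"
  define f where "f = (\<lambda>s t. of_real t powr (s - \<alpha>' - 1) * of_real (1 - t) powr (\<gamma> - 1)
                  * appell_F3 \<alpha> \<alpha>' \<beta> \<beta>' \<gamma> (of_real (1 - t)) (of_real (1 - 1 / t)))"
  \<comment> \<open>The powers of x and 2 that scaling t = x t' takes out of the integrand.\<close>
  define M where "M = of_real x powr (\<gamma> - \<alpha>' + \<rho> + p - 2) / 2 powr p"
  define g where "g = (\<lambda>t. saigo_maeda_kernel \<alpha> \<alpha>' \<beta> \<beta>' \<gamma> x t
                 * (of_real t powr (\<rho> - 1) * gen_bessel p b c (of_real t)))"
  define V where "V = (\<lambda>s. Gamma s * Gamma (s + \<gamma> - \<alpha> - \<alpha>' - \<beta>) * Gamma (s + \<beta>' - \<alpha>')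
        * (rGamma (s + \<beta>') * rGamma (s + \<gamma> - \<alpha> - \<alpha>') * rGamma (s + \<gamma> - \<alpha>' - \<beta>)))"
  have \<gamma>: "Re \<gamma> > 0" and x: "x > 0" by fact+
  have re: "Re (s k) > 0" "Re (s k + \<beta>' - \<alpha>') > 0" "Re (s k + \<gamma> - \<alpha> - \<alpha>' - \<beta>) > 0" for k
    using assms(3) by (auto simp: s_def)
  have int_f: "integrable unit_lebesgue (f (s k))" "integral\<^sup>L unit_lebesgue (f (s k)) = Gamma \<gamma> * V (s k)" for k
    unfolding f_def V_def by (rule mellin_appell_F3[OF \<gamma> re[of k]])+
  have f_s: "f (s k) t = of_real t ^ (2 * k) * f (s 0) t" if "t \<in> {0<..<1}" for k t
  proof -
    have "complex_of_real t powr (s k - \<alpha>' - 1) = of_real t powr (s 0 - \<alpha>' - 1) * of_real t powr of_nat (2 * k)"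
      by (simp add: powr_add [symmetric] s_def algebra_simps)
    also have "complex_of_real t powr of_nat (2 * k) = of_real t ^ (2 * k)"
      using that by (subst powr_nat') auto
    finally show ?thesis by (simp add: f_def mult_ac)
  qed
  have sum_d: "summable (\<lambda>k. norm (d k))" unfolding d_def by (rule summable_bessel_coeff)

  define F where "F = (\<lambda>k t. d k * f (s k) t)"
  \<comment> \<open>On the unit interval the k-th integrand is at most the zeroth one times the Bessel coefficient,
    so a single integral dominates the whole series.\<close>
  define L where "L = (\<integral>t. norm (f (s 0) t) \<partial>unit_lebesgue)"
  have L: "(\<integral>\<^sup>+t. ennreal (norm (f (s 0) t)) \<partial>unit_lebesgue) = ennreal L"
    unfolding L_def by (rule nn_integral_eq_integral) (use int_f(1)[of 0] in auto)
  have L0: "L \<ge> 0" unfolding L_def by (rule Bochner_Integration.integral_nonneg) auto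
  have meas: "F k \<in> borel_measurable unit_lebesgue" for k
    unfolding F_def using borel_measurable_integrable[OF int_f(1)[of k]] by measurable
  have bnd: "(\<integral>\<^sup>+t. ennreal (norm (F k t)) \<partial>unit_lebesgue) \<le> ennreal (norm (d k) * L)" for k
  proof -
    have "(\<integral>\<^sup>+t. ennreal (norm (F k t)) \<partial>unit_lebesgue) \<le>
        (\<integral>\<^sup>+t. ennreal (norm (d k)) * ennreal (norm (f (s 0) t)) \<partial>unit_lebesgue)"
    proof (rule nn_integral_mono)
      fix t assume "t \<in> space unit_lebesgue"
      hence t: "0 < t" "t < 1" by (auto simp: space_restrict_space)
      have "norm (F k t) = norm (d k) * (t ^ (2 * k) * norm (f (s 0) t))"
        using t by (simp add: F_def f_s[where k = k and t = t] norm_mult norm_power)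
      also have "\<dots> \<le> norm (d k) * (1 * norm (f (s 0) t))"
        using t by (intro mult_left_mono mult_right_mono power_le_one) auto
      finally show "ennreal (norm (F k t)) \<le> ennreal (norm (d k)) * ennreal (norm (f (s 0) t))"
        by (simp add: ennreal_mult[symmetric] ennreal_leI)
    qed
    also have "\<dots> = ennreal (norm (d k)) * ennreal L"
      unfolding L[symmetric]
      by (intro nn_integral_cmult measurable_compose[OF borel_measurable_integrable[OF int_f(1)[of 0]]])
         measurable
    also have "\<dots> = ennreal (norm (d k) * L)" using L0 by (simp add: ennreal_mult)
    finally show ?thesis .
  qed
  have nonneg: "0 \<le> norm (d k) * L" for k using L0 by simp
  have summ: "summable (\<lambda>k. norm (d k) * L)" using sum_d by (rule summable_mult2)

  have g_eq: "g (x * t) = M * (\<Sum>k. F k t)" if t: "t \<in> {0<..<1}" for t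
  proof -
    have powr_split: "complex_of_real (u * v) powr w = of_real u powr w * of_real v powr w" if "u > 0" "v > 0" for u v w
      using that by (subst of_real_mult) (rule powr_times_real, auto)
    have sumdt: "summable (\<lambda>k. d k * of_real t ^ (2 * k))"
    proof (rule summable_comparison_test'[OF sum_d, of 0])
      fix k show "norm (d k * of_real t ^ (2 * k)) \<le> norm (d k)"
        using t by (auto simp: norm_mult norm_power intro!: mult_left_le power_le_one)
    qed
    define D where "D = (\<Sum>k. d k * of_real t ^ (2 * k))"
    have "F k t = d k * of_real t ^ (2 * k) * f (s 0) t" for k
      unfolding F_def f_s[OF t, of k] by simp
    hence FD: "(\<Sum>k. F k t) = D * f (s 0) t"
      unfolding D_def suminf_mult2[OF sumdt] by simp
    have bessel: "gen_bessel p b c (of_real (x * t)) = of_real x powr p * of_real t powr p / 2 powr p * D"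
    proof -
      have "(-1) ^ k * c ^ k * rGamma (\<kappa> + of_nat k) / fact k * (complex_of_real (x * t) / 2) powr (2 * of_nat k + p)
         = of_real x powr p * of_real t powr p / 2 powr p * (d k * of_real t ^ (2 * k))" for k
      proof -
        have "(complex_of_real (x * t) / 2) powr (2 * of_nat k + p) =
            (complex_of_real (x * t) / 2) powr of_nat (2 * k) * (complex_of_real (x * t) / 2) powr p"
          by (simp add: powr_add)
        also have "(complex_of_real (x * t) / 2) powr of_nat (2 * k) = (of_real x ^ 2 / 4) ^ k * of_real t ^ (2 * k)"
          using t x by (subst powr_nat') (auto simp: power_mult power_mult_distrib power_divide)
        also have "(complex_of_real (x * t) / 2) powr p = of_real x powr p * of_real t powr p / 2 powr p"
        proof -
          have "complex_of_real (x * t) powr p = of_real (2 * (x * t / 2)) powr p" by simp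
          also have "\<dots> = of_real 2 powr p * of_real (x * t / 2) powr p"
            using t x by (intro powr_split) auto
          finally have "of_real 2 powr p * of_real (x * t / 2) powr p = of_real x powr p * complex_of_real t powr p"
            using t x by (subst (asm) powr_split) auto
          thus ?thesis by (simp add: field_simps)
        qed
        finally have e: "(complex_of_real (x * t) / 2) powr (2 * of_nat k + p) =
           (of_real x ^ 2 / 4) ^ k * of_real t ^ (2 * k) * (of_real x powr p * of_real t powr p / 2 powr p)" .
        have z: "z ^ k = (-1) ^ k * c ^ k * (of_real x ^ 2 / 4) ^ k"
          unfolding power_mult_distrib[symmetric] z_def by simp
        show ?thesis unfolding e d_def z by (simp add: mult_ac)
      qed
      thus ?thesis unfolding gen_bessel_def \<kappa>_def[symmetric] D_def
        using suminf_mult[OF sumdt, of "of_real x powr p * of_real t powr p / 2 powr p"] by simp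
    qed
    have kernel: "saigo_maeda_kernel \<alpha> \<alpha>' \<beta> \<beta>' \<gamma> x (x * t) =
        of_real x powr (\<gamma> - 1) * of_real (1 - t) powr (\<gamma> - 1) * (of_real x powr (- \<alpha>') * of_real t powr (- \<alpha>'))
        * appell_F3 \<alpha> \<alpha>' \<beta> \<beta>' \<gamma> (of_real (1 - t)) (of_real (1 - 1 / t))"
    proof -
      have 1: "x - x * t = x * (1 - t)" by (simp add: algebra_simps)
      have 2: "x * t / x = t" "x / (x * t) = 1 / t" using x by auto
      show ?thesis unfolding saigo_maeda_kernel_def 1 2
        using t x by (simp add: powr_split del: of_real_diff of_real_mult of_real_divide)
    qed
    have powx: "of_real x powr (\<gamma> - 1) * of_real x powr (- \<alpha>') * of_real x powr (\<rho> - 1) * of_real x powr p =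
        complex_of_real x powr (\<gamma> - \<alpha>' + \<rho> + p - 2)"
      by (simp add: powr_add [symmetric] algebra_simps)
    have powt: "of_real t powr (- \<alpha>') * of_real t powr (\<rho> - 1) * of_real t powr p = complex_of_real t powr (s 0 - \<alpha>' - 1)"
      by (simp add: powr_add [symmetric] s_def algebra_simps)
    have "g (x * t) = (of_real x powr (\<gamma> - 1) * of_real x powr (- \<alpha>') * of_real x powr (\<rho> - 1) * of_real x powr p) / 2 powr p *
        (D * ((of_real t powr (- \<alpha>') * of_real t powr (\<rho> - 1) * of_real t powr p) * of_real (1 - t) powr (\<gamma> - 1) *
        appell_F3 \<alpha> \<alpha>' \<beta> \<beta>' \<gamma> (of_real (1 - t)) (of_real (1 - 1 / t))))"
    proof -
      have "complex_of_real (x * t) powr (\<rho> - 1) = of_real x powr (\<rho> - 1) * of_real t powr (\<rho> - 1)"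
        using t x by (intro powr_split) auto
      thus ?thesis unfolding g_def bessel kernel by (simp only: times_divide_eq_left times_divide_eq_right mult_ac)
    qed
    also have "\<dots> = M * (D * f (s 0) t)" unfolding powx powt M_def f_def by simp
    finally show ?thesis by (simp add: FD)
  qed

  have intF: "integrable unit_lebesgue (\<lambda>t. \<Sum>k. F k t)"
    by (rule suminf_interchange_integrable[OF meas bnd nonneg summ])
  have sumsF: "(\<lambda>k. d k * (Gamma \<gamma> * V (s k))) sums (\<integral>t. (\<Sum>k. F k t) \<partial>unit_lebesgue)"
    using suminf_interchange_sums[OF meas bnd nonneg summ] by (simp add: F_def int_f(2))

  \<comment> \<open>The shape 0 + x * t is that of the affine change of variables.\<close>
  have gx: "indicator {0<..<x} (0 + x * t) *\<^sub>R g (0 + x * t) = indicator {0<..<1} t *\<^sub>R (M * (\<Sum>k. F k t))" for t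
    using x g_eq[of t] by (auto simp: indicator_def zero_less_mult_iff)
  have "integrable lborel (\<lambda>t. indicator {0<..<1} t *\<^sub>R (M * (\<Sum>k. F k t)))"
    using integrable_mult_right[OF intF, of M] by (simp add: integrable_restrict_space)
  hence 1: "set_integrable lborel {0<..<x} g"
    unfolding set_integrable_def gx[symmetric] using x by (subst (asm) lborel_integrable_real_affine_iff) auto
  have "(LINT t:{0<..<x}|lborel. g t) = x *\<^sub>R (\<integral>t. indicator {0<..<1} t *\<^sub>R (M * (\<Sum>k. F k t)) \<partial>lborel)"
    unfolding set_lebesgue_integral_def gx[symmetric] using x
    by (subst lborel_integral_real_affine[where c = x and t = 0]) auto
  also have "(\<integral>t. indicator {0<..<1} t *\<^sub>R (M * (\<Sum>k. F k t)) \<partial>lborel) = M * (\<integral>t. (\<Sum>k. F k t) \<partial>unit_lebesgue)"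
    by (subst integral_restrict_space[symmetric]) auto
  finally have int_g: "(LINT t:{0<..<x}|lborel. g t) = of_real x * (M * (\<Sum>k. d k * (Gamma \<gamma> * V (s k))))"
    using sums_unique[OF sumsF] by (simp add: scaleR_conv_of_real)
  have G0: "Gamma \<gamma> \<noteq> 0" using half_plane_notin_nonpos_Ints[OF \<gamma>] by (simp add: Gamma_eq_zero_iff)
  have wright: "(\<Sum>k. d k * (Gamma \<gamma> * V (s k))) = Gamma \<gamma> * wright_psi
                 [(\<rho> + p, 2), (\<rho> + p + \<gamma> - \<alpha> - \<alpha>' - \<beta>, 2), (\<rho> + p + \<beta>' - \<alpha>', 2)]
                 [(\<rho> + p + \<beta>', 2), (\<rho> + p + \<gamma> - \<alpha> - \<alpha>', 2), (\<rho> + p + \<gamma> - \<alpha>' - \<beta>, 2), (\<kappa>, 1)] z"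
  proof -
    have "summable (\<lambda>k. Gamma \<gamma> * (d k * V (s k)))"
      using sums_summable[OF sumsF] by (simp add: mult_ac)
    hence summV: "summable (\<lambda>k. d k * V (s k))" using G0 by (subst (asm) summable_cmult_iff) simp
    have "(\<Sum>k. d k * (Gamma \<gamma> * V (s k))) = Gamma \<gamma> * (\<Sum>k. d k * V (s k))"
      using suminf_mult[OF summV, of "Gamma \<gamma>"] by (simp add: mult_ac)
    also have "(\<lambda>k. d k * V (s k)) = (\<lambda>k. (\<Prod>(a, \<alpha>)\<leftarrow>[(\<rho> + p, 2), (\<rho> + p + \<gamma> - \<alpha> - \<alpha>' - \<beta>, 2), (\<rho> + p + \<beta>' - \<alpha>', 2)]. Gamma (a + \<alpha> * of_nat k))
            * (\<Prod>(b, \<beta>)\<leftarrow>[(\<rho> + p + \<beta>', 2), (\<rho> + p + \<gamma> - \<alpha> - \<alpha>', 2), (\<rho> + p + \<gamma> - \<alpha>' - \<beta>, 2), (\<kappa>, 1)]. rGamma (b + \<beta> * of_nat k))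
            * z ^ k / fact k)"
    proof
      fix k
      have e: "s k + \<gamma> - \<alpha> - \<alpha>' - \<beta> = \<rho> + p + \<gamma> - \<alpha> - \<alpha>' - \<beta> + 2 * of_nat k"
        "s k + \<beta>' - \<alpha>' = \<rho> + p + \<beta>' - \<alpha>' + 2 * of_nat k"
        "s k + \<beta>' = \<rho> + p + \<beta>' + 2 * of_nat k"
        "s k + \<gamma> - \<alpha> - \<alpha>' = \<rho> + p + \<gamma> - \<alpha> - \<alpha>' + 2 * of_nat k"
        "s k + \<gamma> - \<alpha>' - \<beta> = \<rho> + p + \<gamma> - \<alpha>' - \<beta> + 2 * of_nat k"
        by (simp_all add: s_def)
      have e': "s k = \<rho> + p + 2 * of_nat k" by (simp add: s_def)
      show "d k * V (s k) = (\<Prod>(a, \<alpha>)\<leftarrow>[(\<rho> + p, 2), (\<rho> + p + \<gamma> - \<alpha> - \<alpha>' - \<beta>, 2), (\<rho> + p + \<beta>' - \<alpha>', 2)]. Gamma (a + \<alpha> * of_nat k))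
            * (\<Prod>(b, \<beta>)\<leftarrow>[(\<rho> + p + \<beta>', 2), (\<rho> + p + \<gamma> - \<alpha> - \<alpha>', 2), (\<rho> + p + \<gamma> - \<alpha>' - \<beta>, 2), (\<kappa>, 1)]. rGamma (b + \<beta> * of_nat k))
            * z ^ k / fact k"
        unfolding V_def d_def
        by (subst e(1), subst e(2), subst e(3), subst e(4), subst e(5), subst e') (simp add: mult_ac)
    qed
    finally show ?thesis by (simp only: wright_psi_def)
  qed
  have powx: "of_real x powr (- \<alpha>) * (of_real x * of_real x powr (\<gamma> - \<alpha>' + \<rho> + p - 2)) =
      complex_of_real x powr (\<rho> + p - \<alpha> - \<alpha>' + \<gamma> - 1)"
  proof -
    have "complex_of_real x = of_real x powr 1" using x by simp
    hence "of_real x powr (- \<alpha>) * (of_real x * of_real x powr (\<gamma> - \<alpha>' + \<rho> + p - 2)) =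
      complex_of_real x powr (- \<alpha>) * (of_real x powr 1 * of_real x powr (\<gamma> - \<alpha>' + \<rho> + p - 2))" by simp
    also have "\<dots> = complex_of_real x powr (\<rho> + p - \<alpha> - \<alpha>' + \<gamma> - 1)"
      unfolding powr_add [symmetric] by (rule arg_cong) (simp add: algebra_simps)
    finally show ?thesis .
  qed
  have "saigo_maeda_I \<alpha> \<alpha>' \<beta> \<beta>' \<gamma> (\<lambda>t. of_real t powr (\<rho> - 1) * gen_bessel p b c (of_real t)) x
      = of_real x powr (- \<alpha>) / Gamma \<gamma> * (LINT t:{0<..<x}|lborel. g t)"
    unfolding saigo_maeda_I_def g_def ..
  also have "\<dots> = (of_real x powr (- \<alpha>) * (of_real x * of_real x powr (\<gamma> - \<alpha>' + \<rho> + p - 2))) / 2 powr p * wright_psi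
                 [(\<rho> + p, 2), (\<rho> + p + \<gamma> - \<alpha> - \<alpha>' - \<beta>, 2), (\<rho> + p + \<beta>' - \<alpha>', 2)]
                 [(\<rho> + p + \<beta>', 2), (\<rho> + p + \<gamma> - \<alpha> - \<alpha>', 2), (\<rho> + p + \<gamma> - \<alpha>' - \<beta>, 2), (\<kappa>, 1)] z"
    unfolding int_g wright M_def using G0 by simp
  finally show ?thesis
    using 1 unfolding powx g_def \<kappa>_def z_def by blast
qed

end
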